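(* Let $\mathcal H$ be a complex separable Hilbert space with an orthonormal basis $\{\xi_j\}_{0\le j<\omega}$, where $\omega\in\mathbb N\cup\{\aleph_0\}$. Consider the Banach-Lie group $G:=\mathrm{GL}(\mathcal H)$ of all invertible bounded linear operators on $\mathcal H$, and its subgroups $$K:=\{k\in G\mid k^*k=\mathbf 1\},\quad A:=\{a\in G\mid a\xi_j\in\mathbb R_+^*\xi_j\text{ whenever }0\le j<\omega\},$$ $$N:=\{n\in G\mid n\xi_j\in\xi_j+\mathrm{span}\{\xi_l\mid l<j\}\text{ whenever }0\le j<\omega\}.$$ Consider also the Banach-Lie algebra $\mathfrak g=\mathcal B(\mathcal H)$, with its closed real Lie subalgebras $$\mathfrak k:=\{X\in\mathfrak g\mid X^*=-X\},\quad \mathfrak a:=\{Y\in\mathfrak g\mid Y\xi_j\in\mathbb R\xi_j\text{ whenever }0\le j<\omega\},$$ $$\mathfrak n:=\{Z\in\mathfrak g\mid Z\xi_j\in\mathrm{span}\{\xi_l\mid l<j\}\text{ whenever }0\le j<\omega\}.$$ Then the following assertions hold: (1) $K$, $A$, and $N$ are Banach-Lie groups with the corresponding Lie algebras $\mathfrak k$, $\mathfrak a$, and $\mathfrak n$, respectively, and the multiplication map $\mathbf m\colon K\times A\times N\to G$, $(k,a,n)\mapsto kan$, is smooth and bijective. (2) The mapping $\mathbf m$ is a diffeomorphism if and only if $\mathfrak k\dotplus\mathfrak a\dotplus\mathfrak n=\mathfrak g$, and this equality holds if and only if the Hilbert space $\mathcal H$ is finite-dimensional.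
   Context: $\mathcal B(\mathcal H)$ is the algebra of bounded linear operators on $\mathcal H$ with the operator norm and the commutator bracket; $\mathbb R_+^*=(0,\infty)$; $\dotplus$ denotes a direct sum of real linear subspaces. Indices $j,l$ are non-negative integers. $\mathrm{GL}(\mathcal H)$ is an open subset of $\mathcal B(\mathcal H)$; $K,A,N$ carry the norm topology, and the Lie algebra of such a subgroup $S$ is $\{X\in\mathcal B(\mathcal H)\mid \exp(tX)\in S\text{ for all }t\in\mathbb R\}$. *)

theory Defs
  imports "HOL-Analysis.Analysis" "HOL-Library.Extended_Nat" "HOL-Algebra.Group"
begin

section \<open>Complex Hilbert spaces\<close>

text \<open>The real structure underlying a complex Hilbert space (norm, topology, real inner product)
  is the one of the type classes of the library; the last two axioms tie the complex structure to it.
  The norm is therefore the usual one, as \<^term>\<open>Re (cinner x x) = norm x ^ 2\<close>. The form is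
  linear in the first and conjugate linear in the second argument.\<close>

class complex_hilbert = real_inner + banach +
  fixes scaleC :: "complex \<Rightarrow> 'a \<Rightarrow> 'a" (infixr "*\<^sub>C" 75)
    and cinner :: "'a \<Rightarrow> 'a \<Rightarrow> complex"
  assumes scaleC_add_right: "a *\<^sub>C (x + y) = a *\<^sub>C x + a *\<^sub>C y"
    and scaleC_add_left: "(a + b) *\<^sub>C x = a *\<^sub>C x + b *\<^sub>C x"
    and scaleC_scaleC: "a *\<^sub>C b *\<^sub>C x = (a * b) *\<^sub>C x"
    and scaleC_one: "1 *\<^sub>C x = x"
    and cinner_commute: "cinner x y = cnj (cinner y x)"
    and cinner_add_left: "cinner (x + y) z = cinner x z + cinner y z"
    and cinner_scaleC_left: "cinner (a *\<^sub>C x) y = a * cinner x y"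
    and scaleR_eq_scaleC: "r *\<^sub>R x = complex_of_real r *\<^sub>C x"
    and inner_eq_Re_cinner: "inner x y = Re (cinner x y)"

global_interpretation complex_vector: vector_space "scaleC :: complex \<Rightarrow> 'a \<Rightarrow> 'a::complex_hilbert"
  by unfold_locales (simp_all add: scaleC_add_right scaleC_add_left scaleC_scaleC scaleC_one)

abbreviation cspan :: "'a::complex_hilbert set \<Rightarrow> 'a set"
  where "cspan \<equiv> complex_vector.span"

definition finite_dimensional :: "'a::complex_hilbert itself \<Rightarrow> bool"
  where "finite_dimensional _ \<longleftrightarrow> (\<exists>B::'a set. finite B \<and> cspan B = UNIV)"

text \<open>Only the values of \<open>\<xi>\<close> at indices below \<open>\<omega>\<close> matter, here and below.\<close>

definition orthonormal_basis :: "enat \<Rightarrow> (nat \<Rightarrow> 'a::complex_hilbert) \<Rightarrow> bool"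
  where "orthonormal_basis \<omega> \<xi> \<longleftrightarrow>
    (\<forall>j l. enat j < \<omega> \<longrightarrow> enat l < \<omega> \<longrightarrow> cinner (\<xi> j) (\<xi> l) = (if j = l then 1 else 0)) \<and>
    closure (cspan {\<xi> j |j. enat j < \<omega>}) = UNIV"


section \<open>Bounded operators\<close>

text \<open>Bounded complex linear operators are the bounded real linear ones that commute with complex
  scalars; the norm of \<^typ>\<open>'a \<Rightarrow>\<^sub>L 'a\<close> is the operator norm.\<close>

definition bounded_operators :: "('a::complex_hilbert \<Rightarrow>\<^sub>L 'a) set"
  where "bounded_operators = {T. \<forall>c x. blinfun_apply T (c *\<^sub>C x) = c *\<^sub>C blinfun_apply T x}"

definition GL :: "('a::complex_hilbert \<Rightarrow>\<^sub>L 'a) monoid"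
  where "GL = units_of \<lparr>carrier = bounded_operators, mult = (o\<^sub>L), one = id_blinfun\<rparr>"

definition cadjoint :: "('a::complex_hilbert \<Rightarrow>\<^sub>L 'a) \<Rightarrow> ('a \<Rightarrow>\<^sub>L 'a)"
  where "cadjoint T =
    (THE S. \<forall>x y. cinner (blinfun_apply T x) y = cinner x (blinfun_apply S y))"

definition op_exp :: "('a::complex_hilbert \<Rightarrow>\<^sub>L 'a) \<Rightarrow> ('a \<Rightarrow>\<^sub>L 'a)"
  where "op_exp X = (\<Sum>n. (1 / fact n) *\<^sub>R (((o\<^sub>L) X ^^ n) id_blinfun))"

definition closed_real_lie_subalgebra :: "('a::complex_hilbert \<Rightarrow>\<^sub>L 'a) set \<Rightarrow> bool"
  where "closed_real_lie_subalgebra L \<longleftrightarrow>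
    L \<subseteq> bounded_operators \<and> subspace L \<and> closed L \<and>
    (\<forall>X\<in>L. \<forall>Y\<in>L. (X o\<^sub>L Y) - (Y o\<^sub>L X) \<in> L)"

definition lie_algebra :: "('a::complex_hilbert \<Rightarrow>\<^sub>L 'a) set \<Rightarrow> ('a \<Rightarrow>\<^sub>L 'a) set"
  where "lie_algebra S = {X \<in> bounded_operators. \<forall>t::real. op_exp (t *\<^sub>R X) \<in> S}"

definition direct_sum3 :: "'v::real_vector set \<Rightarrow> 'v set \<Rightarrow> 'v set \<Rightarrow> 'v set \<Rightarrow> bool"
  where "direct_sum3 U V W M \<longleftrightarrow>
    {u + v + w |u v w. u \<in> U \<and> v \<in> V \<and> w \<in> W} = M \<and>
    (\<forall>u\<in>U. \<forall>v\<in>V. \<forall>w\<in>W. u + v + w = 0 \<longrightarrow> u = 0 \<and> v = 0 \<and> w = 0)"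


section \<open>Smooth maps on open subsets of closed subspaces\<close>

text \<open>A \<open>k\<close>-linear map on \<open>E\<close> is represented as a function on lists of length \<open>k\<close> over \<open>E\<close>.\<close>

definition bounded_multilinear_on ::
  "'v::real_normed_vector set \<Rightarrow> nat \<Rightarrow> ('v list \<Rightarrow> 'w::real_normed_vector) \<Rightarrow> bool"
  where "bounded_multilinear_on E k m \<longleftrightarrow>
    (\<forall>vs\<in>lists E. \<forall>i<k. \<forall>v\<in>E. \<forall>w\<in>E. \<forall>a b. length vs = k \<longrightarrow>
       m (vs[i := a *\<^sub>R v + b *\<^sub>R w]) = a *\<^sub>R m (vs[i := v]) + b *\<^sub>R m (vs[i := w])) \<and>
    (\<exists>C. \<forall>vs\<in>lists E. length vs = k \<longrightarrow> norm (m vs) \<le> C * prod_list (map norm vs))"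

text \<open>Smooth means having Frechet derivatives of all orders: \<open>D k x\<close> is the \<open>k\<close>-th derivative at
  \<open>x\<close>, a bounded \<open>k\<close>-linear map on the model space \<open>E\<close>, and the last clause says that
  \<open>D (Suc k) x\<close> is the Frechet derivative at \<open>x\<close> of \<open>D k\<close> for the norm of \<open>k\<close>-linear maps.\<close>

definition smooth_on ::
  "'v::real_normed_vector set \<Rightarrow> 'v set \<Rightarrow> ('v \<Rightarrow> 'w::real_normed_vector) \<Rightarrow> bool"
  where "smooth_on E U f \<longleftrightarrow>
    openin (top_of_set E) U \<and>
    (\<exists>D :: nat \<Rightarrow> 'v \<Rightarrow> 'v list \<Rightarrow> 'w.
      (\<forall>x\<in>U. D 0 x [] = f x) \<and>
      (\<forall>k. \<forall>x\<in>U. bounded_multilinear_on E k (D k x)) \<and>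
      (\<forall>k. \<forall>x\<in>U. \<forall>\<epsilon>>0. \<exists>\<delta>>0. \<forall>y\<in>U. norm (y - x) < \<delta> \<longrightarrow>
        (\<forall>vs\<in>lists E. length vs = k \<longrightarrow>
          norm (D k y vs - D k x vs - D (Suc k) x ((y - x) # vs))
            \<le> \<epsilon> * norm (y - x) * prod_list (map norm vs))))"


section \<open>Banach manifolds and Banach-Lie groups\<close>

text \<open>The points carry the subspace topology of the ambient type (for sets of operators: the norm
  topology). A chart is a pair of its domain and its coordinate map into the model space, which is
  a closed real subspace of a Banach space.\<close>

record ('p, 'e) manifold =
  points :: "'p set"
  model_space :: "'e set"
  charts :: "('p set \<times> ('p \<Rightarrow> 'e)) set"

definition banach_manifold :: "('p::t2_space, 'e::banach) manifold \<Rightarrow> bool"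
  where "banach_manifold M \<longleftrightarrow>
    subspace (model_space M) \<and> closed (model_space M) \<and>
    (\<Union>(U, \<phi>)\<in>charts M. U) = points M \<and>
    (\<forall>(U, \<phi>)\<in>charts M.
       openin (top_of_set (points M)) U \<and>
       openin (top_of_set (model_space M)) (\<phi> ` U) \<and>
       inj_on \<phi> U \<and> homeomorphism U (\<phi> ` U) \<phi> (the_inv_into U \<phi>)) \<and>
    (\<forall>(U, \<phi>)\<in>charts M. \<forall>(V, \<psi>)\<in>charts M.
       smooth_on (model_space M) (\<phi> ` (U \<inter> V)) (\<psi> \<circ> the_inv_into U \<phi>))"

definition smooth_map ::
  "('p::topological_space, 'e::banach) manifold \<Rightarrow> ('q::topological_space, 'f::banach) manifold \<Rightarrow>
   ('p \<Rightarrow> 'q) \<Rightarrow> bool"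
  where "smooth_map M N f \<longleftrightarrow>
    f ` points M \<subseteq> points N \<and> continuous_on (points M) f \<and>
    (\<forall>(U, \<phi>)\<in>charts M. \<forall>(V, \<psi>)\<in>charts N.
       smooth_on (model_space M) (\<phi> ` (U \<inter> f -` V)) (\<psi> \<circ> f \<circ> the_inv_into U \<phi>))"

definition diffeo ::
  "('p::topological_space, 'e::banach) manifold \<Rightarrow> ('q::topological_space, 'f::banach) manifold \<Rightarrow>
   ('p \<Rightarrow> 'q) \<Rightarrow> bool"
  where "diffeo M N f \<longleftrightarrow>
    bij_betw f (points M) (points N) \<and> smooth_map M N f \<and>
    smooth_map N M (the_inv_into (points M) f)"

definition open_submanifold :: "'e::banach set \<Rightarrow> 'e set \<Rightarrow> ('e, 'e) manifold"
  where "open_submanifold E U = \<lparr>points = U, model_space = E, charts = {(U, \<lambda>x. x)}\<rparr>"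

definition prod_manifold ::
  "('p, 'e) manifold \<Rightarrow> ('q, 'f) manifold \<Rightarrow> ('p \<times> 'q, 'e \<times> 'f) manifold"
  where "prod_manifold M N =
    \<lparr>points = points M \<times> points N, model_space = model_space M \<times> model_space N,
     charts = {(U \<times> V, map_prod \<phi> \<psi>) |U \<phi> V \<psi>. (U, \<phi>) \<in> charts M \<and> (V, \<psi>) \<in> charts N}\<rparr>"

definition banach_lie_group :: "'p::t2_space monoid \<Rightarrow> ('p, 'e::banach) manifold \<Rightarrow> bool"
  where "banach_lie_group G M \<longleftrightarrow>
    group G \<and> banach_manifold M \<and> points M = carrier G \<and>
    smooth_map (prod_manifold M M) M (\<lambda>(x, y). x \<otimes>\<^bsub>G\<^esub> y) \<and>
    smooth_map M M (m_inv G)"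

text \<open>\<open>M\<close> is a smooth structure that turns the subgroup \<open>S\<close> of \<open>GL\<close>, with its norm topology, into a
  Banach-Lie group with Lie algebra \<open>L\<close>, modelled on \<open>L\<close>. Charts are not required to extend to the
  ambient operator space, and \<open>L\<close> need not be complemented in it.\<close>

definition lie_group_structure ::
  "('a::complex_hilbert \<Rightarrow>\<^sub>L 'a) set \<Rightarrow> ('a \<Rightarrow>\<^sub>L 'a) set \<Rightarrow>
   ('a \<Rightarrow>\<^sub>L 'a, 'a \<Rightarrow>\<^sub>L 'a) manifold \<Rightarrow> bool"
  where "lie_group_structure S L M \<longleftrightarrow>
    subgroup S GL \<and> closed_real_lie_subalgebra L \<and> lie_algebra S = L \<and>
    model_space M = L \<and> banach_lie_group (GL\<lparr>carrier := S\<rparr>) M"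


section \<open>The subgroups and subalgebras of the Iwasawa decomposition\<close>

definition K_group :: "('a::complex_hilbert \<Rightarrow>\<^sub>L 'a) set"
  where "K_group = {k \<in> carrier GL. cadjoint k o\<^sub>L k = id_blinfun}"

definition A_group :: "enat \<Rightarrow> (nat \<Rightarrow> 'a::complex_hilbert) \<Rightarrow> ('a \<Rightarrow>\<^sub>L 'a) set"
  where "A_group \<omega> \<xi> = {a \<in> carrier GL. \<forall>j. enat j < \<omega> \<longrightarrow>
    blinfun_apply a (\<xi> j) \<in> {r *\<^sub>R \<xi> j |r::real. r > 0}}"

definition N_group :: "enat \<Rightarrow> (nat \<Rightarrow> 'a::complex_hilbert) \<Rightarrow> ('a \<Rightarrow>\<^sub>L 'a) set"
  where "N_group \<omega> \<xi> = {n \<in> carrier GL. \<forall>j. enat j < \<omega> \<longrightarrow>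
    blinfun_apply n (\<xi> j) \<in> {\<xi> j + v |v. v \<in> cspan {\<xi> l |l. l < j}}}"

definition k_algebra :: "('a::complex_hilbert \<Rightarrow>\<^sub>L 'a) set"
  where "k_algebra = {X \<in> bounded_operators. cadjoint X = - X}"

definition a_algebra :: "enat \<Rightarrow> (nat \<Rightarrow> 'a::complex_hilbert) \<Rightarrow> ('a \<Rightarrow>\<^sub>L 'a) set"
  where "a_algebra \<omega> \<xi> = {Y \<in> bounded_operators. \<forall>j. enat j < \<omega> \<longrightarrow>
    blinfun_apply Y (\<xi> j) \<in> {r *\<^sub>R \<xi> j |r::real. True}}"

definition n_algebra :: "enat \<Rightarrow> (nat \<Rightarrow> 'a::complex_hilbert) \<Rightarrow> ('a \<Rightarrow>\<^sub>L 'a) set"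
  where "n_algebra \<omega> \<xi> = {Z \<in> bounded_operators. \<forall>j. enat j < \<omega> \<longrightarrow>
    blinfun_apply Z (\<xi> j) \<in> cspan {\<xi> l |l. l < j}}"

definition iwasawa_mult ::
  "('a::complex_hilbert \<Rightarrow>\<^sub>L 'a) \<times> ('a \<Rightarrow>\<^sub>L 'a) \<times> ('a \<Rightarrow>\<^sub>L 'a) \<Rightarrow> ('a \<Rightarrow>\<^sub>L 'a)"
  where "iwasawa_mult = (\<lambda>(k, a, n). k o\<^sub>L a o\<^sub>L n)"

end

theory Submission
  imports Defs
begin

text \<open>The group \<open>K\<close> is covered by Cayley charts, while \<open>A\<close> and \<open>N - 1\<close> are open in \<open>a_algebra\<close> and
  \<open>n_algebra\<close>; all maps between charts are polynomials in operators and their inverses, hence smooth.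
  Bijectivity of the multiplication is Gram-Schmidt orthogonalization: subtracting from \<open>\<xi>\<^sub>j\<close> the
  solution of the normal equations on the preceding basis vectors yields \<open>n\<^sup>-\<^sup>1 \<xi>\<^sub>j\<close>. In finite
  dimension this also expresses \<open>k\<close>, \<open>a\<close>, \<open>n\<close> smoothly through \<open>g\<close>. Conversely, if the inverse of the
  multiplication is smooth, differentiating it along \<open>1 + t W\<close> at \<open>t = 0\<close> decomposes \<open>W\<close>. In infinite
  dimension the sum of the three subalgebras is a proper subspace, because triangular truncation is
  unbounded on operators, as the Hilbert matrix \<open>\<i> / (j - l)\<close> shows.\<close>

section \<open>Smooth families of multilinear maps\<close>

text \<open>A chain rule for all orders would need the combinatorics of higher derivatives of
  compositions. It is avoided: charts are rational in operators, so composing a smooth map with a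
  chart is smooth by inspection, and this property takes the place of the chain rule in the criteria
  for manifolds. Only inversion and the inverse square root need an argument of their own. In
  infinite dimension \<open>n\<close> cannot be produced column by column, since a matrix with
  bounded columns may be unbounded. Hence only \<open>k\<close> and \<open>a\<close> are built from
  images of the basis, which are orthogonal, and \<open>n\<close> is what remains of
  \<open>g\<close>. The bounds for the diagonal come from \<open>norm g\<close> and
  \<open>norm (op_inv g)\<close>. The equivalences form a cycle: finite dimension gives a smooth
  inverse, this gives the direct sum, and the direct sum fails for
  \<open>\<omega> = \<infinity>\<close>. There, no boundedness of the projections is deduced from
  the direct sum; a single operator is summed up from truncated Hilbert matrices of rapidly growing
  size, whose component in \<open>n_algebra\<close> would exceed every bound.\<close>

lemma bounded_multilinear_on_bound:
  assumes "bounded_multilinear_on E k m"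
  obtains C where "C \<ge> 0"
    "\<And>vs. vs \<in> lists E \<Longrightarrow> length vs = k \<Longrightarrow> norm (m vs) \<le> C * prod_list (map norm vs)"
proof -
  obtain C where C: "\<forall>vs\<in>lists E. length vs = k \<longrightarrow> norm (m vs) \<le> C * prod_list (map norm vs)"
    using assms unfolding bounded_multilinear_on_def by blast
  have "norm (m vs) \<le> max C 0 * prod_list (map norm vs)" if "vs \<in> lists E" "length vs = k" for vs
  proof -
    have "0 \<le> prod_list (map norm vs)" by (rule prod_list_nonneg) auto
    then have "C * prod_list (map norm vs) \<le> max C 0 * prod_list (map norm vs)"
      by (intro mult_right_mono) auto
    then show ?thesis using C that by fastforce
  qed
  then show ?thesis using that[of "max C 0"] by simp
qed

lemma prod_list_norm_nonneg: "0 \<le> prod_list (map norm (vs :: 'v::real_normed_vector list))"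
  by (rule prod_list_nonneg) auto

text \<open>The arguments of a product of two multilinear maps are shared out by a set of positions.
  Norm bounds of the two factors thereby multiply to a bound in terms of the full list.\<close>

lemma prod_list_norm_nths:
  "prod_list (map norm vs) =
     prod_list (map norm (nths vs I)) * prod_list (map norm (nths (vs::'v::real_normed_vector list) (- I)))"
proof (induction vs arbitrary: I)
  case (Cons v vs)
  have "{j. Suc j \<in> - I} = - {j. Suc j \<in> I}" by auto
  then show ?case using Cons[of "{j. Suc j \<in> I}"] by (simp add: nths_Cons)
qed simp

text \<open>Position \<open>i\<close> belongs to exactly one of \<open>I\<close> and
  \<open>- I\<close>, so an update touches one factor of a product and leaves the other constant;
  multilinearity of the product reduces to that of one factor. The witness \<open>p\<close> is the
  rank of \<open>i\<close> within \<open>I\<close>.\<close>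

lemma nths_list_update:
  assumes "i < length xs"
  shows "if i \<in> I then \<exists>p < length (nths xs I). \<forall>v. nths (xs[i := v]) I = (nths xs I)[p := v]
         else \<forall>v. nths (xs[i := v]) I = nths xs I"
proof -
  define ys zs where "ys = take i xs" and "zs = drop (Suc i) xs"
  have xs: "xs = ys @ xs ! i # zs" and ly: "length ys = i"
    using assms by (simp_all add: ys_def zs_def id_take_nth_drop)
  have up: "xs[i := v] = ys @ v # zs" for v
    using assms by (simp add: ys_def zs_def upd_conv_take_nth_drop)
  have n: "nths (ys @ v # zs) I =
      nths ys I @ (if i \<in> I then [v] else []) @ nths zs {j. Suc j + i \<in> I}" for v
    by (simp add: nths_append nths_Cons ly)
  show ?thesis
  proof (cases "i \<in> I")
    case True
    have "nths (xs[i := v]) I = (nths xs I)[length (nths ys I) := v]" for v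
      using n[of v] n[of "xs ! i"] True up xs by simp
    moreover have "length (nths ys I) < length (nths xs I)"
      using n[of "xs ! i"] True xs by simp
    ultimately show ?thesis using True by auto
  next
    case False
    then show ?thesis using n[of "xs ! i"] n up xs by simp
  qed
qed

lemma length_nths_split:
  assumes "I \<subseteq> {..<a + b}" "card I = a" "length vs = a + b"
  shows "length (nths vs I) = a" "length (nths vs (- I)) = b"
proof -
  have "{i. i < length vs \<and> i \<in> I} = I" using assms by auto
  then show "length (nths vs I) = a" using assms by (simp add: length_nths)
  have "{i. i < length vs \<and> i \<in> - I} = {..<a + b} - I" using assms by auto
  moreover have "card ({..<a + b} - I) = b"
    using assms by (simp add: card_Diff_subset finite_subset[OF assms(1)])
  ultimately show "length (nths vs (- I)) = b" by (simp add: length_nths)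
qed

lemma nths_in_lists: "vs \<in> lists E \<Longrightarrow> nths vs I \<in> lists E"
  by (metis in_listsI in_listsD in_set_nthsD)

lemma bounded_multilinear_on_linear:
  assumes "bounded_multilinear_on E k m" "vs \<in> lists E" "length vs = k" "i < k" "v \<in> E" "w \<in> E"
  shows "m (vs[i := a *\<^sub>R v + b *\<^sub>R w]) = a *\<^sub>R m (vs[i := v]) + b *\<^sub>R m (vs[i := w])"
  using assms unfolding bounded_multilinear_on_def by blast

text \<open>Arbitrary position sets \<open>I\<close>, not only initial segments, have to be allowed:
  the Leibniz rule hands each new direction to either factor, so after several derivatives the
  arguments of the factors are interleaved.\<close>

lemma bounded_multilinear_on_product:
  fixes B :: "'w::real_normed_vector \<Rightarrow> 'w \<Rightarrow> 'w"
  assumes B: "bounded_bilinear B"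
    and m: "bounded_multilinear_on E a m1" "bounded_multilinear_on E b m2"
    and I: "I \<subseteq> {..<a + b}" "card I = a"
  shows "bounded_multilinear_on E (a + b) (\<lambda>vs. B (m1 (nths vs I)) (m2 (nths vs (- I))))"
proof -
  interpret bounded_bilinear B by fact
  obtain K where K: "K \<ge> 0" "\<And>x y. norm (B x y) \<le> norm x * norm y * K" using nonneg_bounded by blast
  obtain C1 where C1: "C1 \<ge> 0"
    "\<And>vs. vs \<in> lists E \<Longrightarrow> length vs = a \<Longrightarrow> norm (m1 vs) \<le> C1 * prod_list (map norm vs)"
    using bounded_multilinear_on_bound[OF m(1)] by blast
  obtain C2 where C2: "C2 \<ge> 0"
    "\<And>vs. vs \<in> lists E \<Longrightarrow> length vs = b \<Longrightarrow> norm (m2 vs) \<le> C2 * prod_list (map norm vs)"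
    using bounded_multilinear_on_bound[OF m(2)] by blast
  have "B (m1 (nths (vs[i := c *\<^sub>R v + d *\<^sub>R w]) I)) (m2 (nths (vs[i := c *\<^sub>R v + d *\<^sub>R w]) (- I))) =
      c *\<^sub>R B (m1 (nths (vs[i := v]) I)) (m2 (nths (vs[i := v]) (- I))) +
      d *\<^sub>R B (m1 (nths (vs[i := w]) I)) (m2 (nths (vs[i := w]) (- I)))"
    if vs: "vs \<in> lists E" "length vs = a + b" and i: "i < a + b" and vw: "v \<in> E" "w \<in> E" for vs i v w c d
  proof (cases "i \<in> I")
    case True
    obtain p where p: "p < a" "\<And>v. nths (vs[i := v]) I = (nths vs I)[p := v]"
      using nths_list_update[of i vs I] True i vs(2) length_nths_split[OF I vs(2)] by auto
    have q: "\<And>v. nths (vs[i := v]) (- I) = nths vs (- I)"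
      using nths_list_update[of i vs "- I"] True i vs(2) by auto
    show ?thesis
      unfolding p(2) q
      using bounded_multilinear_on_linear[OF m(1) nths_in_lists[OF vs(1)] length_nths_split(1)[OF I vs(2)] p(1) vw]
      by (simp add: add_left scaleR_left)
  next
    case False
    obtain p where p: "p < b" "\<And>v. nths (vs[i := v]) (- I) = (nths vs (- I))[p := v]"
      using nths_list_update[of i vs "- I"] False i vs(2) length_nths_split[OF I vs(2)] by auto
    have q: "\<And>v. nths (vs[i := v]) I = nths vs I"
      using nths_list_update[of i vs I] False i vs(2) by auto
    show ?thesis
      unfolding p(2) q
      using bounded_multilinear_on_linear[OF m(2) nths_in_lists[OF vs(1)] length_nths_split(2)[OF I vs(2)] p(1) vw]
      by (simp add: add_right scaleR_right)
  qed
  moreover have "norm (B (m1 (nths vs I)) (m2 (nths vs (- I)))) \<le> (C1 * C2 * K) * prod_list (map norm vs)"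
    if vs: "vs \<in> lists E" "length vs = a + b" for vs
  proof -
    have "norm (m1 (nths vs I)) * norm (m2 (nths vs (- I))) \<le>
        (C1 * prod_list (map norm (nths vs I))) * (C2 * prod_list (map norm (nths vs (- I))))"
      using C1 C2 vs length_nths_split[OF I vs(2)] nths_in_lists[OF vs(1)]
      by (intro mult_mono) (auto intro!: mult_nonneg_nonneg prod_list_norm_nonneg)
    also have "\<dots> = C1 * C2 * prod_list (map norm vs)"
      by (simp add: prod_list_norm_nths[of vs I] algebra_simps)
    finally show ?thesis using K by (smt (verit, best) ab_semigroup_mult_class.mult_ac(1) mult.commute mult_left_mono)
  qed
  ultimately show ?thesis unfolding bounded_multilinear_on_def by blast
qed

definition multilinear_derivative ::
  "'v::real_normed_vector set \<Rightarrow> 'v set \<Rightarrow> nat \<Rightarrow> ('v \<Rightarrow> 'v list \<Rightarrow> 'w::real_normed_vector) \<Rightarrow>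
    ('v \<Rightarrow> 'v list \<Rightarrow> 'w) \<Rightarrow> bool"
  where "multilinear_derivative E U k m m' \<longleftrightarrow> (\<forall>x\<in>U. \<forall>\<epsilon>>0. \<exists>\<delta>>0. \<forall>y\<in>U. norm (y - x) < \<delta> \<longrightarrow>
    (\<forall>vs\<in>lists E. length vs = k \<longrightarrow>
      norm (m y vs - m x vs - m' x ((y - x) # vs)) \<le> \<epsilon> * norm (y - x) * prod_list (map norm vs)))"

lemma multilinear_derivativeD:
  assumes "multilinear_derivative E U k m m'" "x \<in> U" "\<epsilon> > 0"
  obtains \<delta> where "\<delta> > 0" "\<And>y vs. y \<in> U \<Longrightarrow> norm (y - x) < \<delta> \<Longrightarrow> vs \<in> lists E \<Longrightarrow> length vs = k \<Longrightarrow>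
      norm (m y vs - m x vs - m' x ((y - x) # vs)) \<le> \<epsilon> * norm (y - x) * prod_list (map norm vs)"
  using assms unfolding multilinear_derivative_def by blast

text \<open>Compared with \<^const>\<open>smooth_on\<close>, the sequence of derivatives is hidden in a coinductive predicate,
  so that closure properties need not name the higher derivatives.\<close>

coinductive smooth_family ::
  "'v::real_normed_vector set \<Rightarrow> 'v set \<Rightarrow> nat \<Rightarrow> ('v \<Rightarrow> 'v list \<Rightarrow> 'w::real_normed_vector) \<Rightarrow> bool"
  for E U where
  "\<forall>x\<in>U. bounded_multilinear_on E k (m x) \<Longrightarrow> multilinear_derivative E U k m m' \<Longrightarrow>
   smooth_family E U (Suc k) m' \<Longrightarrow> smooth_family E U k m"

lemma smooth_on_iff_family:
  "smooth_on E U f \<longleftrightarrow> openin (top_of_set E) U \<and> (\<exists>m. smooth_family E U 0 m \<and> (\<forall>x\<in>U. m x [] = f x))"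
proof safe
  assume s: "smooth_on E U f"
  then show "openin (top_of_set E) U" by (simp add: smooth_on_def)
  obtain D where D: "\<forall>x\<in>U. D 0 x [] = f x" "\<And>k. \<forall>x\<in>U. bounded_multilinear_on E k (D k x)"
      "\<And>k. multilinear_derivative E U k (D k) (D (Suc k))"
    using s unfolding smooth_on_def multilinear_derivative_def by blast
  have "smooth_family E U k (D k)" for k
    by (coinduction arbitrary: k) (use D in blast)
  with D show "\<exists>m. smooth_family E U 0 m \<and> (\<forall>x\<in>U. m x [] = f x)" by blast
next
  fix m assume o: "openin (top_of_set E) U" and m: "smooth_family E U 0 m" "\<forall>x\<in>U. m x [] = f x"
  \<comment> \<open>The coinductive predicate yields one derivative at a time; dependent choice
    strings them into a sequence. The clause for \<open>k = 0\<close> pins its start to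
    \<open>m\<close>.\<close>
  have "\<exists>D. \<forall>k. (smooth_family E U k (D k) \<and> (k = 0 \<longrightarrow> D k = m)) \<and> multilinear_derivative E U k (D k) (D (Suc k))"
  proof (rule dependent_nat_choice)
    fix d k assume "smooth_family E U k d \<and> (k = 0 \<longrightarrow> d = m)"
    then have "smooth_family E U k d" by simp
    then show "\<exists>y. (smooth_family E U (Suc k) y \<and> (Suc k = 0 \<longrightarrow> y = m)) \<and> multilinear_derivative E U k d y"
      by cases blast
  qed (use m in blast)
  then obtain D where D: "\<And>k. smooth_family E U k (D k)" "D 0 = m"
      "\<And>k. multilinear_derivative E U k (D k) (D (Suc k))"
    by blast
  have "\<forall>x\<in>U. bounded_multilinear_on E k (D k x)" for k
    using D(1)[of k] by cases blast
  then show "smooth_on E U f"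
    unfolding smooth_on_def using o D m unfolding multilinear_derivative_def by blast
qed

lemma smooth_on_openin: "smooth_on E U f \<Longrightarrow> openin (top_of_set E) U"
  by (simp add: smooth_on_def)

lemma smooth_on_subset: "smooth_on E U f \<Longrightarrow> U \<subseteq> E"
  using openin_imp_subset smooth_on_openin by blast

lemma smooth_on_cong: "smooth_on E U f \<Longrightarrow> (\<And>x. x \<in> U \<Longrightarrow> g x = f x) \<Longrightarrow> smooth_on E U g"
  unfolding smooth_on_iff_family by auto

text \<open>The terms obtained from smooth families and one further function \<open>F\<close> by
  sums and products. \<open>F\<close> is not assumed to be smooth, which is the point: it may occur
  in its own derivative, as for the inverse of an operator.\<close>

inductive generated_family ::
  "'v::real_normed_vector set \<Rightarrow> 'v set \<Rightarrow> ('w::real_normed_vector \<Rightarrow> 'w \<Rightarrow> 'w) \<Rightarrow> ('v \<Rightarrow> 'w) \<Rightarrow>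
    nat \<Rightarrow> ('v \<Rightarrow> 'v list \<Rightarrow> 'w) \<Rightarrow> bool"
  for E U B F where
  smooth: "smooth_family E U k m \<Longrightarrow> generated_family E U B F k m"
| gen: "generated_family E U B F 0 (\<lambda>x vs. F x)"
| add: "generated_family E U B F k m1 \<Longrightarrow> generated_family E U B F k m2 \<Longrightarrow>
    generated_family E U B F k (\<lambda>x vs. m1 x vs + m2 x vs)"
| prod: "generated_family E U B F a m1 \<Longrightarrow> generated_family E U B F b m2 \<Longrightarrow>
    I \<subseteq> {..<a + b} \<Longrightarrow> card I = a \<Longrightarrow>
    generated_family E U B F (a + b) (\<lambda>x vs. B (m1 x (nths vs I)) (m2 x (nths vs (- I))))"

lemma multilinear_derivative_add:
  assumes "multilinear_derivative E U k m1 m1'" "multilinear_derivative E U k m2 m2'"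
  shows "multilinear_derivative E U k (\<lambda>x vs. m1 x vs + m2 x vs) (\<lambda>x vs. m1' x vs + m2' x vs)"
  unfolding multilinear_derivative_def
proof (intro ballI allI impI)
  fix x and e :: real assume x: "x \<in> U" and e: "0 < e"
  then have e2: "e / 2 > 0" by simp
  obtain d1 where d1: "d1 > 0" "\<And>y vs. y \<in> U \<Longrightarrow> norm (y - x) < d1 \<Longrightarrow> vs \<in> lists E \<Longrightarrow> length vs = k \<Longrightarrow>
      norm (m1 y vs - m1 x vs - m1' x ((y - x) # vs)) \<le> e / 2 * norm (y - x) * prod_list (map norm vs)"
    by (rule multilinear_derivativeD[OF assms(1) x e2]) blast
  obtain d2 where d2: "d2 > 0" "\<And>y vs. y \<in> U \<Longrightarrow> norm (y - x) < d2 \<Longrightarrow> vs \<in> lists E \<Longrightarrow> length vs = k \<Longrightarrow>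
      norm (m2 y vs - m2 x vs - m2' x ((y - x) # vs)) \<le> e / 2 * norm (y - x) * prod_list (map norm vs)"
    by (rule multilinear_derivativeD[OF assms(2) x e2]) blast
  have "norm (m1 y vs + m2 y vs - (m1 x vs + m2 x vs) - (m1' x ((y - x) # vs) + m2' x ((y - x) # vs)))
      \<le> e * norm (y - x) * prod_list (map norm vs)"
    if "y \<in> U" "norm (y - x) < min d1 d2" "vs \<in> lists E" "length vs = k" for y vs
  proof -
    have "norm (m1 y vs + m2 y vs - (m1 x vs + m2 x vs) - (m1' x ((y - x) # vs) + m2' x ((y - x) # vs)))
       = norm ((m1 y vs - m1 x vs - m1' x ((y - x) # vs)) + (m2 y vs - m2 x vs - m2' x ((y - x) # vs)))"
      by (simp add: algebra_simps)
    also have "\<dots> \<le> e / 2 * norm (y - x) * prod_list (map norm vs) + e / 2 * norm (y - x) * prod_list (map norm vs)"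
      using d1(2)[of y vs] d2(2)[of y vs] that by (intro norm_triangle_mono) auto
    also have "\<dots> = e * norm (y - x) * prod_list (map norm vs)" by (simp add: field_simps)
    finally show ?thesis .
  qed
  moreover have "min d1 d2 > 0" using d1 d2 by simp
  ultimately show "\<exists>\<delta>>0. \<forall>y\<in>U. norm (y - x) < \<delta> \<longrightarrow> (\<forall>vs\<in>lists E. length vs = k \<longrightarrow>
      norm (m1 y vs + m2 y vs - (m1 x vs + m2 x vs) - (m1' x ((y - x) # vs) + m2' x ((y - x) # vs)))
      \<le> e * norm (y - x) * prod_list (map norm vs))" by blast
qed

lemma bounded_multilinear_on_add:
  assumes "bounded_multilinear_on E k m1" "bounded_multilinear_on E k m2"
  shows "bounded_multilinear_on E k (\<lambda>vs. m1 vs + m2 vs)"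
proof -
  obtain C1 where C1: 
    "\<And>vs. vs \<in> lists E \<Longrightarrow> length vs = k \<Longrightarrow> norm (m1 vs) \<le> C1 * prod_list (map norm vs)"
    using bounded_multilinear_on_bound[OF assms(1)] by blast
  obtain C2 where C2: 
    "\<And>vs. vs \<in> lists E \<Longrightarrow> length vs = k \<Longrightarrow> norm (m2 vs) \<le> C2 * prod_list (map norm vs)"
    using bounded_multilinear_on_bound[OF assms(2)] by blast
  have "norm (m1 vs + m2 vs) \<le> (C1 + C2) * prod_list (map norm vs)"
    if "vs \<in> lists E" "length vs = k" for vs
    using norm_triangle_mono[OF C1[OF that] C2[OF that]] by (simp add: algebra_simps)
  moreover have "m1 (vs[i := a *\<^sub>R v + b *\<^sub>R w]) + m2 (vs[i := a *\<^sub>R v + b *\<^sub>R w]) =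
      a *\<^sub>R (m1 (vs[i := v]) + m2 (vs[i := v])) + b *\<^sub>R (m1 (vs[i := w]) + m2 (vs[i := w]))"
    if "vs \<in> lists E" "length vs = k" "i < k" "v \<in> E" "w \<in> E" for vs i v w a b
    using bounded_multilinear_on_linear[OF assms(1) that] bounded_multilinear_on_linear[OF assms(2) that]
    by (simp add: algebra_simps)
  ultimately show ?thesis unfolding bounded_multilinear_on_def by blast
qed

text \<open>The direction of the new derivative is put in front of the list, so the positions \<open>I\<close> of the
  arguments of the first factor are shifted by one.\<close>

lemma multilinear_derivative_product:
  fixes B :: "'w::real_normed_vector \<Rightarrow> 'w \<Rightarrow> 'w"
  assumes B: "bounded_bilinear B" and E: "subspace E" "U \<subseteq> E"
    and m: "\<forall>x\<in>U. bounded_multilinear_on E a (m1 x)" "\<forall>x\<in>U. bounded_multilinear_on E b (m2 x)"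
    and m': "\<forall>x\<in>U. bounded_multilinear_on E (Suc a) (m1' x)" "\<forall>x\<in>U. bounded_multilinear_on E (Suc b) (m2' x)"
    and d: "multilinear_derivative E U a m1 m1'" "multilinear_derivative E U b m2 m2'"
    and I: "I \<subseteq> {..<a + b}" "card I = a"
  shows "multilinear_derivative E U (a + b) (\<lambda>x vs. B (m1 x (nths vs I)) (m2 x (nths vs (- I))))
    (\<lambda>x vs. B (m1' x (nths vs (insert 0 (Suc ` I)))) (m2 x (nths vs (- insert 0 (Suc ` I)))) +
            B (m1 x (nths vs (Suc ` I))) (m2' x (nths vs (- Suc ` I))))"
  unfolding multilinear_derivative_def
proof (intro ballI allI impI)
  interpret bounded_bilinear B by fact
  obtain K where K: "K > 0" "\<And>x y. norm (B x y) \<le> norm x * norm y * K" using pos_bounded by blast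
  fix x and e :: real assume x: "x \<in> U" and e: "0 < e"
  obtain C1 where C1: "C1 \<ge> 0"
    "\<And>vs. vs \<in> lists E \<Longrightarrow> length vs = a \<Longrightarrow> norm (m1 x vs) \<le> C1 * prod_list (map norm vs)"
    using bounded_multilinear_on_bound m(1) x by (metis (full_types))
  obtain C2 where C2: "C2 \<ge> 0"
    "\<And>vs. vs \<in> lists E \<Longrightarrow> length vs = b \<Longrightarrow> norm (m2 x vs) \<le> C2 * prod_list (map norm vs)"
    using bounded_multilinear_on_bound m(2) x by (metis (full_types))
  obtain C1' where C1': "C1' \<ge> 0"
    "\<And>vs. vs \<in> lists E \<Longrightarrow> length vs = Suc a \<Longrightarrow> norm (m1' x vs) \<le> C1' * prod_list (map norm vs)"
    using bounded_multilinear_on_bound m'(1) x by (metis (full_types))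
  obtain C2' where C2': "C2' \<ge> 0"
    "\<And>vs. vs \<in> lists E \<Longrightarrow> length vs = Suc b \<Longrightarrow> norm (m2' x vs) \<le> C2' * prod_list (map norm vs)"
    using bounded_multilinear_on_bound m'(2) x by (metis (full_types))
  \<comment> \<open>Each of three error terms is to take a third of the bound. The fraction serves
    the two that contain a remainder of one factor; the cap 1 makes the increments of
    \<open>m1\<close> and \<open>m2\<close> Lipschitz with constants \<open>C1' + 1\<close> and
    \<open>C2' + 1\<close>.\<close>
  define r where "r = min 1 (e / (3 * K * (C1 + C2 + 1)))"
  have r: "r > 0" using e K C1 C2 by (simp add: r_def)
  have rC: "r * (C1 * K) \<le> e / 3" "r * (C2 * K) \<le> e / 3"
  proof -
    have "r \<le> e / (3 * K * (C1 + C2 + 1))" by (simp add: r_def)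
    then have *: "r * (3 * K * (C1 + C2 + 1)) \<le> e"
      using K C1 C2 by (simp add: pos_le_divide_eq)
    have "0 \<le> r * K * C1" "0 \<le> r * K * C2" "0 \<le> r * K" using r K C1 C2 by auto
    moreover have "r * (3 * K * (C1 + C2 + 1)) = 3 * (r * K * C1) + 3 * (r * K * C2) + 3 * (r * K)"
      by (simp add: algebra_simps)
    ultimately have "3 * (r * K * C1) \<le> e" "3 * (r * K * C2) \<le> e" using * by linarith+
    then show "r * (C1 * K) \<le> e / 3" "r * (C2 * K) \<le> e / 3" by (simp_all add: algebra_simps)
  qed
  obtain d1 where d1: "d1 > 0" "\<And>y vs. y \<in> U \<Longrightarrow> norm (y - x) < d1 \<Longrightarrow> vs \<in> lists E \<Longrightarrow> length vs = a \<Longrightarrow>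
      norm (m1 y vs - m1 x vs - m1' x ((y - x) # vs)) \<le> r * norm (y - x) * prod_list (map norm vs)"
    by (rule multilinear_derivativeD[OF d(1) x r]) blast
  obtain d2 where d2: "d2 > 0" "\<And>y vs. y \<in> U \<Longrightarrow> norm (y - x) < d2 \<Longrightarrow> vs \<in> lists E \<Longrightarrow> length vs = b \<Longrightarrow>
      norm (m2 y vs - m2 x vs - m2' x ((y - x) # vs)) \<le> r * norm (y - x) * prod_list (map norm vs)"
    by (rule multilinear_derivativeD[OF d(2) x r]) blast
  define M where "M = (C1' + 1) * (C2' + 1) * K"
  have M: "M > 0" using C1' C2' K by (simp add: M_def)
  define \<delta> where "\<delta> = min (min d1 d2) (e / (3 * M))"
  have "\<delta> > 0" using d1 d2 e M by (simp add: \<delta>_def)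
  moreover have "norm (B (m1 y (nths vs I)) (m2 y (nths vs (- I))) - B (m1 x (nths vs I)) (m2 x (nths vs (- I))) -
     (B (m1' x (nths ((y - x) # vs) (insert 0 (Suc ` I)))) (m2 x (nths ((y - x) # vs) (- insert 0 (Suc ` I)))) +
      B (m1 x (nths ((y - x) # vs) (Suc ` I))) (m2' x (nths ((y - x) # vs) (- Suc ` I)))))
      \<le> e * norm (y - x) * prod_list (map norm vs)" (is "norm ?L \<le> _")
    if y: "y \<in> U" "norm (y - x) < \<delta>" and vs: "vs \<in> lists E" "length vs = a + b" for y vs
  proof -
    define h p q where "h = y - x" and "p = nths vs I" and "q = nths vs (- I)"
    have h: "h \<in> E" unfolding h_def using E x y by (meson subspace_diff subsetD)
    have s: "{j. Suc j \<in> I'} = I" if "I' = insert 0 (Suc ` I) \<or> I' = Suc ` I" for I' using that by auto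
    have s': "{j. Suc j \<in> I'} = - I" if "I' = - insert 0 (Suc ` I) \<or> I' = - Suc ` I" for I'
      using that by auto
    have n: "nths (h # vs) (insert 0 (Suc ` I)) = h # p" "nths (h # vs) (- insert 0 (Suc ` I)) = q"
       "nths (h # vs) (Suc ` I) = p" "nths (h # vs) (- Suc ` I) = h # q"
      using s[of "insert 0 (Suc ` I)"] s[of "Suc ` I"] s'[of "- insert 0 (Suc ` I)"] s'[of "- Suc ` I"]
      by (simp_all add: nths_Cons p_def q_def image_iff)
    have pq: "p \<in> lists E" "q \<in> lists E" "length p = a" "length q = b"
      using vs length_nths_split[OF I vs(2)] nths_in_lists by (auto simp: p_def q_def)
    define P Q where "P = prod_list (map norm p)" and "Q = prod_list (map norm q)"
    have PQ: "P \<ge> 0" "Q \<ge> 0" "prod_list (map norm vs) = P * Q"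
      by (auto simp: P_def Q_def p_def q_def prod_list_norm_nonneg prod_list_norm_nths[symmetric])
    define R1 R2 where "R1 = m1 y p - m1 x p - m1' x (h # p)" and "R2 = m2 y q - m2 x q - m2' x (h # q)"
    have R1: "norm R1 \<le> r * norm h * P" unfolding R1_def P_def h_def
      using d1(2) y pq by (auto simp: \<delta>_def)
    have R2: "norm R2 \<le> r * norm h * Q" unfolding R2_def Q_def h_def
      using d2(2) y pq by (auto simp: \<delta>_def)
    have D1: "norm (m1 y p - m1 x p) \<le> (C1' + 1) * norm h * P"
    proof -
      have "norm (m1 y p - m1 x p) = norm (R1 + m1' x (h # p))" by (simp add: R1_def)
      also have "\<dots> \<le> r * norm h * P + C1' * (norm h * P)"
        using R1 C1'(2)[of "h # p"] pq h by (intro norm_triangle_mono) (auto simp: P_def)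
      also have "r * norm h * P \<le> 1 * norm h * P" using PQ by (intro mult_right_mono) (auto simp: r_def)
      finally show ?thesis by (simp add: algebra_simps)
    qed
    have D2: "norm (m2 y q - m2 x q) \<le> (C2' + 1) * norm h * Q"
    proof -
      have "norm (m2 y q - m2 x q) = norm (R2 + m2' x (h # q))" by (simp add: R2_def)
      also have "\<dots> \<le> r * norm h * Q + C2' * (norm h * Q)"
        using R2 C2'(2)[of "h # q"] pq h by (intro norm_triangle_mono) (auto simp: Q_def)
      also have "r * norm h * Q \<le> 1 * norm h * Q" using PQ by (intro mult_right_mono) (auto simp: r_def)
      finally show ?thesis by (simp add: algebra_simps)
    qed
    \<comment> \<open>The Leibniz rule with its error: the remainder of one factor against the other
      factor at \<open>x\<close>, twice, and the product of both increments. The latter is quadratic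
      in \<open>h\<close>, hence small once \<open>norm h < e / (3 * M)\<close>.\<close>
    have "?L = B R1 (m2 x q) + B (m1 x p) R2 + B (m1 y p - m1 x p) (m2 y q - m2 x q)"
      unfolding h_def[symmetric] n R1_def R2_def by (simp add: p_def q_def add_left add_right diff_left diff_right algebra_simps)
    also have "norm \<dots> \<le> e / 3 * (norm h * P * Q) + e / 3 * (norm h * P * Q) + e / 3 * (norm h * P * Q)"
    proof (intro norm_triangle_mono)
      have "norm (B R1 (m2 x q)) \<le> norm R1 * norm (m2 x q) * K" by (rule K)
      also have "\<dots> \<le> (r * norm h * P) * (C2 * Q) * K"
        using R1 C2 pq K r PQ by (intro mult_right_mono mult_mono) (auto simp: Q_def)
      also have "\<dots> = (r * (C2 * K)) * (norm h * P * Q)" by (simp add: algebra_simps)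
      also have "\<dots> \<le> e / 3 * (norm h * P * Q)"
        using rC PQ by (intro mult_right_mono) auto
      finally show "norm (B R1 (m2 x q)) \<le> e / 3 * (norm h * P * Q)" .
      have "norm (B (m1 x p) R2) \<le> norm (m1 x p) * norm R2 * K" by (rule K)
      also have "\<dots> \<le> (C1 * P) * (r * norm h * Q) * K"
        using R2 C1 pq K r PQ by (intro mult_right_mono mult_mono) (auto simp: P_def)
      also have "\<dots> = (r * (C1 * K)) * (norm h * P * Q)" by (simp add: algebra_simps)
      also have "\<dots> \<le> e / 3 * (norm h * P * Q)"
        using rC PQ by (intro mult_right_mono) auto
      finally show "norm (B (m1 x p) R2) \<le> e / 3 * (norm h * P * Q)" .
      have "norm (B (m1 y p - m1 x p) (m2 y q - m2 x q)) \<le> norm (m1 y p - m1 x p) * norm (m2 y q - m2 x q) * K"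
        by (rule K)
      also have "\<dots> \<le> ((C1' + 1) * norm h * P) * ((C2' + 1) * norm h * Q) * K"
        using D1 D2 K C1' C2' PQ by (intro mult_right_mono mult_mono) auto
      also have "\<dots> = (M * norm h) * (norm h * P * Q)" by (simp add: M_def algebra_simps)
      also have "\<dots> \<le> e / 3 * (norm h * P * Q)"
      proof -
        have "norm h < e / (3 * M)" using y by (simp add: h_def \<delta>_def)
        then have "M * norm h \<le> e / 3" using M by (simp add: field_simps)
        then show ?thesis using PQ by (intro mult_right_mono) auto
      qed
      finally show "norm (B (m1 y p - m1 x p) (m2 y q - m2 x q)) \<le> e / 3 * (norm h * P * Q)" .
    qed
    also have "\<dots> = e * norm (y - x) * prod_list (map norm vs)"
      by (simp add: PQ h_def)
    finally show ?thesis .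
  qed
  ultimately show "\<exists>\<delta>>0. \<forall>y\<in>U. norm (y - x) < \<delta> \<longrightarrow> (\<forall>vs\<in>lists E. length vs = a + b \<longrightarrow>
      norm (B (m1 y (nths vs I)) (m2 y (nths vs (- I))) - B (m1 x (nths vs I)) (m2 x (nths vs (- I))) -
     (B (m1' x (nths ((y - x) # vs) (insert 0 (Suc ` I)))) (m2 x (nths ((y - x) # vs) (- insert 0 (Suc ` I)))) +
      B (m1 x (nths ((y - x) # vs) (Suc ` I))) (m2' x (nths ((y - x) # vs) (- Suc ` I)))))
      \<le> e * norm (y - x) * prod_list (map norm vs))" by blast
qed

lemma bounded_multilinear_on_const: "bounded_multilinear_on E 0 (\<lambda>vs. c)"
  unfolding bounded_multilinear_on_def by auto

lemma generated_family_bounded_multilinear: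
  fixes B :: "'w::real_normed_vector \<Rightarrow> 'w \<Rightarrow> 'w"
  assumes B: "bounded_bilinear B" and m: "generated_family E U B F k m"
  shows "\<forall>x\<in>U. bounded_multilinear_on E k (m x)"
  using m
proof induction
  case (smooth k m)
  then show ?case by cases blast
qed (simp_all add: bounded_multilinear_on_const bounded_multilinear_on_add bounded_multilinear_on_product[OF B])

text \<open>Coinduction up to the operations that generate the class: it is enough to differentiate the
  generator \<open>F\<close> inside the class.\<close>

lemma generated_family_smooth:
  fixes B :: "'w::real_normed_vector \<Rightarrow> 'w \<Rightarrow> 'w"
  assumes B: "bounded_bilinear B" and E: "subspace E" "U \<subseteq> E"
    and F: "generated_family E U B F 1 F'" "multilinear_derivative E U 0 (\<lambda>x vs. F x) F'"
    and m: "generated_family E U B F k m"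
  shows "smooth_family E U k m"
proof -
  note bm = generated_family_bounded_multilinear[OF B]
  have deriv: "\<exists>m'. generated_family E U B F (Suc k) m' \<and> multilinear_derivative E U k m m'"
    if "generated_family E U B F k m" for k m
    using that
  proof induction
    case (smooth k m)
    then show ?case by cases (blast intro: generated_family.smooth)
  next
    case gen
    then show ?case using F by auto
  next
    case (add k m1 m2)
    then obtain m1' m2' where "generated_family E U B F (Suc k) m1'" "multilinear_derivative E U k m1 m1'"
      "generated_family E U B F (Suc k) m2'" "multilinear_derivative E U k m2 m2'" by blast
    then show ?case using generated_family.add multilinear_derivative_add by blast
  next
    case (prod a m1 b m2 I)
    then obtain m1' m2' where m': "generated_family E U B F (Suc a) m1'" "multilinear_derivative E U a m1 m1'"
      "generated_family E U B F (Suc b) m2'" "multilinear_derivative E U b m2 m2'" by blast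
    have fin: "finite I" using prod by (meson finite_lessThan finite_subset)
    \<comment> \<open>The new direction, at position 0, goes to the first factor here and to the
      second factor in the other summand.\<close>
    have 1: "generated_family E U B F (Suc a + b) (\<lambda>x vs. B (m1' x (nths vs (insert 0 (Suc ` I))))
         (m2 x (nths vs (- insert 0 (Suc ` I)))))"
      using prod m' fin by (intro generated_family.prod) (auto simp: card_image card_insert_if)
    have 2: "generated_family E U B F (a + Suc b) (\<lambda>x vs. B (m1 x (nths vs (Suc ` I)))
         (m2' x (nths vs (- (Suc ` I)))))"
      using prod m' fin by (intro generated_family.prod) (auto simp: card_image)
    show ?case
      using generated_family.add[OF 1[simplified] 2[simplified]]
        multilinear_derivative_product[OF B E bm[OF prod(1)] bm[OF prod(2)] bm[OF m'(1)] bm[OF m'(3)] m'(2,4) prod(3,4)]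
      by blast
  qed
  show ?thesis using m
  proof (coinduction arbitrary: k m)
    case (smooth_family k m)
    obtain m' where "generated_family E U B F (Suc k) m'" "multilinear_derivative E U k m m'"
      using deriv[OF smooth_family] by blast
    then show ?case using bm[OF smooth_family] by blast
  qed
qed

lemma smooth_family_zero: "smooth_family E U k (\<lambda>x vs. 0)"
proof (coinduction arbitrary: k)
  case smooth_family
  have "bounded_multilinear_on E k (\<lambda>vs. 0)" unfolding bounded_multilinear_on_def by (auto intro: exI[of _ 0])
  moreover have "multilinear_derivative E U k (\<lambda>x vs. 0) (\<lambda>x vs. 0)"
    unfolding multilinear_derivative_def by (auto intro!: exI[of _ 1] mult_nonneg_nonneg prod_list_norm_nonneg)
  ultimately show ?case by blast
qed

lemma smooth_family_const: "smooth_family E U 0 (\<lambda>x vs. c)"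
proof (rule smooth_family.intros)
  show "multilinear_derivative E U 0 (\<lambda>x vs. c) (\<lambda>x vs. 0)"
    unfolding multilinear_derivative_def by (auto intro!: exI[of _ 1])
qed (auto simp: bounded_multilinear_on_const smooth_family_zero)

text \<open>With the generator 0 only sums and products of smooth families are left, so closure
  under both is the special case of coinduction with a trivial derivative of the generator.\<close>

lemma smooth_family_generated:
  fixes B :: "'w::real_normed_vector \<Rightarrow> 'w \<Rightarrow> 'w"
  assumes "bounded_bilinear B" "subspace E" "U \<subseteq> E" "generated_family E U B (\<lambda>x. 0) k m"
  shows "smooth_family E U k m"
  using assms(1-3) _ _ assms(4)
proof (rule generated_family_smooth)
  show "generated_family E U B (\<lambda>x. 0) 1 (\<lambda>x vs. 0)"
    by (rule generated_family.smooth[OF smooth_family_zero])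
  show "multilinear_derivative E U 0 (\<lambda>x vs. 0) (\<lambda>x vs. 0)"
    unfolding multilinear_derivative_def by (auto intro!: exI[of _ 1])
qed

section \<open>Closure properties of smooth maps\<close>

lemma smooth_on_familyE:
  assumes "smooth_on E U f"
  obtains m where "smooth_family E U 0 m" "\<And>x. x \<in> U \<Longrightarrow> m x [] = f x"
  using assms unfolding smooth_on_iff_family by blast

lemma smooth_on_const: "openin (top_of_set E) U \<Longrightarrow> smooth_on E U (\<lambda>x. c)"
  unfolding smooth_on_iff_family using smooth_family_const by blast

text \<open>The first derivative does not depend on the base point and all higher ones vanish: the
  families are \<open>L x\<close>, \<open>L (hd vs)\<close> and \<open>0\<close>.\<close>

lemma smooth_on_bounded_linear:
  assumes "openin (top_of_set E) U" "subspace E" "bounded_linear L"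
  shows "smooth_on E U L"
proof -
  interpret bounded_linear L by fact
  obtain K where K: "\<And>x. norm (L x) \<le> norm x * K" using bounded by blast
  have UE: "U \<subseteq> E" using assms openin_imp_subset by blast
  have 1: "bounded_multilinear_on E (Suc 0) (\<lambda>vs. L (hd vs))"
  proof -
    have "norm (L (hd vs)) \<le> K * prod_list (map norm vs)" if "length vs = Suc 0" for vs
      using that K by (auto simp: length_Suc_conv mult.commute)
    then show ?thesis unfolding bounded_multilinear_on_def
      by (auto simp: length_Suc_conv add scaleR intro!: exI[of _ K])
  qed
  have "smooth_family E U (Suc 0) (\<lambda>x vs. L (hd vs))"
    using 1 by (intro smooth_family.intros[OF _ _ smooth_family_zero])
      (auto simp: multilinear_derivative_def intro!: exI[of _ 1] mult_nonneg_nonneg prod_list_norm_nonneg)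
  then have "smooth_family E U 0 (\<lambda>x vs. L x)"
    by (rule smooth_family.intros[rotated 2])
      (auto simp: multilinear_derivative_def bounded_multilinear_on_const diff intro!: exI[of _ 1])
  then show ?thesis unfolding smooth_on_iff_family using assms by blast
qed

lemma smooth_on_bilinear:
  fixes B :: "'w::real_normed_vector \<Rightarrow> 'w \<Rightarrow> 'w"
  assumes "bounded_bilinear B" "subspace E" "smooth_on E U f" "smooth_on E U g"
  shows "smooth_on E U (\<lambda>x. B (f x) (g x))"
proof -
  obtain m1 where m1: "smooth_family E U 0 m1" "\<And>x. x \<in> U \<Longrightarrow> m1 x [] = f x"
    using smooth_on_familyE assms by metis
  obtain m2 where m2: "smooth_family E U 0 m2" "\<And>x. x \<in> U \<Longrightarrow> m2 x [] = g x"
    using smooth_on_familyE assms by metis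
  have "generated_family E U B (\<lambda>x. 0) (0 + 0) (\<lambda>x vs. B (m1 x (nths vs {})) (m2 x (nths vs (- {}))))"
    using m1 m2 by (intro generated_family.intros) auto
  then have "smooth_family E U 0 (\<lambda>x vs. B (m1 x (nths vs {})) (m2 x (nths vs (- {}))))"
    using smooth_family_generated[OF assms(1,2) smooth_on_subset[OF assms(3)]] by simp
  then show ?thesis unfolding smooth_on_iff_family using smooth_on_openin[OF assms(3)] m1 m2 by force
qed

text \<open>Derivatives of compositions \<open>\<phi> \<circ> f\<close> are only needed for outer maps \<open>\<phi>\<close> whose derivative is a
  polynomial in \<open>\<phi>\<close> itself; then all higher derivatives come for free.\<close>

lemma smooth_on_outer:
  fixes B :: "'w::real_normed_vector \<Rightarrow> 'w \<Rightarrow> 'w"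
  assumes B: "bounded_bilinear B" and E: "subspace E" and f: "smooth_on E U f"
    and \<phi>: "\<And>x. x \<in> U \<Longrightarrow> (\<phi> has_derivative \<phi>' x) (at (f x))"
    and gen: "\<And>m. smooth_family E U (Suc 0) m \<Longrightarrow>
      \<exists>m'. generated_family E U B (\<lambda>x. \<phi> (f x)) (Suc 0) m' \<and> (\<forall>x v. m' x [v] = \<phi>' x (m x [v]))"
  shows "smooth_on E U (\<lambda>x. \<phi> (f x))"
proof -
  have UE: "U \<subseteq> E" using f smooth_on_subset by blast
  obtain m where m: "smooth_family E U 0 m" "\<And>x. x \<in> U \<Longrightarrow> m x [] = f x"
    using smooth_on_familyE f by metis
  from m(1) obtain m' where m': "multilinear_derivative E U 0 m m'" "smooth_family E U (Suc 0) m'" by cases auto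
  have bm': "\<forall>x\<in>U. bounded_multilinear_on E (Suc 0) (m' x)" using m'(2) by cases auto
  have "multilinear_derivative E U 0 (\<lambda>x vs. \<phi> (f x)) (\<lambda>x vs. \<phi>' x (m' x vs))"
    unfolding multilinear_derivative_def
  proof (intro ballI allI impI)
    fix x and e :: real assume x: "x \<in> U" and e: "e > 0"
    obtain C where C: "C \<ge> 0" "\<And>vs. vs \<in> lists E \<Longrightarrow> length vs = Suc 0 \<Longrightarrow> norm (m' x vs) \<le> C * prod_list (map norm vs)"
      using bounded_multilinear_on_bound bm' x by (metis (full_types))
    interpret \<phi>': bounded_linear "\<phi>' x" using \<phi>[OF x] by (rule has_derivative_bounded_linear)
    obtain K where K: "K > 0" "\<And>v. norm (\<phi>' x v) \<le> norm v * K" using \<phi>'.pos_bounded by blast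
    \<comment> \<open>Half of \<open>e\<close> goes to the remainder of \<phi> on an increment of
      \<open>f\<close>, which is at most \<open>C + 1\<close> times \<open>norm (y - x)\<close>; the
      other half goes to the remainder of \<open>f\<close>, transported by the derivative of \<phi>.
      The cap 1 is what yields the constant \<open>C + 1\<close>.\<close>
    have e1: "e / (2 * (C + 1)) > 0" "min 1 (e / (2 * K)) > 0" using e C K by auto
    obtain d1 where d1: "d1 > 0" "\<And>w. norm (w - f x) < d1 \<Longrightarrow>
        norm (\<phi> w - \<phi> (f x) - \<phi>' x (w - f x)) \<le> e / (2 * (C + 1)) * norm (w - f x)"
      using \<phi>[OF x] e1 unfolding has_derivative_at_alt by blast
    obtain d2 where d2: "d2 > 0" "\<And>y. y \<in> U \<Longrightarrow> norm (y - x) < d2 \<Longrightarrow>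
        norm (f y - f x - m' x [y - x]) \<le> min 1 (e / (2 * K)) * norm (y - x)"
      using multilinear_derivativeD[OF m'(1) x e1(2)] m(2) x by (metis (no_types, lifting) lists.Nil list.size(3) map_is_Nil_conv mult_1_right prod_list.Nil)
    define \<delta> where "\<delta> = min d2 (d1 / (C + 1))"
    have \<delta>: "\<delta> > 0" using d1 d2 C by (simp add: \<delta>_def)
    have "norm (\<phi> (f y) - \<phi> (f x) - \<phi>' x (m' x [y - x])) \<le> e * norm (y - x)"
      if y: "y \<in> U" "norm (y - x) < \<delta>" for y
    proof -
      have "y - x \<in> E" using E UE x y by (meson subspace_diff subsetD)
      then have "norm (m' x [y - x]) \<le> C * norm (y - x)" using C(2)[of "[y - x]"] by simp
      moreover have R: "norm (f y - f x - m' x [y - x]) \<le> min 1 (e / (2 * K)) * norm (y - x)"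
        using d2 y by (simp add: \<delta>_def)
      moreover have "min 1 (e / (2 * K)) * norm (y - x) \<le> 1 * norm (y - x)" by (intro mult_right_mono) auto
      moreover have "norm (f y - f x) \<le> norm (f y - f x - m' x [y - x]) + norm (m' x [y - x])"
        by (metis diff_add_cancel norm_triangle_ineq)
      ultimately have N: "norm (f y - f x) \<le> (C + 1) * norm (y - x)" by (simp add: algebra_simps)
      also have "\<dots> < (C + 1) * (d1 / (C + 1))" using y C by (intro mult_strict_left_mono) (auto simp: \<delta>_def)
      also have "\<dots> = d1" using C by simp
      finally have "norm (\<phi> (f y) - \<phi> (f x) - \<phi>' x (f y - f x)) \<le> e / (2 * (C + 1)) * norm (f y - f x)"
        using d1 by blast
      also have "\<dots> \<le> e / (2 * (C + 1)) * ((C + 1) * norm (y - x))"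
        using N e C by (intro mult_left_mono) auto
      also have "\<dots> = e / 2 * norm (y - x)" 
      proof -
        have "e / (2 * c) * (c * norm (y - x)) = e / 2 * norm (y - x)" if "c \<noteq> 0" for c using that by simp
        from this[of "C + 1"] show ?thesis using C by linarith
      qed
      finally have 1: "norm (\<phi> (f y) - \<phi> (f x) - \<phi>' x (f y - f x)) \<le> e / 2 * norm (y - x)" .
      have "norm (\<phi>' x (f y - f x - m' x [y - x])) \<le> norm (f y - f x - m' x [y - x]) * K" by (rule K)
      also have "\<dots> \<le> (e / (2 * K) * norm (y - x)) * K"
        using R K by (intro mult_right_mono order_trans[OF R]) auto
      also have "\<dots> = e / 2 * norm (y - x)" using K by simp
      finally have 2: "norm (\<phi>' x (f y - f x - m' x [y - x])) \<le> e / 2 * norm (y - x)" .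
      have "\<phi> (f y) - \<phi> (f x) - \<phi>' x (m' x [y - x]) =
          (\<phi> (f y) - \<phi> (f x) - \<phi>' x (f y - f x)) + \<phi>' x (f y - f x - m' x [y - x])"
        by (simp add: \<phi>'.diff)
      also have "norm \<dots> \<le> e / 2 * norm (y - x) + e / 2 * norm (y - x)"
        using 1 2 by (rule norm_triangle_mono)
      finally show ?thesis by simp
    qed
    then show "\<exists>\<delta>>0. \<forall>y\<in>U. norm (y - x) < \<delta> \<longrightarrow> (\<forall>vs\<in>lists E. length vs = 0 \<longrightarrow>
        norm (\<phi> (f y) - \<phi> (f x) - \<phi>' x (m' x ((y - x) # vs))) \<le> e * norm (y - x) * prod_list (map norm vs))"
      using \<delta> by (intro exI[of _ \<delta>]) simp
  qed
  moreover obtain m'' where m'': "generated_family E U B (\<lambda>x. \<phi> (f x)) (Suc 0) m''" "\<And>x v. m'' x [v] = \<phi>' x (m' x [v])"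
    using gen[OF m'(2)] by blast
  ultimately have "multilinear_derivative E U 0 (\<lambda>x vs. \<phi> (f x)) m''"
    unfolding multilinear_derivative_def by simp
  then have "smooth_family E U 0 (\<lambda>x vs. \<phi> (f x))"
    using m'' by (intro generated_family_smooth[OF B E UE]) (auto intro: generated_family.gen)
  then show ?thesis unfolding smooth_on_iff_family using smooth_on_openin[OF f] by blast
qed

text \<open>Products in \<open>generated_family\<close> stay in one target space, whereas
  \<open>L\<close> may change it; hence a separate coinduction, in which \<open>L\<close> is applied
  to every derivative.\<close>

lemma smooth_on_linear_image:
  assumes L: "bounded_linear L" and f: "smooth_on E U f"
  shows "smooth_on E U (\<lambda>x. L (f x))"
proof -
  interpret bounded_linear L by fact
  obtain K where K: "K > 0" "\<And>v. norm (L v) \<le> norm v * K" using pos_bounded by blast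
  have bm: "bounded_multilinear_on E k (\<lambda>vs. L (m vs))" if m: "bounded_multilinear_on E k m" for k m
  proof -
    obtain C where C: "C \<ge> 0" "\<And>vs. vs \<in> lists E \<Longrightarrow> length vs = k \<Longrightarrow> norm (m vs) \<le> C * prod_list (map norm vs)"
      using bounded_multilinear_on_bound[OF m] by blast
    have "norm (L (m vs)) \<le> C * K * prod_list (map norm vs)" if "vs \<in> lists E" "length vs = k" for vs
    proof -
      have "norm (L (m vs)) \<le> norm (m vs) * K" by (rule K)
      also have "\<dots> \<le> C * prod_list (map norm vs) * K" using C(2)[OF that] K(1) by (intro mult_right_mono) auto
      finally show ?thesis by (simp add: mult_ac)
    qed
    then show ?thesis
      unfolding bounded_multilinear_on_def
      using bounded_multilinear_on_linear[OF m] by (auto simp: add scaleR intro!: exI[of _ "C * K"])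
  qed
  have dm: "multilinear_derivative E U k (\<lambda>x vs. L (m x vs)) (\<lambda>x vs. L (m' x vs))"
    if m: "multilinear_derivative E U k m m'" for k m m'
    unfolding multilinear_derivative_def
  proof (intro ballI allI impI)
    fix x and e :: real assume x: "x \<in> U" and e: "e > 0"
    then have eK: "e / K > 0" using K by simp
    obtain d where d: "d > 0" "\<And>y vs. y \<in> U \<Longrightarrow> norm (y - x) < d \<Longrightarrow> vs \<in> lists E \<Longrightarrow> length vs = k \<Longrightarrow>
      norm (m y vs - m x vs - m' x ((y - x) # vs)) \<le> e / K * norm (y - x) * prod_list (map norm vs)"
      by (rule multilinear_derivativeD[OF m x eK]) blast
    have "norm (L (m y vs) - L (m x vs) - L (m' x ((y - x) # vs))) \<le> e * norm (y - x) * prod_list (map norm vs)"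
      if "y \<in> U" "norm (y - x) < d" "vs \<in> lists E" "length vs = k" for y vs
    proof -
      have "norm (L (m y vs) - L (m x vs) - L (m' x ((y - x) # vs))) \<le> norm (m y vs - m x vs - m' x ((y - x) # vs)) * K"
        using K(2)[of "m y vs - m x vs - m' x ((y - x) # vs)"] by (simp add: diff)
      also have "\<dots> \<le> e / K * norm (y - x) * prod_list (map norm vs) * K"
        using d(2)[OF that] K by (intro mult_right_mono) auto
      finally show ?thesis using K by simp
    qed
    with d(1) show "\<exists>\<delta>>0. \<forall>y\<in>U. norm (y - x) < \<delta> \<longrightarrow> (\<forall>vs\<in>lists E. length vs = k \<longrightarrow>
        norm (L (m y vs) - L (m x vs) - L (m' x ((y - x) # vs))) \<le> e * norm (y - x) * prod_list (map norm vs))"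
      by blast
  qed
  have "smooth_family E U k (\<lambda>x vs. L (m x vs))" if "smooth_family E U k m" for k m
    using that
  proof (coinduction arbitrary: k m)
    case (smooth_family k m)
    then show ?case by cases (use bm dm in blast)
  qed
  then show ?thesis using f unfolding smooth_on_iff_family by metis
qed

lemma smooth_on_add:
  assumes "subspace E" "smooth_on E U f" "smooth_on E U g"
  shows "smooth_on E U (\<lambda>x. f x + g x)"
proof -
  obtain m1 where m1: "smooth_family E U 0 m1" "\<And>x. x \<in> U \<Longrightarrow> m1 x [] = f x"
    using smooth_on_familyE assms by metis
  obtain m2 where m2: "smooth_family E U 0 m2" "\<And>x. x \<in> U \<Longrightarrow> m2 x [] = g x"
    using smooth_on_familyE assms by metis
  \<comment> \<open>A trivial product, so that the generated families supply just the sum.\<close>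
  have B: "bounded_bilinear (\<lambda>x y. 0 :: 'b)" by (rule bounded_bilinear.intro) (auto intro: exI[of _ 0])
  have "generated_family E U (\<lambda>x y. 0) (\<lambda>x. 0) 0 (\<lambda>x vs. m1 x vs + m2 x vs)"
    using m1 m2 by (intro generated_family.intros) auto
  then have "smooth_family E U 0 (\<lambda>x vs. m1 x vs + m2 x vs)"
    using smooth_family_generated[OF B assms(1) smooth_on_subset[OF assms(2)]] by simp
  then show ?thesis unfolding smooth_on_iff_family using smooth_on_openin[OF assms(2)] m1 m2 by force
qed

lemma smooth_on_diff:
  assumes "subspace E" "smooth_on E U f" "smooth_on E U g"
  shows "smooth_on E U (\<lambda>x. f x - g x)"
  using smooth_on_add[OF assms(1,2) smooth_on_linear_image[OF bounded_linear_minus[OF bounded_linear_ident] assms(3)]]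
  by simp

lemma smooth_on_sum:
  assumes "subspace E" "openin (top_of_set E) U" "\<And>i. i \<in> A \<Longrightarrow> smooth_on E U (f i)"
  shows "smooth_on E U (\<lambda>x. \<Sum>i\<in>A. f i x)"
  using assms(3)
  by (induction A rule: infinite_finite_induct) (auto intro!: smooth_on_const smooth_on_add assms(1,2))

text \<open>A pair is the sum of the images of its components under the two linear embeddings into
  the product.\<close>

lemma smooth_on_Pair:
  assumes "subspace E" "smooth_on E U f" "smooth_on E U g"
  shows "smooth_on E U (\<lambda>x. (f x, g x))"
proof -
  have "bounded_linear (\<lambda>x::'b. (x, 0::'c))" "bounded_linear (\<lambda>x::'c. (0::'b, x))"
    by (intro bounded_linear_intros)+
  from smooth_on_add[OF assms(1) smooth_on_linear_image[OF this(1) assms(2)] smooth_on_linear_image[OF this(2) assms(3)]]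
  show ?thesis by simp
qed

lemma smooth_on_openin_subset:
  assumes "smooth_on E U f" "openin (top_of_set E) V" "V \<subseteq> U"
  shows "smooth_on E V f"
proof -
  obtain D where D: "\<forall>x\<in>U. D 0 x [] = f x" "\<forall>k. \<forall>x\<in>U. bounded_multilinear_on E k (D k x)"
      "\<forall>k. multilinear_derivative E U k (D k) (D (Suc k))"
    using assms unfolding smooth_on_def multilinear_derivative_def by blast
  have "multilinear_derivative E V k (D k) (D (Suc k))" for k
    unfolding multilinear_derivative_def
  proof (intro ballI allI impI)
    fix x and e :: real assume x: "x \<in> V" "e > 0"
    then have "x \<in> U" using assms(3) by blast
    obtain d where d: "d > 0" "\<And>y vs. y \<in> U \<Longrightarrow> norm (y - x) < d \<Longrightarrow> vs \<in> lists E \<Longrightarrow> length vs = k \<Longrightarrow>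
      norm (D k y vs - D k x vs - D (Suc k) x ((y - x) # vs)) \<le> e * norm (y - x) * prod_list (map norm vs)"
      by (rule multilinear_derivativeD[OF D(3)[rule_format] \<open>x \<in> U\<close> x(2)]) blast
    then show "\<exists>\<delta>>0. \<forall>y\<in>V. norm (y - x) < \<delta> \<longrightarrow> (\<forall>vs\<in>lists E. length vs = k \<longrightarrow>
      norm (D k y vs - D k x vs - D (Suc k) x ((y - x) # vs)) \<le> e * norm (y - x) * prod_list (map norm vs))"
      using assms(3) by blast
  qed
  moreover have "\<forall>x\<in>V. D 0 x [] = f x" "\<forall>k. \<forall>x\<in>V. bounded_multilinear_on E k (D k x)"
    using D assms(3) by blast+
  ultimately show ?thesis unfolding smooth_on_def multilinear_derivative_def using assms(2) by blast
qed

text \<open>The first derivative, freed from the encoding by lists. Linearity and the bound are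
  confined to \<open>E\<close>, as nothing is known off the model space.\<close>

lemma smooth_on_derivative:
  assumes f: "smooth_on E U f" and x: "x \<in> U"
  obtains f' C where "C \<ge> 0" "\<And>v. v \<in> E \<Longrightarrow> norm (f' v) \<le> C * norm v"
    "\<And>v w a b. v \<in> E \<Longrightarrow> w \<in> E \<Longrightarrow> f' (a *\<^sub>R v + b *\<^sub>R w) = a *\<^sub>R f' v + b *\<^sub>R f' w"
    "\<And>\<epsilon>. \<epsilon> > 0 \<Longrightarrow> \<exists>\<delta>>0. \<forall>y\<in>U. norm (y - x) < \<delta> \<longrightarrow> norm (f y - f x - f' (y - x)) \<le> \<epsilon> * norm (y - x)"
proof -
  obtain m where m: "smooth_family E U 0 m" "\<And>x. x \<in> U \<Longrightarrow> m x [] = f x"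
    using smooth_on_familyE f by metis
  from m(1) obtain m' where m': "multilinear_derivative E U 0 m m'" "smooth_family E U (Suc 0) m'" by cases auto
  have bm': "bounded_multilinear_on E (Suc 0) (m' x)" using m'(2) x by cases auto
  obtain C where C: "C \<ge> 0" "\<And>vs. vs \<in> lists E \<Longrightarrow> length vs = Suc 0 \<Longrightarrow> norm (m' x vs) \<le> C * prod_list (map norm vs)"
    using bounded_multilinear_on_bound[OF bm'] by blast
  have "norm (m' x [v]) \<le> C * norm v" if "v \<in> E" for v using C(2)[of "[v]"] that by simp
  moreover have "m' x [a *\<^sub>R v + b *\<^sub>R w] = a *\<^sub>R m' x [v] + b *\<^sub>R m' x [w]" if "v \<in> E" "w \<in> E" for v w a b
    using bounded_multilinear_on_linear[OF bm', of "[v]" 0 v w a b] that by simp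
  moreover have "\<exists>\<delta>>0. \<forall>y\<in>U. norm (y - x) < \<delta> \<longrightarrow> norm (f y - f x - m' x [y - x]) \<le> \<epsilon> * norm (y - x)"
    if "\<epsilon> > 0" for \<epsilon>
    using multilinear_derivativeD[OF m'(1) x that] m(2) x
    by (metis (no_types, lifting) lists.Nil list.size(3) map_is_Nil_conv mult_1_right prod_list.Nil)
  ultimately show ?thesis using that[of C "\<lambda>h. m' x [h]"] C(1) by blast
qed

lemma smooth_on_continuous:
  assumes E: "subspace E" and f: "smooth_on E U f"
  shows "continuous_on U f"
  unfolding continuous_on_iff
proof (intro ballI allI impI)
  fix x and e :: real assume x: "x \<in> U" and e: "e > 0"
  obtain f' C where C: "C \<ge> 0" "\<And>v. v \<in> E \<Longrightarrow> norm (f' v) \<le> C * norm v" and f':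
    "\<And>\<epsilon>. \<epsilon> > 0 \<Longrightarrow> \<exists>\<delta>>0. \<forall>y\<in>U. norm (y - x) < \<delta> \<longrightarrow> norm (f y - f x - f' (y - x)) \<le> \<epsilon> * norm (y - x)"
    using smooth_on_derivative[OF f x] by metis
  obtain d where d: "d > 0" "\<And>y. y \<in> U \<Longrightarrow> norm (y - x) < d \<Longrightarrow> norm (f y - f x - f' (y - x)) \<le> 1 * norm (y - x)"
    using f'[of 1] by auto
  have "dist (f y) (f x) < e" if y: "y \<in> U" "dist y x < min d (e / (C + 1))" for y
  proof -
    have "y - x \<in> E" using E x y smooth_on_subset[OF f] by (meson subspace_diff subsetD)
    then have "norm (f' (y - x)) \<le> C * norm (y - x)" using C(2) by simp
    moreover have "norm (f y - f x) \<le> norm (f y - f x - f' (y - x)) + norm (f' (y - x))"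
      by (metis diff_add_cancel norm_triangle_ineq)
    moreover have "norm (f y - f x - f' (y - x)) \<le> 1 * norm (y - x)" using d y by (simp add: dist_norm)
    ultimately have "norm (f y - f x) \<le> (C + 1) * norm (y - x)" by (simp add: algebra_simps)
    also have "\<dots> < (C + 1) * (e / (C + 1))" using y C by (intro mult_strict_left_mono) (auto simp: dist_norm)
    finally show ?thesis using C by (simp add: dist_norm)
  qed
  then show "\<exists>d>0. \<forall>x'\<in>U. dist x' x < d \<longrightarrow> dist (f x') (f x) < e"
    using d(1) C(1) e by (intro exI[of _ "min d (e / (C + 1))"]) auto
qed

section \<open>Operators on a real Hilbert space\<close>

lemmas compose_distribs =
  bounded_bilinear.add_left[OF bounded_bilinear_blinfun_compose]
  bounded_bilinear.add_right[OF bounded_bilinear_blinfun_compose]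
  bounded_bilinear.diff_left[OF bounded_bilinear_blinfun_compose]
  bounded_bilinear.diff_right[OF bounded_bilinear_blinfun_compose]
  bounded_bilinear.minus_left[OF bounded_bilinear_blinfun_compose]
  bounded_bilinear.minus_right[OF bounded_bilinear_blinfun_compose]
  bounded_bilinear.scaleR_left[OF bounded_bilinear_blinfun_compose]
  bounded_bilinear.scaleR_right[OF bounded_bilinear_blinfun_compose]
  bounded_bilinear.sum_left[OF bounded_bilinear_blinfun_compose]
  bounded_bilinear.sum_right[OF bounded_bilinear_blinfun_compose]

lemma blinfun_compose_assoc: "(f o\<^sub>L g) o\<^sub>L h = f o\<^sub>L (g o\<^sub>L h)"
  by (rule blinfun_eqI) simp

lemma blinfun_compose_id [simp]: "f o\<^sub>L id_blinfun = f" "id_blinfun o\<^sub>L f = f"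
  by (auto intro!: blinfun_eqI)

text \<open>Riesz representation: \<open>\<parallel>x\<parallel>\<^sup>2 / 2 - f x\<close> attains its infimum, since minimizing sequences are
  Cauchy by the parallelogram law.\<close>

lemma riesz_representation:
  fixes f :: "'a::{real_inner,banach} \<Rightarrow> real"
  assumes f: "bounded_linear f"
  shows "\<exists>v. \<forall>x. f x = x \<bullet> v"
proof -
  interpret bounded_linear f by fact
  obtain K where K: "\<And>x. norm (f x) \<le> norm x * K" using bounded by blast
  define J where "J = (\<lambda>x. (norm x)\<^sup>2 / 2 - f x)"
  have "J x \<ge> - (K\<^sup>2 / 2)" for x
  proof -
    have "f x \<le> norm x * K" using K[of x] by simp
    moreover have "0 \<le> (norm x - K)\<^sup>2" by simp
    ultimately show ?thesis unfolding J_def power2_diff by (simp add: field_simps)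
  qed
  then have bdd: "bdd_below (range J)" by (auto simp: bdd_below_def)
  define m where "m = Inf (range J)"
  have mJ: "m \<le> J x" for x unfolding m_def using bdd by (intro cInf_lower) auto
  have "\<exists>x. J x < m + 1 / real (Suc n)" for n
    using cInf_lessD[of "range J" "m + 1 / real (Suc n)"] unfolding m_def by auto
  then obtain X where X: "\<And>n. J (X n) < m + 1 / real (Suc n)" by metis
  have par: "(norm (x - y))\<^sup>2 \<le> 4 * (J x + J y - 2 * m)" for x y
  proof -
    have "(norm (x - y))\<^sup>2 = 4 * (J x + J y - 2 * J ((1/2) *\<^sub>R (x + y)))"
      unfolding J_def power2_norm_eq_inner scaleR add
      by (simp add: inner_diff inner_add inner_commute field_simps)
    then show ?thesis using mJ[of "(1/2) *\<^sub>R (x + y)"] by simp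
  qed
  have "Cauchy X"
  proof (rule metric_CauchyI)
    fix e :: real assume e: "e > 0"
    \<comment> \<open>For indices from \<open>N\<close> on, each of two values of \<open>J\<close>
      exceeds \<open>m\<close> by less than \<open>1 / real (Suc N)\<close>, and \<open>par\<close>
      costs a factor 4; hence 8.\<close>
    obtain N where N: "8 / real (Suc N) < e\<^sup>2"
    proof -
      obtain N where "1 / real (Suc N) < e\<^sup>2 / 8"
        using reals_Archimedean[of "e\<^sup>2 / 8"] e by (auto simp: inverse_eq_divide)
      then show ?thesis using that[of N] by simp
    qed
    have "dist (X i) (X j) < e" if "i \<ge> N" "j \<ge> N" for i j
    proof -
      have "1 / real (Suc i) \<le> 1 / real (Suc N)" "1 / real (Suc j) \<le> 1 / real (Suc N)"
        using that by (auto intro!: divide_left_mono)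
      then have "4 * (J (X i) + J (X j) - 2 * m) \<le> 8 / real (Suc N)"
        using X[of i] X[of j] by simp
      then have "(norm (X i - X j))\<^sup>2 < e\<^sup>2" using N par[of "X i" "X j"] by linarith
      then show ?thesis using e by (simp add: dist_norm power_less_imp_less_base[of _ 2])
    qed
    then show "\<exists>M. \<forall>i\<ge>M. \<forall>j\<ge>M. dist (X i) (X j) < e" by blast
  qed
  then obtain v where v: "X \<longlonglongrightarrow> v" using Cauchy_convergent_iff convergent_def by blast
  have "(\<lambda>n. J (X n)) \<longlonglongrightarrow> J v" unfolding J_def
    by (intro tendsto_intros tendsto v) simp
  moreover have "(\<lambda>n. m + 1 / real (Suc n)) \<longlonglongrightarrow> m + 0"
    by (intro tendsto_intros LIMSEQ_inverse_real_of_nat[unfolded inverse_eq_divide])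
  ultimately have "J v \<le> m + 0" using X by (intro LIMSEQ_le) (auto intro: less_imp_le)
  then have Jv: "J v \<le> J x" for x using mJ[of x] by simp
  have "f h = h \<bullet> v" for h
  proof -
    \<comment> \<open>\<open>c\<close> is the derivative of \<open>J\<close> at \<open>v\<close>
      along \<open>h\<close>. The step \<open>- c / s\<close> would lower \<open>J\<close> by at
      least \<open>c^2 / (2 * s)\<close>, so minimality forces \<open>c = 0\<close>; the summand 1
      keeps \<open>s\<close> positive for \<open>h = 0\<close>.\<close>
    define c s where "c = h \<bullet> v - f h" and "s = (norm h)\<^sup>2 + 1"
    have s: "s > 0" by (simp add: s_def add_nonneg_pos)
    have "J (v + t *\<^sub>R h) - J v = t * c + t\<^sup>2 * (norm h)\<^sup>2 / 2" for t
      unfolding J_def power2_norm_eq_inner c_def scaleR add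
      by (simp add: inner_add inner_commute algebra_simps power2_eq_square)
    from this[of "- c / s"] Jv[of "v + (- c / s) *\<^sub>R h"]
    have "0 \<le> (- c / s) * c + (- c / s)\<^sup>2 * (norm h)\<^sup>2 / 2" by simp
    also have "\<dots> \<le> (- c / s) * c + (- c / s)\<^sup>2 * s / 2" by (intro add_left_mono divide_right_mono mult_left_mono) (auto simp: s_def)
    also have "\<dots> = - (c\<^sup>2 / (2 * s))" using s by (simp add: field_simps power2_eq_square)
    finally have "c\<^sup>2 \<le> 0" using s by (simp add: divide_le_0_iff)
    then show ?thesis by (simp add: c_def)
  qed
  then show ?thesis by blast
qed

lemma adjoint_exists:
  fixes T :: "'a::{real_inner,banach} \<Rightarrow>\<^sub>L 'a"
  shows "\<exists>S::'a \<Rightarrow>\<^sub>L 'a. \<forall>x y. T x \<bullet> y = x \<bullet> S y"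
proof -
  have "\<exists>v. \<forall>x. T x \<bullet> y = x \<bullet> v" for y
    by (rule riesz_representation)
      (rule bounded_linear_compose[OF bounded_linear_inner_left blinfun.bounded_linear_right])
  then obtain S where S: "\<And>x y. T x \<bullet> y = x \<bullet> S y" by metis
  have "bounded_linear S"
  proof (rule bounded_linear_intro)
    fix x y and r :: real
    have "z \<bullet> (S (x + y) - (S x + S y)) = 0" for z
      by (simp add: inner_diff_right inner_add_right S[symmetric])
    from this[of "S (x + y) - (S x + S y)"] show "S (x + y) = S x + S y" by simp
    have "z \<bullet> (S (r *\<^sub>R x) - r *\<^sub>R S x) = 0" for z
      by (simp add: inner_diff_right S[symmetric])
    from this[of "S (r *\<^sub>R x) - r *\<^sub>R S x"] show "S (r *\<^sub>R x) = r *\<^sub>R S x" by simp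
    have "norm (S x) * norm (S x) = T (S x) \<bullet> x"
      by (simp add: S power2_norm_eq_inner[symmetric] power2_eq_square)
    also have "\<dots> \<le> norm (T (S x)) * norm x" by (rule norm_cauchy_schwarz)
    also have "\<dots> \<le> (norm T * norm (S x)) * norm x" by (intro mult_right_mono norm_blinfun) auto
    finally have "norm (S x) * norm (S x) \<le> norm (S x) * (norm x * norm T)" by (simp add: mult_ac)
    then show "norm (S x) \<le> norm x * norm T"
      by (cases "norm (S x) = 0") (auto simp: mult_le_cancel_left)
  qed
  then show ?thesis using S by (intro exI[of _ "Blinfun S"]) (simp add: bounded_linear_Blinfun_apply)
qed

text \<open>The adjoint for the real inner product exists for every real linear operator, so
  \<open>adj\<close> is linear and bounded on the whole operator space without side conditions. On
  complex linear operators it agrees with \<open>cadjoint\<close>.\<close>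

definition adj :: "('a::{real_inner,banach} \<Rightarrow>\<^sub>L 'a) \<Rightarrow> ('a \<Rightarrow>\<^sub>L 'a)"
  where "adj T = (SOME S. \<forall>x y. blinfun_apply T x \<bullet> y = x \<bullet> blinfun_apply S y)"

lemma inner_adj: "blinfun_apply T x \<bullet> y = x \<bullet> adj T y"
  using someI_ex[OF adjoint_exists[of T]] unfolding adj_def by blast

lemma inner_adj_left: "adj T x \<bullet> y = x \<bullet> blinfun_apply T y"
  by (metis inner_adj inner_commute)

lemma adj_eqI: "(\<And>x y. blinfun_apply T x \<bullet> y = x \<bullet> blinfun_apply S y) \<Longrightarrow> adj T = S"
proof (rule blinfun_eqI)
  fix y assume *: "\<And>x y. T x \<bullet> y = x \<bullet> S y"
  have "(adj T y - S y) \<bullet> (adj T y - S y) = 0"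
    using *[of "adj T y - S y" y] inner_adj[of T "adj T y - S y" y] by (simp add: inner_diff_right)
  then show "adj T y = S y" by simp
qed

lemma adj_adj [simp]: "adj (adj T) = T" by (rule adj_eqI) (rule inner_adj_left)
lemma adj_compose: "adj (S o\<^sub>L T) = adj T o\<^sub>L adj S" by (rule adj_eqI) (simp add: inner_adj)
lemma adj_id [simp]: "adj id_blinfun = id_blinfun" by (rule adj_eqI) simp
lemma adj_add: "adj (S + T) = adj S + adj T"
  by (rule adj_eqI) (simp add: inner_adj inner_add blinfun.bilinear_simps)
lemma adj_scaleR: "adj (r *\<^sub>R T) = r *\<^sub>R adj T"
  by (rule adj_eqI) (simp add: inner_adj blinfun.bilinear_simps)
lemma adj_minus: "adj (- T) = - adj T" using adj_scaleR[of "-1" T] by simp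
lemma adj_diff: "adj (S - T) = adj S - adj T" using adj_add[of S "- T"] by (simp add: adj_minus)
lemma adj_zero [simp]: "adj 0 = 0" using adj_scaleR[of 0 0] by simp

lemma bounded_linear_adj: "bounded_linear (adj :: _ \<Rightarrow> 'a::{real_inner,banach} \<Rightarrow>\<^sub>L 'a)"
proof (rule bounded_linear_intro)
  fix T :: "'a \<Rightarrow>\<^sub>L 'a"
  have "norm (adj T x) \<le> norm T * norm x" for x
  proof -
    have "norm (adj T x) * norm (adj T x) = T (adj T x) \<bullet> x"
      by (simp add: inner_adj power2_norm_eq_inner[symmetric] power2_eq_square)
    also have "\<dots> \<le> norm (T (adj T x)) * norm x" by (rule norm_cauchy_schwarz)
    also have "\<dots> \<le> (norm T * norm (adj T x)) * norm x" by (intro mult_right_mono norm_blinfun) auto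
    finally have "norm (adj T x) * norm (adj T x) \<le> norm (adj T x) * (norm T * norm x)" by (simp add: mult_ac)
    then show ?thesis
      by (cases "norm (adj T x) = 0") (auto simp: mult_le_cancel_left)
  qed
  then show "norm (adj T) \<le> norm T * 1" by (intro norm_blinfun_bound) auto
qed (simp_all add: adj_add adj_scaleR)

section \<open>Invertible operators\<close>

text \<open>Invertibility among real linear operators, an open condition in the full operator space.
  For a complex linear operator it amounts to membership in \<open>GL\<close>, because the inverse
  is complex linear again.\<close>

definition invertible_op :: "('a::real_normed_vector \<Rightarrow>\<^sub>L 'a) \<Rightarrow> bool"
  where "invertible_op T \<longleftrightarrow> (\<exists>S. S o\<^sub>L T = id_blinfun \<and> T o\<^sub>L S = id_blinfun)"

definition op_inv :: "('a::real_normed_vector \<Rightarrow>\<^sub>L 'a) \<Rightarrow> ('a \<Rightarrow>\<^sub>L 'a)"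
  where "op_inv T = (SOME S. S o\<^sub>L T = id_blinfun \<and> T o\<^sub>L S = id_blinfun)"

lemma op_inv:
  assumes "invertible_op T"
  shows "op_inv T o\<^sub>L T = id_blinfun" "T o\<^sub>L op_inv T = id_blinfun"
  using someI_ex[OF assms[unfolded invertible_op_def]] unfolding op_inv_def by blast+

lemma op_inv_apply:
  assumes "invertible_op T"
  shows "op_inv T (blinfun_apply T x) = x" "blinfun_apply T (op_inv T x) = x"
  using op_inv[OF assms] by (metis blinfun_apply_blinfun_compose blinfun_apply_id_blinfun id_apply)+

lemma op_inv_eqI:
  assumes "S o\<^sub>L T = id_blinfun" "T o\<^sub>L S = id_blinfun"
  shows "invertible_op T" "op_inv T = S"
proof -
  show i: "invertible_op T" using assms invertible_op_def by blast
  have "op_inv T = (S o\<^sub>L T) o\<^sub>L op_inv T" using assms by simp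
  also have "\<dots> = S" unfolding blinfun_compose_assoc op_inv[OF i] by simp
  finally show "op_inv T = S" .
qed

lemma invertible_op_id [simp]: "invertible_op id_blinfun" "op_inv id_blinfun = id_blinfun"
  using op_inv_eqI[of id_blinfun id_blinfun] by auto

lemma invertible_op_inv:
  assumes "invertible_op T" shows "invertible_op (op_inv T)" "op_inv (op_inv T) = T"
  using op_inv_eqI[OF op_inv(2,1)[OF assms]] by auto

lemma invertible_op_compose:
  assumes "invertible_op S" "invertible_op T"
  shows "invertible_op (S o\<^sub>L T)" "op_inv (S o\<^sub>L T) = op_inv T o\<^sub>L op_inv S"
proof -
  have "(op_inv T o\<^sub>L op_inv S) o\<^sub>L (S o\<^sub>L T) = id_blinfun" "(S o\<^sub>L T) o\<^sub>L (op_inv T o\<^sub>L op_inv S) = id_blinfun"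
    by (auto intro!: blinfun_eqI simp: op_inv_apply assms)
  then show "invertible_op (S o\<^sub>L T)" "op_inv (S o\<^sub>L T) = op_inv T o\<^sub>L op_inv S"
    using op_inv_eqI by blast+
qed

lemma invertible_op_scaleR:
  assumes "invertible_op T" "r \<noteq> 0"
  shows "invertible_op (r *\<^sub>R T)" "op_inv (r *\<^sub>R T) = (1 / r) *\<^sub>R op_inv T"
proof -
  have "((1 / r) *\<^sub>R op_inv T) o\<^sub>L (r *\<^sub>R T) = id_blinfun" "(r *\<^sub>R T) o\<^sub>L ((1 / r) *\<^sub>R op_inv T) = id_blinfun"
    using assms by (simp_all add: compose_distribs op_inv)
  then show "invertible_op (r *\<^sub>R T)" "op_inv (r *\<^sub>R T) = (1 / r) *\<^sub>R op_inv T"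
    using op_inv_eqI by blast+
qed

lemma invertible_op_adj:
  assumes "invertible_op T"
  shows "invertible_op (adj T)" "op_inv (adj T) = adj (op_inv T)"
  using op_inv_eqI[of "adj (op_inv T)" "adj T"] op_inv[OF assms] by (simp_all add: adj_compose[symmetric])

section \<open>Powers, the Neumann series and the derivative of inversion\<close>

definition op_pow :: "('a::real_normed_vector \<Rightarrow>\<^sub>L 'a) \<Rightarrow> nat \<Rightarrow> ('a \<Rightarrow>\<^sub>L 'a)"
  where "op_pow X n = ((o\<^sub>L) X ^^ n) id_blinfun"

lemma op_pow_0 [simp]: "op_pow X 0 = id_blinfun" by (simp add: op_pow_def)
lemma op_pow_Suc [simp]: "op_pow X (Suc n) = X o\<^sub>L op_pow X n" by (simp add: op_pow_def)
lemma op_pow_add: "op_pow X (m + n) = op_pow X m o\<^sub>L op_pow X n"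
  by (induction m) (simp_all add: blinfun_compose_assoc)
lemma op_pow_Suc_right: "op_pow X (Suc n) = op_pow X n o\<^sub>L X"
  using op_pow_add[of X n 1] by simp

lemma norm_op_pow: "norm (op_pow X n) \<le> norm X ^ n"
proof (induction n)
  case (Suc n)
  have "norm (op_pow X (Suc n)) \<le> norm X * norm (op_pow X n)" by (simp add: norm_blinfun_compose)
  also have "\<dots> \<le> norm X * norm X ^ n" using Suc by (intro mult_left_mono) auto
  finally show ?case by simp
qed (simp add: norm_blinfun_id_le)

lemma invertible_op_neumann:
  fixes H :: "'a::banach \<Rightarrow>\<^sub>L 'a"
  assumes "norm H < 1"
  shows "invertible_op (id_blinfun - H)"
proof -
  have s: "summable (op_pow H)"
    by (rule summable_comparison_test[OF _ summable_geometric[of "norm H"]]) (use assms norm_op_pow in auto)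
  define S where "S = suminf (op_pow H)"
  have sp: "S = id_blinfun + (\<Sum>n. op_pow H (Suc n))"
    using suminf_split_head[OF s] by (simp add: S_def)
  have "H o\<^sub>L S = (\<Sum>n. op_pow H (Suc n))"
    unfolding S_def op_pow_Suc
    by (rule bounded_linear.suminf[OF bounded_bilinear.bounded_linear_right[OF bounded_bilinear_blinfun_compose] s])
  then have "S - (H o\<^sub>L S) = id_blinfun" using sp by (metis add_diff_cancel_right')
  then have 1: "(id_blinfun - H) o\<^sub>L S = id_blinfun" by (simp add: compose_distribs)
  have "S o\<^sub>L H = (\<Sum>n. op_pow H (Suc n))"
    unfolding S_def op_pow_Suc_right
    by (rule bounded_linear.suminf[OF bounded_bilinear.bounded_linear_left[OF bounded_bilinear_blinfun_compose] s])
  then have "S - (S o\<^sub>L H) = id_blinfun" using sp by (metis add_diff_cancel_right')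
  then have 2: "S o\<^sub>L (id_blinfun - H) = id_blinfun" by (simp add: compose_distribs)
  show ?thesis using op_inv_eqI[OF 2 1] by blast
qed

lemma invertible_op_near:
  fixes T :: "'a::banach \<Rightarrow>\<^sub>L 'a"
  assumes T: "invertible_op T" and W: "norm (W - T) * norm (op_inv T) < 1"
  shows "invertible_op W"
proof -
  have "norm (op_inv T o\<^sub>L (T - W)) < 1"
    using norm_blinfun_compose[of "op_inv T" "T - W"] W by (simp add: norm_minus_commute mult.commute)
  then have "invertible_op (T o\<^sub>L (id_blinfun - (op_inv T o\<^sub>L (T - W))))"
    by (intro invertible_op_compose(1)[OF T invertible_op_neumann])
  also have "T o\<^sub>L (id_blinfun - (op_inv T o\<^sub>L (T - W))) = W"
    by (rule blinfun_eqI) (simp add: blinfun.bilinear_simps op_inv_apply[OF T])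
  finally show ?thesis .
qed

lemma open_invertible_op: "open {T::'a::banach \<Rightarrow>\<^sub>L 'a. invertible_op T}"
  unfolding open_dist
proof
  fix T :: "'a \<Rightarrow>\<^sub>L 'a" assume "T \<in> {T. invertible_op T}"
  then have T: "invertible_op T" by simp
  define e where "e = 1 / (norm (op_inv T) + 1)"
  have N: "norm (op_inv T) + 1 > 0" by (simp add: add_nonneg_pos)
  have "invertible_op W" if "dist W T < e" for W
  proof (rule invertible_op_near[OF T])
    have "norm (W - T) * norm (op_inv T) \<le> e * norm (op_inv T)"
      using that by (intro mult_right_mono) (auto simp: dist_norm)
    also have "\<dots> < 1" using N by (simp add: e_def field_simps)
    finally show "norm (W - T) * norm (op_inv T) < 1" .
  qed
  moreover have "e > 0" using N by (simp add: e_def)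
  ultimately show "\<exists>e>0. \<forall>y. dist y T < e \<longrightarrow> y \<in> {T. invertible_op T}" by blast
qed

text \<open>Let \<open>R\<close> and \<open>Q\<close> be the inverses of \<open>T\<close> and
  \<open>W\<close>, and \<open>D = W - T\<close>. Using \<open>R - Q = Q D R\<close> twice, the
  remainder becomes \<open>Q D R D R\<close>, which is quadratic in \<open>D\<close> as long as
  \<open>Q\<close> stays bounded.\<close>

lemma has_derivative_op_inv:
  fixes T :: "'a::banach \<Rightarrow>\<^sub>L 'a"
  assumes T: "invertible_op T"
  shows "(op_inv has_derivative (\<lambda>V. - (op_inv T o\<^sub>L V o\<^sub>L op_inv T))) (at T)"
  unfolding has_derivative_at_alt
proof (intro conjI allI impI)
  define R r where "R = op_inv T" and "r = norm R + 1"
  show "bounded_linear (\<lambda>V. - (op_inv T o\<^sub>L V o\<^sub>L op_inv T))"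
    by (intro bounded_linear_minus bounded_linear_compose[OF
        bounded_bilinear.bounded_linear_left[OF bounded_bilinear_blinfun_compose]
        bounded_bilinear.bounded_linear_right[OF bounded_bilinear_blinfun_compose]])
  fix e :: real assume e: "e > 0"
  have r: "r > 0" "norm R \<le> r" "r \<ge> 1" by (auto simp: r_def add_nonneg_pos)
  \<comment> \<open>The first bound gives \<open>norm Q \<le> 2 * r\<close>; the second turns the
    quadratic remainder, at most \<open>2 * r ^ 3 * h ^ 2\<close>, into at most
    \<open>e * h\<close>.\<close>
  define d where "d = min (1 / (2 * r)) (e / (2 * r ^ 3))"
  have d: "d > 0" using r e by (simp add: d_def)
  have "norm (op_inv W - op_inv T - - (op_inv T o\<^sub>L (W - T) o\<^sub>L op_inv T)) \<le> e * norm (W - T)"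
    if W: "norm (W - T) < d" for W
  proof -
    define h where "h = norm (W - T)"
    have h: "h \<ge> 0" "h * r \<le> 1 / 2" "h * (2 * r ^ 3) \<le> e"
      using W r by (auto simp: h_def d_def field_simps)
    have hR: "h * norm R \<le> 1 / 2" using mult_left_mono[OF r(2) h(1)] h(2) by linarith
    have iW: "invertible_op W"
      by (rule invertible_op_near[OF T]) (use hR in \<open>simp add: h_def R_def\<close>)
    define Q where "Q = op_inv W"
    have Q1: "Q = R - (Q o\<^sub>L (W - T) o\<^sub>L R)"
      by (rule blinfun_eqI)
        (simp add: blinfun.bilinear_simps Q_def R_def op_inv_apply[OF T] op_inv_apply[OF iW])
    have "norm Q \<le> norm R + norm Q * h * norm R"
    proof -
      have "norm (Q o\<^sub>L (W - T) o\<^sub>L R) \<le> norm Q * h * norm R"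
        unfolding h_def by (meson norm_blinfun_compose mult_right_mono norm_ge_zero order_trans)
      then show ?thesis
        by (subst Q1) (meson add_left_mono norm_triangle_ineq4 order_trans)
    qed
    also have "norm Q * h * norm R \<le> norm Q * (1 / 2)"
      using mult_left_mono[OF hR norm_ge_zero[of Q]] by (simp add: mult_ac)
    finally have nQ: "norm Q \<le> 2 * r" using r by linarith
    define D where "D = W - T"
    have RQ: "R - Q = Q o\<^sub>L D o\<^sub>L R" using Q1 by (metis D_def add_diff_cancel_left' diff_add_cancel)
    have "Q - R - - (R o\<^sub>L D o\<^sub>L R) = (R o\<^sub>L D o\<^sub>L R) - (R - Q)" by simp
    also have "\<dots> = (R o\<^sub>L D o\<^sub>L R) - (Q o\<^sub>L D o\<^sub>L R)" by (simp only: RQ)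
    also have "\<dots> = (R - Q) o\<^sub>L D o\<^sub>L R" by (simp only: compose_distribs)
    also have "\<dots> = Q o\<^sub>L D o\<^sub>L R o\<^sub>L D o\<^sub>L R" by (simp only: RQ)
    also have "norm \<dots> \<le> norm Q * h * norm R * h * norm R"
      unfolding h_def D_def by (meson norm_blinfun_compose mult_right_mono norm_ge_zero order_trans)
    also have "\<dots> \<le> (2 * r) * h * r * h * r"
      using nQ r h by (intro mult_mono) auto
    also have "\<dots> = (h * (2 * r ^ 3)) * h" by (simp add: power3_eq_cube)
    also have "\<dots> \<le> e * h" using h by (intro mult_right_mono) auto
    finally show ?thesis by (simp add: h_def Q_def R_def D_def)
  qed
  then show "\<exists>d>0. \<forall>y. norm (y - T) < d \<longrightarrow>
      norm (op_inv y - op_inv T - - (op_inv T o\<^sub>L (y - T) o\<^sub>L op_inv T)) \<le> e * norm (y - T)"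
    using d by blast
qed

section \<open>Smoothness of operator products, inverses and inverse square roots\<close>

lemma smooth_on_compose:
  fixes f g :: "'v::real_normed_vector \<Rightarrow> 'a::real_normed_vector \<Rightarrow>\<^sub>L 'a"
  assumes "subspace E" "smooth_on E U f" "smooth_on E U g"
  shows "smooth_on E U (\<lambda>x. f x o\<^sub>L g x)"
  by (rule smooth_on_bilinear[OF bounded_bilinear_blinfun_compose assms])

lemma nths_UNIV [simp]: "nths xs UNIV = xs"
  by (simp add: nths_def)

lemma smooth_on_op_inv:
  fixes f :: "'v::real_normed_vector \<Rightarrow> 'a::banach \<Rightarrow>\<^sub>L 'a"
  assumes E: "subspace E" and f: "smooth_on E U f" and i: "\<And>x. x \<in> U \<Longrightarrow> invertible_op (f x)"
  shows "smooth_on E U (\<lambda>x. op_inv (f x))"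
proof (rule smooth_on_outer[OF bounded_bilinear_blinfun_compose E f])
  show "(op_inv has_derivative (\<lambda>V. - (op_inv (f x) o\<^sub>L V o\<^sub>L op_inv (f x)))) (at (f x))" if "x \<in> U" for x
    by (rule has_derivative_op_inv[OF i[OF that]])
  fix m :: "'v \<Rightarrow> 'v list \<Rightarrow> 'a \<Rightarrow>\<^sub>L 'a" assume m: "smooth_family E U (Suc 0) m"
  let ?G = "generated_family E U (o\<^sub>L) (\<lambda>x. op_inv (f x))"
  \<comment> \<open>The derivative of inversion is assembled as a product of four factors, with the
    constant \<open>- id_blinfun\<close> for the sign. The sets \<open>I\<close> of the three
    products send the only argument to no factor, to the second and to the first.\<close>
  have 1: "?G (0 + 0) (\<lambda>x vs. (- id_blinfun) o\<^sub>L op_inv (f x))"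
    by (rule generated_family.prod[where I = "{}"]) (auto intro: generated_family.intros smooth_family_const)
  have 2: "?G (0 + Suc 0) (\<lambda>x vs. ((- id_blinfun) o\<^sub>L op_inv (f x)) o\<^sub>L m x (nths vs (- {})))"
    by (rule generated_family.prod[OF 1[simplified]]) (auto intro: generated_family.intros m)
  have "?G (Suc 0 + 0) (\<lambda>x vs. (((- id_blinfun) o\<^sub>L op_inv (f x)) o\<^sub>L m x (nths vs {0})) o\<^sub>L op_inv (f x))"
    by (rule generated_family.prod[OF 2[simplified]]) (auto intro: generated_family.intros)
  then show "\<exists>m'. ?G (Suc 0) m' \<and> (\<forall>x v. m' x [v] = - (op_inv (f x) o\<^sub>L m x [v] o\<^sub>L op_inv (f x)))"
    by (intro exI conjI) (simp, simp add: compose_distribs)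
qed

text \<open>For \<open>s = 1 / sqrt r\<close> the derivative is \<open>- s ^ 3 / 2\<close>, a
  polynomial in \<open>s\<close> itself, as \<open>smooth_on_outer\<close> demands. This provides
  the inverse of the diagonal factor.\<close>

lemma smooth_on_inverse_sqrt:
  fixes f :: "'v::real_normed_vector \<Rightarrow> real"
  assumes E: "subspace E" and f: "smooth_on E U f" and pos: "\<And>x. x \<in> U \<Longrightarrow> f x > 0"
  shows "smooth_on E U (\<lambda>x. 1 / sqrt (f x))"
proof (rule smooth_on_outer[OF bounded_bilinear_mult E f])
  show "((\<lambda>r. 1 / sqrt r) has_derivative (\<lambda>v. (- (1 / 2) * (1 / sqrt (f x)) * (1 / sqrt (f x)) * (1 / sqrt (f x))) * v)) (at (f x))"
    if "x \<in> U" for x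
  proof -
    have "((\<lambda>r. 1 / sqrt r) has_real_derivative (- (1 / 2) * (1 / sqrt (f x)) * (1 / sqrt (f x)) * (1 / sqrt (f x)))) (at (f x))"
      using pos[OF that] by (auto intro!: derivative_eq_intros simp: field_simps)
    then show ?thesis unfolding has_field_derivative_def .
  qed
  fix m :: "'v \<Rightarrow> 'v list \<Rightarrow> real" assume m: "smooth_family E U (Suc 0) m"
  let ?s = "\<lambda>x. 1 / sqrt (f x)"
  let ?G = "generated_family E U (*) ?s"
  have 1: "?G (0 + 0) (\<lambda>x vs. (- (1 / 2)) * ?s x)"
    by (rule generated_family.prod[where I = "{}"]) (auto intro: generated_family.intros smooth_family_const)
  have 2: "?G (0 + 0) (\<lambda>x vs. (- (1 / 2)) * ?s x * ?s x)"
    using generated_family.prod[OF 1[simplified add_0] generated_family.gen, of "{}"] by simp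
  have 3: "?G (0 + 0) (\<lambda>x vs. (- (1 / 2)) * ?s x * ?s x * ?s x)"
    using generated_family.prod[OF 2[simplified add_0] generated_family.gen, of "{}"] by simp
  have "?G (0 + Suc 0) (\<lambda>x vs. ((- (1 / 2)) * ?s x * ?s x * ?s x) * m x (nths vs (- {})))"
    by (rule generated_family.prod[OF 3[simplified add_0]]) (auto intro: generated_family.intros m)
  then show "\<exists>m'. ?G (Suc 0) m' \<and> (\<forall>x v. m' x [v] = (- (1 / 2) * ?s x * ?s x * ?s x) * m x [v])"
    by (intro exI conjI) (simp only: add_0, simp)
qed

text \<open>For small \<open>\<rho> > 0\<close> the operator \<open>1 - \<rho> T\<close> is a contraction.\<close>

lemma invertible_op_coercive:
  fixes T :: "'a::{real_inner,banach} \<Rightarrow>\<^sub>L 'a"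
  assumes c: "c > 0" "\<And>x. T x \<bullet> x \<ge> c * (norm x)\<^sup>2"
  shows "invertible_op T"
proof -
  define s where "s = (norm T)\<^sup>2 + 1"
  \<comment> \<open>The squared norm of \<open>x - \<rho> T x\<close> is at most
    \<open>1 - 2 \<rho> c + \<rho>^2 s\<close> times that of \<open>x\<close>. This is least for
    \<open>\<rho> = c / s\<close>, with value \<open>1 - \<rho> c\<close>, whose square root is the
    contraction factor \<open>q\<close>.\<close>
  define \<rho> where "\<rho> = c / s"
  have s: "s > 0" by (simp add: s_def add_nonneg_pos)
  have \<rho>: "\<rho> > 0" using c s by (simp add: \<rho>_def)
  define q where "q = sqrt (max 0 (1 - \<rho> * c))"
  have q: "q < 1" using \<rho> c by (simp add: q_def)
  have "norm ((id_blinfun - \<rho> *\<^sub>R T) x) \<le> q * norm x" for x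
  proof -
    have "(norm ((id_blinfun - \<rho> *\<^sub>R T) x))\<^sup>2 = (norm x)\<^sup>2 - 2 * \<rho> * (T x \<bullet> x) + \<rho>\<^sup>2 * (norm (T x))\<^sup>2"
      unfolding power2_norm_eq_inner
      by (simp add: blinfun.bilinear_simps inner_diff inner_commute algebra_simps power2_eq_square del: dot_square_norm)
    also have "\<dots> \<le> (norm x)\<^sup>2 - 2 * \<rho> * (c * (norm x)\<^sup>2) + \<rho>\<^sup>2 * (s * (norm x)\<^sup>2)"
    proof -
      have "(norm (T x))\<^sup>2 \<le> (norm T * norm x)\<^sup>2" by (intro power_mono norm_blinfun) auto
      also have "\<dots> \<le> s * (norm x)\<^sup>2" by (simp add: s_def power_mult_distrib algebra_simps)
      finally have "\<rho>\<^sup>2 * (norm (T x))\<^sup>2 \<le> \<rho>\<^sup>2 * (s * (norm x)\<^sup>2)" by (intro mult_left_mono) auto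
      moreover have "2 * \<rho> * (c * (norm x)\<^sup>2) \<le> 2 * \<rho> * (T x \<bullet> x)" using c \<rho> by (intro mult_left_mono) auto
      ultimately show ?thesis by linarith
    qed
    also have "\<rho>\<^sup>2 * (s * (norm x)\<^sup>2) = \<rho> * c * (norm x)\<^sup>2" using s by (simp add: \<rho>_def power2_eq_square)
    also have "(norm x)\<^sup>2 - 2 * \<rho> * (c * (norm x)\<^sup>2) + \<rho> * c * (norm x)\<^sup>2 = (1 - \<rho> * c) * (norm x)\<^sup>2"
      by (simp add: algebra_simps)
    also have "\<dots> \<le> (q * norm x)\<^sup>2" by (simp add: q_def power_mult_distrib mult_right_mono)
    finally show ?thesis by (rule power2_le_imp_le) (simp add: q_def)
  qed
  then have "norm (id_blinfun - \<rho> *\<^sub>R T) \<le> q" by (intro norm_blinfun_bound) (auto simp: q_def)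
  then have "invertible_op (id_blinfun - (id_blinfun - \<rho> *\<^sub>R T))" using q by (intro invertible_op_neumann) linarith
  then have "invertible_op (\<rho> *\<^sub>R T)" by simp
  from invertible_op_scaleR(1)[OF this, of "1 / \<rho>"] \<rho> show ?thesis by simp
qed

section \<open>The exponential of an operator\<close>

lemma op_exp_op_pow: "op_exp X = (\<Sum>n. (1 / fact n) *\<^sub>R op_pow X n)"
  by (simp add: op_exp_def op_pow_def)

lemma norm_op_exp_term: "norm ((1 / fact n) *\<^sub>R op_pow X n) \<le> norm X ^ n /\<^sub>R fact n"
  using norm_op_pow[of X n] by (simp add: divide_simps)

lemma summable_norm_op_exp:
  "summable (\<lambda>n. norm ((1 / fact n) *\<^sub>R op_pow (X :: 'a::banach \<Rightarrow>\<^sub>L 'a) n))"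
  by (rule summable_comparison_test[OF _ summable_exp_generic[of "norm X"]]) (use norm_op_exp_term in auto)

lemma summable_op_exp: "summable (\<lambda>n. (1 / fact n) *\<^sub>R op_pow (X :: 'a::banach \<Rightarrow>\<^sub>L 'a) n)"
  by (rule summable_norm_cancel[OF summable_norm_op_exp])

lemma suminf_in_closed_subspace:
  fixes f :: "nat \<Rightarrow> 'a::real_normed_vector"
  assumes "closed S" "subspace S" "summable f" "\<And>n. f n \<in> S"
  shows "suminf f \<in> S"
  by (rule closed_sequentially[OF assms(1) _ summable_LIMSEQ[OF assms(3)]]) (simp add: assms subspace_sum)

lemma op_exp_in_closed_subspace:
  assumes "closed S" "subspace S" "\<And>n. op_pow X n \<in> S"
  shows "op_exp X \<in> S"
  unfolding op_exp_op_pow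
  by (rule suminf_in_closed_subspace[OF assms(1,2) summable_op_exp]) (simp add: assms subspace_scale)

lemma adj_op_pow: "adj (op_pow X n) = op_pow (adj X) n"
  by (induction n) (simp_all add: adj_compose op_pow_Suc_right[of "adj X"] del: op_pow_Suc,
      simp add: adj_compose op_pow_Suc_right flip: op_pow_Suc)

lemma adj_op_exp: "adj (op_exp X) = op_exp (adj X)"
  unfolding op_exp_op_pow bounded_linear.suminf[OF bounded_linear_adj summable_op_exp]
  by (simp add: adj_scaleR adj_op_pow)

lemma op_exp_apply: "op_exp X x = (\<Sum>n. (1 / fact n) *\<^sub>R op_pow X n x)"
  unfolding op_exp_op_pow bounded_linear.suminf[OF blinfun.bounded_linear_left summable_op_exp]
  by (simp add: blinfun.bilinear_simps)

lemma norm_op_exp_linear: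
  assumes "norm X \<le> 1"
  shows "norm (op_exp X - id_blinfun - X) \<le> (norm X)\<^sup>2"
proof -
  let ?f = "\<lambda>n. (1 / fact n) *\<^sub>R op_pow X n" and ?g = "\<lambda>n. norm X ^ n /\<^sub>R fact n"
  have "op_exp X - id_blinfun - X = (\<Sum>n. ?f (n + 2))"
    unfolding op_exp_op_pow using suminf_minus_initial_segment[OF summable_op_exp, of 2 X]
    by (simp add: numeral_2_eq_2)
  also have "norm \<dots> \<le> (\<Sum>n. ?g (n + 2))"
    by (rule norm_suminf_le[OF norm_op_exp_term summable_ignore_initial_segment[OF summable_exp_generic]])
  also have "\<dots> = exp (norm X) - 1 - norm X"
    unfolding exp_def using suminf_minus_initial_segment[OF summable_exp_generic[of "norm X"], of 2]
    by (simp add: numeral_2_eq_2)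
  also have "\<dots> \<le> (norm X)\<^sup>2" using exp_bound[of "norm X"] assms by simp
  finally show ?thesis .
qed

text \<open>The library has Cauchy products only in normed algebras; operators of type
  \<open>'a \<Rightarrow>\<^sub>L 'a\<close> are no instance. The remainder is compared with that of the product of the norms.\<close>

lemma Cauchy_product_sums_compose:
  fixes a b :: "nat \<Rightarrow> ('a::banach \<Rightarrow>\<^sub>L 'a)"
  assumes a: "summable (\<lambda>k. norm (a k))" and b: "summable (\<lambda>k. norm (b k))"
  shows "(\<lambda>k. \<Sum>i\<le>k. a i o\<^sub>L b (k - i)) sums (suminf a o\<^sub>L suminf b)"
proof -
  let ?Q = "\<lambda>n::nat. {..<n} \<times> {..<n}" and ?T = "\<lambda>n::nat. {(i, j). i + j < n}"
  have TQ: "?T n \<subseteq> ?Q n" for n by auto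
  let ?u = "\<lambda>n. (\<Sum>i<n. a i) o\<^sub>L (\<Sum>j<n. b j)" and ?v = "\<lambda>n. \<Sum>k<n. \<Sum>i\<le>k. a i o\<^sub>L b (k - i)"
  let ?ru = "\<lambda>n. (\<Sum>i<n. norm (a i)) * (\<Sum>j<n. norm (b j))"
  let ?rv = "\<lambda>n. \<Sum>k<n. \<Sum>i\<le>k. norm (a i) * norm (b (k - i))"
  have u: "?u n - ?v n = (\<Sum>(i, j)\<in>?Q n - ?T n. a i o\<^sub>L b j)" for n
  proof -
    have "?u n = (\<Sum>(i, j)\<in>?Q n. a i o\<^sub>L b j)"
      by (simp only: bounded_bilinear.sum_left[OF bounded_bilinear_blinfun_compose]
          bounded_bilinear.sum_right[OF bounded_bilinear_blinfun_compose] sum.cartesian_product[symmetric])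
        (rule sum.swap)
    moreover have "?v n = (\<Sum>(i, j)\<in>?T n. a i o\<^sub>L b j)" by (rule sum.triangle_reindex[symmetric])
    ultimately show ?thesis using sum.subset_diff[OF TQ[of n], of "\<lambda>(i, j). a i o\<^sub>L b j"] by simp
  qed
  have ru: "?ru n - ?rv n = (\<Sum>(i, j)\<in>?Q n - ?T n. norm (a i) * norm (b j))" for n
  proof -
    have "?ru n = (\<Sum>(i, j)\<in>?Q n. norm (a i) * norm (b j))" by (simp add: sum_product sum.cartesian_product)
    moreover have "?rv n = (\<Sum>(i, j)\<in>?T n. norm (a i) * norm (b j))" by (rule sum.triangle_reindex[symmetric])
    ultimately show ?thesis using sum.subset_diff[OF TQ[of n], of "\<lambda>(i, j). norm (a i) * norm (b j)"] by simp
  qed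
  have bound: "norm (?u n - ?v n) \<le> ?ru n - ?rv n" for n
    unfolding u ru by (rule sum_norm_le) (auto intro: norm_blinfun_compose)
  have "?ru \<longlonglongrightarrow> (\<Sum>k. norm (a k)) * (\<Sum>k. norm (b k))"
    by (intro tendsto_mult summable_LIMSEQ a b)
  moreover have "?rv \<longlonglongrightarrow> (\<Sum>k. norm (a k)) * (\<Sum>k. norm (b k))"
    using Cauchy_product_sums[of "\<lambda>k. norm (a k)" "\<lambda>k. norm (b k)"] a b by (simp add: sums_def)
  ultimately have "(\<lambda>n. ?ru n - ?rv n) \<longlonglongrightarrow> 0" using tendsto_diff by fastforce
  then have "(\<lambda>n. ?u n - ?v n) \<longlonglongrightarrow> 0"
    by (rule Lim_null_comparison[rotated]) (simp add: bound)
  moreover have "?u \<longlonglongrightarrow> (suminf a o\<^sub>L suminf b)"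
    by (intro bounded_bilinear.tendsto[OF bounded_bilinear_blinfun_compose] summable_LIMSEQ
        summable_norm_cancel[OF a] summable_norm_cancel[OF b])
  ultimately have "(\<lambda>n. ?u n - (?u n - ?v n)) \<longlonglongrightarrow> (suminf a o\<^sub>L suminf b) - 0"
    by (intro tendsto_diff)
  then show ?thesis by (simp add: sums_def)
qed

lemma op_pow_minus: "op_pow (- X) n = (- 1) ^ n *\<^sub>R op_pow X n"
  by (induction n) (simp_all add: compose_distribs)

text \<open>By the binomial theorem the term of degree \<open>k\<close> in the Cauchy product is
  \<open>(1 + (- 1)) ^ k / fact k\<close> times a power of \<open>X\<close>, hence zero except for
  \<open>k = 0\<close>.\<close>

lemma op_exp_minus: "op_exp X o\<^sub>L op_exp (- X) = id_blinfun"
proof -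
  have "(\<Sum>i\<le>k. ((1 / fact i) *\<^sub>R op_pow X i) o\<^sub>L ((1 / fact (k - i)) *\<^sub>R op_pow (- X) (k - i))) =
      (if k = 0 then id_blinfun else 0)" for k
  proof -
    have "(\<Sum>i\<le>k. ((1 / fact i) *\<^sub>R op_pow X i) o\<^sub>L ((1 / fact (k - i)) *\<^sub>R op_pow (- X) (k - i))) =
        (\<Sum>i\<le>k. (1 / fact k * (real (k choose i) * 1 ^ i * (- 1) ^ (k - i))) *\<^sub>R op_pow X k)"
    proof (rule sum.cong)
      fix i assume "i \<in> {..k}"
      then have i: "i \<le> k" by simp
      have "1 / fact i * (1 / fact (k - i) * (- 1) ^ (k - i)) = 1 / fact k * (real (k choose i) * 1 ^ i * (- 1) ^ (k - i))"
        using binomial_fact[OF i, where 'a = real] by simp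
      moreover have "op_pow X i o\<^sub>L op_pow X (k - i) = op_pow X k" using i op_pow_add[of X i "k - i"] by simp
      ultimately show "((1 / fact i) *\<^sub>R op_pow X i) o\<^sub>L ((1 / fact (k - i)) *\<^sub>R op_pow (- X) (k - i)) =
          (1 / fact k * (real (k choose i) * 1 ^ i * (- 1) ^ (k - i))) *\<^sub>R op_pow X k"
        by (simp add: op_pow_minus compose_distribs mult_ac)
    qed simp
    also have "\<dots> = (1 / fact k * (1 + (- 1)) ^ k) *\<^sub>R op_pow X k"
      unfolding binomial_ring scaleR_left.sum[symmetric] sum_distrib_left by simp
    finally show ?thesis by (simp add: power_0_left)
  qed
  then have "(\<lambda>k. if k = 0 then id_blinfun else 0) sums (op_exp X o\<^sub>L op_exp (- X))"
    using Cauchy_product_sums_compose[OF summable_norm_op_exp[of X] summable_norm_op_exp[of "- X"]]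
    by (simp add: op_exp_op_pow)
  then show ?thesis using sums_single[of 0 "\<lambda>_. id_blinfun"] sums_unique2 by blast
qed

lemma invertible_op_exp: "invertible_op (op_exp X)" "op_inv (op_exp X) = op_exp (- X)"
  using op_inv_eqI[of "op_exp (- X)" "op_exp X"] op_exp_minus[of X] op_exp_minus[of "- X"] by auto

text \<open>These quotients recover \<open>X\<close> from the values of its one-parameter group near
  the identity; through them a subgroup restricts its Lie algebra.\<close>

lemma op_exp_difference_quotient:
  "(\<lambda>n. real (Suc n) *\<^sub>R (op_exp ((1 / real (Suc n)) *\<^sub>R X) - id_blinfun)) \<longlonglongrightarrow> X"
proof -
  define t where "t = (\<lambda>n. 1 / real (Suc n))"
  have t0: "t \<longlonglongrightarrow> 0" unfolding t_def using LIMSEQ_inverse_real_of_nat by (simp add: inverse_eq_divide)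
  have tX: "(\<lambda>n. t n * norm X) \<longlonglongrightarrow> 0" using tendsto_mult_right[OF t0, of "norm X"] by simp
  have tX2: "(\<lambda>n. t n * (norm X)\<^sup>2) \<longlonglongrightarrow> 0" using tendsto_mult_right[OF t0, of "(norm X)\<^sup>2"] by simp
  have "\<forall>\<^sub>F n in sequentially. norm (real (Suc n) *\<^sub>R (op_exp (t n *\<^sub>R X) - id_blinfun) - X) \<le> t n * (norm X)\<^sup>2"
    using order_tendstoD(2)[OF tX zero_less_one]
  proof eventually_elim
    case (elim n)
    have st: "real (Suc n) * t n = 1" "t n > 0" by (simp_all add: t_def)
    have "norm (op_exp (t n *\<^sub>R X) - id_blinfun - t n *\<^sub>R X) \<le> (t n * norm X)\<^sup>2"
      using norm_op_exp_linear[of "t n *\<^sub>R X"] elim st by simp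
    then have "real (Suc n) * norm (op_exp (t n *\<^sub>R X) - id_blinfun - t n *\<^sub>R X) \<le> real (Suc n) * (t n * norm X)\<^sup>2"
      by (intro mult_left_mono) auto
    also have "\<dots> = (real (Suc n) * t n) * (t n * (norm X)\<^sup>2)" by (simp add: power2_eq_square)
    also have "\<dots> = t n * (norm X)\<^sup>2" by (simp only: st mult_1)
    finally have "norm (real (Suc n) *\<^sub>R (op_exp (t n *\<^sub>R X) - id_blinfun - t n *\<^sub>R X)) \<le> t n * (norm X)\<^sup>2"
      by (simp del: of_nat_Suc)
    moreover have "real (Suc n) *\<^sub>R (op_exp (t n *\<^sub>R X) - id_blinfun - t n *\<^sub>R X) =
        real (Suc n) *\<^sub>R (op_exp (t n *\<^sub>R X) - id_blinfun) - X"
      using st(1) by (simp add: scaleR_diff_right del: of_nat_Suc)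
    ultimately show ?case by (simp del: of_nat_Suc)
  qed
  then have "(\<lambda>n. real (Suc n) *\<^sub>R (op_exp (t n *\<^sub>R X) - id_blinfun) - X) \<longlonglongrightarrow> 0"
    by (rule Lim_null_comparison[OF _ tX2])
  then show ?thesis unfolding t_def by (rule Lim_transform_eq[THEN iffD2, OF _ tendsto_const])
qed

section \<open>Complex Hilbert spaces\<close>

lemma cinner_add_right: "cinner x (y + z) = cinner x y + cinner x z"
  by (metis cinner_add_left cinner_commute complex_cnj_add)

lemma cinner_scaleC_right: "cinner x (a *\<^sub>C y) = cnj a * cinner x y"
  by (metis cinner_scaleC_left cinner_commute complex_cnj_mult)

lemma cinner_scaleR_left: "cinner (r *\<^sub>R x) y = of_real r * cinner x y"
  by (simp add: scaleR_eq_scaleC cinner_scaleC_left)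

lemma cinner_scaleR_right: "cinner x (r *\<^sub>R y) = of_real r * cinner x y"
  by (simp add: scaleR_eq_scaleC cinner_scaleC_right)

lemma cinner_zero_left [simp]: "cinner 0 y = 0"
  using cinner_scaleR_left[of 0 0 y] by simp

lemma cinner_zero_right [simp]: "cinner x 0 = 0"
  using cinner_scaleR_right[of x 0 0] by simp

lemma cinner_minus_left: "cinner (- x) y = - cinner x y"
  using cinner_scaleR_left[of "-1" x y] by simp

lemma cinner_minus_right: "cinner x (- y) = - cinner x y"
  using cinner_scaleR_right[of x "-1" y] by simp

lemma cinner_diff_left: "cinner (x - y) z = cinner x z - cinner y z"
  using cinner_add_left[of x "- y" z] by (simp add: cinner_minus_left)

lemma cinner_diff_right: "cinner x (y - z) = cinner x y - cinner x z"
  using cinner_add_right[of x y "- z"] by (simp add: cinner_minus_right)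

lemma cinner_sum_left: "cinner (\<Sum>i\<in>A. f i) y = (\<Sum>i\<in>A. cinner (f i) y)"
  by (induction A rule: infinite_finite_induct) (simp_all add: cinner_add_left)

lemma cinner_sum_right: "cinner x (\<Sum>i\<in>A. f i) = (\<Sum>i\<in>A. cinner x (f i))"
  by (induction A rule: infinite_finite_induct) (simp_all add: cinner_add_right)

lemmas cinner_simps = cinner_add_left cinner_add_right cinner_diff_left cinner_diff_right
  cinner_minus_left cinner_minus_right cinner_scaleC_left cinner_scaleC_right
  cinner_scaleR_left cinner_scaleR_right cinner_sum_left cinner_sum_right

lemma scaleC_zero [simp]: "0 *\<^sub>C (x::'a::complex_hilbert) = 0" "a *\<^sub>C (0::'a) = 0"
  by (rule complex_vector.scale_zero_left, rule complex_vector.scale_zero_right)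

lemma cinner_self: "cinner x x = of_real ((norm x)\<^sup>2)"
proof (rule complex_eqI)
  have "cinner x x = cnj (cinner x x)" by (rule cinner_commute)
  then show "Im (cinner x x) = Im (complex_of_real ((norm x)\<^sup>2))"
    by (metis Im_complex_of_real cnj.simps(2) neg_equal_zero)
qed (simp add: power2_norm_eq_inner inner_eq_Re_cinner)

text \<open>Multiplication by \<open>- \<i>\<close> turns imaginary parts into real ones, so an
  identity for the real inner product passes to the complex form once the operators in it commute
  with complex scalars.\<close>

lemma Im_cinner: "Im (cinner x y) = ((- \<i>) *\<^sub>C x) \<bullet> y"
  by (simp add: inner_eq_Re_cinner cinner_scaleC_left cinner_minus_left)

lemma norm_scaleC: "norm (a *\<^sub>C x) = cmod a * norm (x::'a::complex_hilbert)"
proof -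
  have "cinner (a *\<^sub>C x) (a *\<^sub>C x) = (a * cnj a) * cinner x x"
    by (simp add: cinner_scaleC_left cinner_scaleC_right)
  then have "complex_of_real ((norm (a *\<^sub>C x))\<^sup>2) = of_real ((cmod a * norm x)\<^sup>2)"
    unfolding cinner_self complex_norm_square[symmetric] by (simp add: power_mult_distrib)
  then have "(norm (a *\<^sub>C x))\<^sup>2 = (cmod a * norm x)\<^sup>2" by (simp only: of_real_eq_iff)
  then show ?thesis by (simp add: power2_eq_iff_nonneg)
qed

lemma cmod_cinner_le: "cmod (cinner x y) \<le> norm x * norm y"
proof (cases "cinner x y = 0")
  case False
  \<comment> \<open>A phase that makes the inner product real and nonnegative, so that the real
    Cauchy-Schwarz inequality applies.\<close>
  define u where "u = cnj (cinner x y) / cmod (cinner x y)"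
  have u: "cmod u = 1" using False by (simp add: u_def norm_divide)
  have "u * cinner x y = of_real (cmod (cinner x y))"
    using False by (simp add: u_def complex_norm_square[symmetric] power2_eq_square mult.commute)
  then have "cmod (cinner x y) = (u *\<^sub>C x) \<bullet> y"
    by (simp add: inner_eq_Re_cinner cinner_scaleC_left)
  also have "\<dots> \<le> norm (u *\<^sub>C x) * norm y" by (rule norm_cauchy_schwarz)
  finally show ?thesis by (simp add: norm_scaleC u)
qed simp

lemma bounded_linear_scaleC: "bounded_linear (\<lambda>x::'a::complex_hilbert. c *\<^sub>C x)"
  by (rule bounded_linear_intro[of _ "cmod c"])
    (simp_all add: scaleC_add_right scaleR_eq_scaleC scaleC_scaleC norm_scaleC mult.commute)

lemma bounded_linear_cinner_left: "bounded_linear (\<lambda>x::'a::complex_hilbert. cinner x y)"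
  by (rule bounded_linear_intro[of _ "norm y"])
    (simp_all add: cinner_simps scaleR_conv_of_real cmod_cinner_le)

lemma bounded_linear_cinner_right: "bounded_linear (\<lambda>y::'a::complex_hilbert. cinner x y)"
  by (rule bounded_linear_intro[of _ "norm x"])
    (simp_all add: cinner_simps scaleR_conv_of_real cmod_cinner_le mult.commute[of _ "norm x"])

lemmas continuous_on_cinner = bounded_linear.continuous_on[OF bounded_linear_cinner_left]
  bounded_linear.continuous_on[OF bounded_linear_cinner_right]
  bounded_linear.continuous_on[OF bounded_linear_scaleC]

lemma complex_subspace_imp_subspace: "complex_vector.subspace S \<Longrightarrow> subspace S"
  by (simp add: complex_vector.subspace_def subspace_def scaleR_eq_scaleC)

lemma norm_sum_orthogonal:
  fixes y :: "'i \<Rightarrow> 'a::complex_hilbert"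
  assumes "finite F" "\<And>i j. i \<in> F \<Longrightarrow> j \<in> F \<Longrightarrow> i \<noteq> j \<Longrightarrow> cinner (y i) (y j) = 0"
  shows "(norm (\<Sum>j\<in>F. c j *\<^sub>C y j))\<^sup>2 = (\<Sum>j\<in>F. (cmod (c j))\<^sup>2 * (norm (y j))\<^sup>2)"
  using assms
proof (induction F rule: finite_induct)
  case (insert i F)
  have "cinner (c i *\<^sub>C y i) (\<Sum>j\<in>F. c j *\<^sub>C y j) = 0"
    unfolding cinner_sum_right
  proof (rule sum.neutral, rule ballI)
    fix j assume "j \<in> F"
    then have "cinner (y i) (y j) = 0" using insert.hyps(2) by (intro insert.prems) auto
    then show "cinner (c i *\<^sub>C y i) (c j *\<^sub>C y j) = 0" by (simp add: cinner_simps)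
  qed
  then have "orthogonal (c i *\<^sub>C y i) (\<Sum>j\<in>F. c j *\<^sub>C y j)"
    by (simp add: orthogonal_def inner_eq_Re_cinner)
  from norm_add_Pythagorean[OF this] show ?case
    using insert by (simp add: norm_scaleC power_mult_distrib)
qed simp

section \<open>Complex linear operators\<close>

lemma bounded_operators_iff:
  "T \<in> bounded_operators \<longleftrightarrow> (\<forall>c x. blinfun_apply T (c *\<^sub>C x) = c *\<^sub>C blinfun_apply T x)"
  by (simp add: bounded_operators_def)

lemma bounded_operatorsD: "T \<in> bounded_operators \<Longrightarrow> blinfun_apply T (c *\<^sub>C x) = c *\<^sub>C blinfun_apply T x"
  by (simp add: bounded_operators_def)

lemma subspace_bounded_operators: "subspace (bounded_operators :: ('a::complex_hilbert \<Rightarrow>\<^sub>L 'a) set)"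
  unfolding subspace_def
  by (auto simp: bounded_operators_def blinfun.bilinear_simps scaleC_add_right scaleR_eq_scaleC scaleC_scaleC mult.commute)

lemma closed_bounded_operators: "closed (bounded_operators :: ('a::complex_hilbert \<Rightarrow>\<^sub>L 'a) set)"
  unfolding bounded_operators_def
  by (intro closed_Collect_all closed_Collect_eq continuous_intros continuous_on_cinner)

lemma id_bounded_operators [simp]: "id_blinfun \<in> bounded_operators"
  by (simp add: bounded_operators_def)

lemma compose_bounded_operators [simp]:
  "S \<in> bounded_operators \<Longrightarrow> T \<in> bounded_operators \<Longrightarrow> (S o\<^sub>L T) \<in> bounded_operators"
  by (simp add: bounded_operators_def)

lemma cinner_adj:
  assumes "T \<in> bounded_operators"
  shows "cinner (blinfun_apply T x) y = cinner x (blinfun_apply (adj T) y)"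
proof (rule complex_eqI)
  show "Re (cinner (blinfun_apply T x) y) = Re (cinner x (blinfun_apply (adj T) y))"
    using inner_adj[of T x y] by (simp add: inner_eq_Re_cinner)
  show "Im (cinner (blinfun_apply T x) y) = Im (cinner x (blinfun_apply (adj T) y))"
    unfolding Im_cinner bounded_operatorsD[OF assms, symmetric] by (rule inner_adj)
qed

lemma cinner_eqI: "(\<And>x. cinner x y = cinner x z) \<Longrightarrow> y = z"
proof -
  assume "\<And>x. cinner x y = cinner x z"
  then have "cinner (y - z) (y - z) = 0" by (simp add: cinner_diff_right)
  then show "y = z" by (simp add: cinner_self)
qed

lemma adj_bounded_operators [simp]:
  assumes "T \<in> bounded_operators" shows "adj T \<in> bounded_operators"
  unfolding bounded_operators_iff
proof (intro allI cinner_eqI)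
  fix c x y
  show "cinner y (blinfun_apply (adj T) (c *\<^sub>C x)) = cinner y (c *\<^sub>C blinfun_apply (adj T) x)"
    by (simp add: cinner_adj[OF assms, symmetric] cinner_scaleC_right)
qed

lemma cadjoint_eq_adj:
  assumes "T \<in> bounded_operators" shows "cadjoint T = adj T"
  unfolding cadjoint_def
proof (rule the_equality)
  show "\<forall>x y. cinner (blinfun_apply T x) y = cinner x (blinfun_apply (adj T) y)"
    using cinner_adj[OF assms] by blast
  show "S = adj T" if "\<forall>x y. cinner (blinfun_apply T x) y = cinner x (blinfun_apply S y)" for S
    by (rule adj_eqI[symmetric]) (use that in \<open>simp add: inner_eq_Re_cinner\<close>)
qed

lemma op_inv_bounded_operators [simp]:
  assumes "T \<in> bounded_operators" "invertible_op T"
  shows "op_inv T \<in> bounded_operators"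
  unfolding bounded_operators_iff
proof (intro allI)
  fix c x
  have "op_inv T (c *\<^sub>C x) = op_inv T (c *\<^sub>C T (op_inv T x))" by (simp add: op_inv_apply[OF assms(2)])
  also have "\<dots> = c *\<^sub>C op_inv T x"
    by (simp only: bounded_operatorsD[OF assms(1), symmetric] op_inv_apply(1)[OF assms(2)])
  finally show "op_inv T (c *\<^sub>C x) = c *\<^sub>C op_inv T x" .
qed

lemma op_pow_bounded_operators: "X \<in> bounded_operators \<Longrightarrow> op_pow X n \<in> bounded_operators"
  by (induction n) simp_all

lemma op_exp_bounded_operators: "X \<in> bounded_operators \<Longrightarrow> op_exp X \<in> bounded_operators"
  by (rule op_exp_in_closed_subspace[OF closed_bounded_operators subspace_bounded_operators op_pow_bounded_operators])

lemma monoid_bounded_operators: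
  "monoid \<lparr>carrier = bounded_operators, mult = (o\<^sub>L), one = id_blinfun\<rparr>"
  by unfold_locales (auto simp: blinfun_compose_assoc)

lemma group_GL: "group GL"
  unfolding GL_def by (rule monoid.units_group[OF monoid_bounded_operators])

lemma carrier_GL: "carrier GL = {T \<in> bounded_operators. invertible_op T}"
proof -
  have "T \<in> carrier GL \<longleftrightarrow> T \<in> bounded_operators \<and> invertible_op T" for T :: "'a \<Rightarrow>\<^sub>L 'a"
  proof -
    have "T \<in> carrier GL \<longleftrightarrow> T \<in> bounded_operators \<and>
        (\<exists>S\<in>bounded_operators. S o\<^sub>L T = id_blinfun \<and> T o\<^sub>L S = id_blinfun)"
      by (simp add: GL_def units_of_def Units_def)
    also have "\<dots> \<longleftrightarrow> T \<in> bounded_operators \<and> invertible_op T"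
      using op_inv[of T] op_inv_bounded_operators[of T] unfolding invertible_op_def by blast
    finally show ?thesis .
  qed
  then show ?thesis by blast
qed

lemma mult_GL [simp]: "S \<otimes>\<^bsub>GL\<^esub> T = S o\<^sub>L T" by (simp add: GL_def units_of_def)
lemma one_GL [simp]: "\<one>\<^bsub>GL\<^esub> = id_blinfun" by (simp add: GL_def units_of_def)

lemma inv_GL: "T \<in> carrier GL \<Longrightarrow> inv\<^bsub>GL\<^esub> T = op_inv T"
  using group.inv_equality[OF group_GL, of "op_inv T" T]
  by (simp add: carrier_GL op_inv invertible_op_inv)

lemma subgroup_GL_I:
  assumes "S \<subseteq> carrier GL" "id_blinfun \<in> S" "\<And>s t. s \<in> S \<Longrightarrow> t \<in> S \<Longrightarrow> (s o\<^sub>L t) \<in> S"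
    "\<And>s. s \<in> S \<Longrightarrow> op_inv s \<in> S"
  shows "subgroup S GL"
proof (rule subgroup.intro)
  show "inv\<^bsub>GL\<^esub> s \<in> S" if "s \<in> S" for s
    using assms(4)[OF that] inv_GL[of s] assms(1) that by (metis subsetD)
qed (use assms in auto)

lemma inv_GL_subgroup:
  assumes "subgroup S GL" "s \<in> S"
  shows "inv\<^bsub>GL\<lparr>carrier := S\<rparr>\<^esub> s = op_inv s"
  using group.m_inv_consistent[OF group_GL assms] inv_GL subgroup.mem_carrier[OF assms] by simp

lemma openin_GL: "openin (top_of_set bounded_operators) (carrier GL :: ('a::complex_hilbert \<Rightarrow>\<^sub>L 'a) set)"
  unfolding openin_open carrier_GL using open_invertible_op by blast

section \<open>Charts\<close>

lemma the_inv_into_left_inverse: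
  assumes "\<And>x. x \<in> U \<Longrightarrow> \<psi> (\<phi> x) = x" "x \<in> U"
  shows "the_inv_into U \<phi> (\<phi> x) = x"
  using assms by (metis inj_onI the_inv_into_f_f)

text \<open>The expression of \<open>F\<close> in coordinates is smooth into the ambient space,
  hence continuous, and \<open>Q\<close> cuts an open domain out of the chart. The assumption on
  \<rho> stands for the chain rule with the target chart. Transition maps are the case that
  \<open>F\<close> is the identity.\<close>

lemma smooth_on_local_representation:
  fixes \<phi> :: "'p::topological_space \<Rightarrow> 'v::real_normed_vector"
    and F :: "'p \<Rightarrow> 'q::real_normed_vector" and \<rho> :: "'q \<Rightarrow> 'w::real_normed_vector"
  assumes E: "subspace E" and \<psi>: "\<And>x. x \<in> U \<Longrightarrow> \<psi> (\<phi> x) = x"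
    and F: "smooth_on E (\<phi> ` U) (\<lambda>x. F (\<psi> x))" "F ` U \<subseteq> T"
    and V: "V = T \<inter> Q" "open Q"
    and \<rho>: "\<And>W g. smooth_on E W g \<Longrightarrow> g ` W \<subseteq> V \<Longrightarrow> smooth_on E W (\<lambda>x. \<rho> (g x))"
  shows "smooth_on E (\<phi> ` (U \<inter> F -` V)) (\<rho> \<circ> F \<circ> the_inv_into U \<phi>)"
proof -
  have eq: "\<phi> ` (U \<inter> F -` V) = \<phi> ` U \<inter> (\<lambda>x. F (\<psi> x)) -` Q"
    using \<psi> F(2) V(1) by force
  have "openin (top_of_set (\<phi> ` U)) (\<phi> ` U \<inter> (\<lambda>x. F (\<psi> x)) -` Q)"
    using smooth_on_continuous[OF E F(1)] V(2) continuous_openin_preimage_gen by blast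
  then have o: "openin (top_of_set E) (\<phi> ` (U \<inter> F -` V))"
    using openin_trans smooth_on_openin[OF F(1)] eq by metis
  have "smooth_on E (\<phi> ` (U \<inter> F -` V)) (\<lambda>x. \<rho> (F (\<psi> x)))"
    by (rule \<rho>[OF smooth_on_openin_subset[OF F(1) o]]) (use \<psi> in auto)
  then show ?thesis
    by (rule smooth_on_cong) (use \<psi> the_inv_into_left_inverse[of U \<psi> \<phi>] in auto)
qed

text \<open>An explicit inverse \<open>\<psi>\<close>, smooth as a map into the ambient space, is
  more than an abstract manifold demands. It allows smoothness to be checked on operator
  formulas.\<close>

definition lie_chart :: "'p::real_normed_vector set \<Rightarrow> 'v::real_normed_vector set \<Rightarrow> 'p set \<Rightarrow> ('p \<Rightarrow> 'v) \<Rightarrow> ('v \<Rightarrow> 'p) \<Rightarrow> bool"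
  where "lie_chart S E U \<phi> \<psi> \<longleftrightarrow> (\<exists>Q. open Q \<and> U = S \<inter> Q) \<and> continuous_on U \<phi> \<and>
    (\<forall>x\<in>U. \<psi> (\<phi> x) = x) \<and> smooth_on E (\<phi> ` U) \<psi>"

lemma banach_manifoldI:
  fixes M :: "('p::real_normed_vector, 'e::banach) manifold"
  assumes E: "subspace (model_space M)" "closed (model_space M)"
    and un: "(\<Union>(U, \<phi>)\<in>charts M. U) = points M"
    and ch: "\<And>U \<phi>. (U, \<phi>) \<in> charts M \<Longrightarrow> \<exists>\<psi>. lie_chart (points M) (model_space M) U \<phi> \<psi>"
    and sm: "\<And>U \<phi> W g. (U, \<phi>) \<in> charts M \<Longrightarrow> smooth_on (model_space M) W g \<Longrightarrow> g ` W \<subseteq> U \<Longrightarrow>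
       smooth_on (model_space M) W (\<lambda>x. \<phi> (g x))"
  shows "banach_manifold M"
proof -
  have 1: "openin (top_of_set (points M)) U \<and> openin (top_of_set (model_space M)) (\<phi> ` U) \<and>
       inj_on \<phi> U \<and> homeomorphism U (\<phi> ` U) \<phi> (the_inv_into U \<phi>)"
    if U: "(U, \<phi>) \<in> charts M" for U \<phi>
  proof -
    obtain \<psi> Q where \<psi>: "open Q" "U = points M \<inter> Q" "continuous_on U \<phi>" "\<And>x. x \<in> U \<Longrightarrow> \<psi> (\<phi> x) = x"
      "smooth_on (model_space M) (\<phi> ` U) \<psi>"
      using ch[OF U] unfolding lie_chart_def by blast
    have inj: "inj_on \<phi> U" using \<psi>(4) by (metis inj_onI)
    have inv: "the_inv_into U \<phi> (\<phi> x) = x" if "x \<in> U" for x using the_inv_into_f_f[OF inj that] .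
    have "continuous_on (\<phi> ` U) (the_inv_into U \<phi>)"
      using smooth_on_continuous[OF E(1) \<psi>(5)] by (rule continuous_on_eq) (use \<psi>(4) inv in auto)
    then have "homeomorphism U (\<phi> ` U) \<phi> (the_inv_into U \<phi>)"
      unfolding homeomorphism_def using inv \<psi>(3) by force
    moreover have "openin (top_of_set (points M)) U" using \<psi>(1,2) by (auto simp: openin_open)
    ultimately show ?thesis using inj smooth_on_openin[OF \<psi>(5)] by blast
  qed
  have 2: "smooth_on (model_space M) (\<phi> ` (U \<inter> V)) (\<rho> \<circ> the_inv_into U \<phi>)"
    if U: "(U, \<phi>) \<in> charts M" and V: "(V, \<rho>) \<in> charts M" for U \<phi> V \<rho>
  proof -
    obtain \<psi> Q where \<psi>: "U = points M \<inter> Q" "\<And>x. x \<in> U \<Longrightarrow> \<psi> (\<phi> x) = x"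
      "smooth_on (model_space M) (\<phi> ` U) \<psi>"
      using ch[OF U] unfolding lie_chart_def by blast
    obtain Q' where Q': "V = points M \<inter> Q'" "open Q'"
      using ch[OF V] unfolding lie_chart_def by blast
    have "smooth_on (model_space M) (\<phi> ` (U \<inter> (\<lambda>x. x) -` V)) (\<rho> \<circ> (\<lambda>x. x) \<circ> the_inv_into U \<phi>)"
      by (rule smooth_on_local_representation[OF E(1) \<psi>(2) _ _ Q'])
        (use \<psi> sm[OF V] in auto)
    then show ?thesis by (simp add: o_def)
  qed
  show ?thesis unfolding banach_manifold_def
  proof (intro conjI ballI E un)
    fix c assume "c \<in> charts M"
    with 1 show "case c of (U, \<phi>) \<Rightarrow> openin (top_of_set (points M)) U \<and>
        openin (top_of_set (model_space M)) (\<phi> ` U) \<and> inj_on \<phi> U \<and>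
        homeomorphism U (\<phi> ` U) \<phi> (the_inv_into U \<phi>)" by (cases c) simp
  next
    fix c assume "c \<in> charts M"
    with 2 show "case c of (U, \<phi>) \<Rightarrow> \<forall>(V, \<psi>)\<in>charts M.
        smooth_on (model_space M) (\<phi> ` (U \<inter> V)) (\<psi> \<circ> the_inv_into U \<phi>)" by (cases c) auto
  qed
qed

lemma smooth_mapI:
  fixes M :: "('p::topological_space, 'e::banach) manifold"
    and N :: "('q::real_normed_vector, 'f::banach) manifold"
  assumes E: "subspace (model_space M)" and f: "f ` points M \<subseteq> points N" "continuous_on (points M) f"
    and M: "\<And>U \<phi>. (U, \<phi>) \<in> charts M \<Longrightarrow> U \<subseteq> points M \<and>
      (\<exists>\<psi>. (\<forall>x\<in>U. \<psi> (\<phi> x) = x) \<and> smooth_on (model_space M) (\<phi> ` U) (\<lambda>x. f (\<psi> x)))"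
    and N: "\<And>V \<rho>. (V, \<rho>) \<in> charts N \<Longrightarrow> \<exists>Q. open Q \<and> V = points N \<inter> Q"
      "\<And>V \<rho> W g. (V, \<rho>) \<in> charts N \<Longrightarrow> smooth_on (model_space M) W g \<Longrightarrow> g ` W \<subseteq> V \<Longrightarrow>
        smooth_on (model_space M) W (\<lambda>x. \<rho> (g x))"
  shows "smooth_map M N f"
  unfolding smooth_map_def
proof (intro conjI f ballI)
  have "smooth_on (model_space M) (\<phi> ` (U \<inter> f -` V)) (\<rho> \<circ> f \<circ> the_inv_into U \<phi>)"
    if U: "(U, \<phi>) \<in> charts M" and V: "(V, \<rho>) \<in> charts N" for U \<phi> V \<rho>
  proof -
    obtain \<psi> where \<psi>: "\<And>x. x \<in> U \<Longrightarrow> \<psi> (\<phi> x) = x" "smooth_on (model_space M) (\<phi> ` U) (\<lambda>x. f (\<psi> x))"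
      using M[OF U] by blast
    have fU: "f ` U \<subseteq> points N" using M[OF U] f(1) by blast
    obtain Q where Q: "V = points N \<inter> Q" "open Q" using N(1)[OF V] by blast
    show ?thesis
      by (rule smooth_on_local_representation[OF E \<psi>(1) \<psi>(2) fU Q N(2)[OF V]])
  qed
  then show "case c of (U, \<phi>) \<Rightarrow> \<forall>(V, \<rho>)\<in>charts N.
        smooth_on (model_space M) (\<phi> ` (U \<inter> f -` V)) (\<rho> \<circ> f \<circ> the_inv_into U \<phi>)"
    if "c \<in> charts M" for c using that by (cases c) auto
qed

lemma continuous_on_blinfun_compose [continuous_intros]:
  fixes f g :: "'x::topological_space \<Rightarrow> 'a::real_normed_vector \<Rightarrow>\<^sub>L 'a"
  shows "continuous_on U f \<Longrightarrow> continuous_on U g \<Longrightarrow> continuous_on U (\<lambda>x. f x o\<^sub>L g x)"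
  by (rule bounded_bilinear.continuous_on[OF bounded_bilinear_blinfun_compose])

lemma continuous_on_adj [continuous_intros]:
  "continuous_on U f \<Longrightarrow> continuous_on U (\<lambda>x. adj (f x))"
  by (rule bounded_linear.continuous_on[OF bounded_linear_adj])

lemma continuous_on_op_inv [continuous_intros]:
  fixes f :: "'x::topological_space \<Rightarrow> 'a::banach \<Rightarrow>\<^sub>L 'a"
  assumes "continuous_on U f" "\<And>x. x \<in> U \<Longrightarrow> invertible_op (f x)"
  shows "continuous_on U (\<lambda>x. op_inv (f x))"
proof -
  have "continuous_on {T::'a \<Rightarrow>\<^sub>L 'a. invertible_op T} op_inv"
    by (rule has_derivative_continuous_on[OF has_derivative_at_withinI[OF has_derivative_op_inv]]) simp
  from continuous_on_compose2[OF this assms(1)] show ?thesis using assms(2) by blast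
qed

text \<open>The quotients in \<open>op_exp_difference_quotient\<close> are multiples of
  \<open>s - id_blinfun\<close>, so they stay in \<open>L\<close>, and closedness keeps their limit
  there.\<close>

lemma closed_subspace_lie_algebra_subset:
  assumes S: "\<And>s. s \<in> S \<Longrightarrow> s - id_blinfun \<in> L" and L: "closed L" "subspace L"
  shows "lie_algebra S \<subseteq> L"
proof
  fix X :: "'a \<Rightarrow>\<^sub>L 'a" assume "X \<in> lie_algebra S"
  then have "op_exp (t *\<^sub>R X) \<in> S" for t by (simp add: lie_algebra_def)
  then have "real (Suc n) *\<^sub>R (op_exp ((1 / real (Suc n)) *\<^sub>R X) - id_blinfun) \<in> L" for n
    using S L subspace_scale by blast
  then show "X \<in> L"
    using closed_sequentially[OF L(1) _ op_exp_difference_quotient] by blast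
qed

lemma smooth_on_fst_snd:
  assumes "subspace E" "subspace F" "openin (top_of_set (E \<times> F)) W"
  shows "smooth_on (E \<times> F) W fst" "smooth_on (E \<times> F) W snd"
  using assms by (auto intro!: smooth_on_bounded_linear bounded_linear_fst bounded_linear_snd subspace_Times)

section \<open>The unitary group and the Cayley transform\<close>

lemma K_group_iff: "k \<in> K_group \<longleftrightarrow> k \<in> bounded_operators \<and> adj k o\<^sub>L k = id_blinfun \<and> k o\<^sub>L adj k = id_blinfun"
proof
  assume k: "k \<in> K_group"
  then have k': "k \<in> bounded_operators" "invertible_op k" "adj k o\<^sub>L k = id_blinfun"
    by (auto simp: K_group_def carrier_GL cadjoint_eq_adj)
  have "adj k = adj k o\<^sub>L (k o\<^sub>L op_inv k)" by (simp add: op_inv k')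
  also have "\<dots> = op_inv k" by (simp add: blinfun_compose_assoc[symmetric] k')
  finally show "k \<in> bounded_operators \<and> adj k o\<^sub>L k = id_blinfun \<and> k o\<^sub>L adj k = id_blinfun"
    using k' op_inv by metis
next
  assume k: "k \<in> bounded_operators \<and> adj k o\<^sub>L k = id_blinfun \<and> k o\<^sub>L adj k = id_blinfun"
  then show "k \<in> K_group"
    using op_inv_eqI[of "adj k" k] by (auto simp: K_group_def carrier_GL cadjoint_eq_adj)
qed

lemma K_groupD:
  assumes "k \<in> K_group"
  shows "k \<in> bounded_operators" "invertible_op k" "op_inv k = adj k"
    "adj k o\<^sub>L k = id_blinfun" "k o\<^sub>L adj k = id_blinfun"
  using assms op_inv_eqI[of "adj k" k] by (auto simp: K_group_iff)

lemma K_group_compose: "k \<in> K_group \<Longrightarrow> l \<in> K_group \<Longrightarrow> (k o\<^sub>L l) \<in> K_group"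
  by (auto simp: K_group_iff adj_compose blinfun_compose_assoc)
    (metis blinfun_compose_assoc blinfun_compose_id(2))+

lemma K_group_adj: "k \<in> K_group \<Longrightarrow> adj k \<in> K_group"
  by (simp add: K_group_iff)

lemma K_group_id: "id_blinfun \<in> K_group"
  by (simp add: K_group_iff)

lemma subgroup_K: "subgroup K_group GL"
  by (rule subgroup_GL_I) (auto simp: K_groupD carrier_GL K_group_id K_group_compose K_group_adj)

lemma k_algebra_iff: "X \<in> k_algebra \<longleftrightarrow> X \<in> bounded_operators \<and> adj X = - X"
  by (auto simp: k_algebra_def cadjoint_eq_adj)

lemma closed_real_lie_subalgebra_k: "closed_real_lie_subalgebra (k_algebra :: ('a::complex_hilbert \<Rightarrow>\<^sub>L 'a) set)"
proof -
  have k: "(k_algebra :: ('a \<Rightarrow>\<^sub>L 'a) set) = bounded_operators \<inter> {X. adj X = - X}"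
    using k_algebra_iff by blast
  have "closed (k_algebra :: ('a \<Rightarrow>\<^sub>L 'a) set)"
    unfolding k by (intro closed_Int closed_bounded_operators closed_Collect_eq continuous_intros)
  moreover have "subspace (k_algebra :: ('a \<Rightarrow>\<^sub>L 'a) set)"
    unfolding k by (intro subspace_inter subspace_bounded_operators) (auto simp: subspace_def adj_add adj_scaleR)
  moreover have "(X o\<^sub>L Y) - (Y o\<^sub>L X) \<in> k_algebra" if "X \<in> k_algebra" "Y \<in> k_algebra" for X Y :: "'a \<Rightarrow>\<^sub>L 'a"
    using that
    by (auto simp: k_algebra_iff adj_diff adj_compose compose_distribs intro!: subspace_diff[OF subspace_bounded_operators])
  ultimately show ?thesis unfolding closed_real_lie_subalgebra_def by (auto simp: k_algebra_iff)
qed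

lemma subspace_k: "subspace k_algebra" and closed_k: "closed k_algebra"
  using closed_real_lie_subalgebra_k by (auto simp: closed_real_lie_subalgebra_def)

lemma lie_algebra_K: "lie_algebra K_group = k_algebra"
proof (intro equalityI subsetI)
  fix X :: "'a \<Rightarrow>\<^sub>L 'a" assume X: "X \<in> lie_algebra K_group"
  then have K: "op_exp (t *\<^sub>R X) \<in> K_group" for t by (simp add: lie_algebra_def)
  \<comment> \<open>Adjoint and inverse agree on \<open>K_group\<close>, so \<open>adj X\<close> and
    \<open>- X\<close> generate the same one-parameter group and are equal as limits of the same
    quotients.\<close>
  have "op_exp (t *\<^sub>R adj X) = op_exp (t *\<^sub>R (- X))" for t
    using K_groupD(3)[OF K[of t]] by (simp add: adj_op_exp adj_scaleR invertible_op_exp)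
  then have "(\<lambda>n. real (Suc n) *\<^sub>R (op_exp ((1 / real (Suc n)) *\<^sub>R adj X) - id_blinfun)) \<longlonglongrightarrow> - X"
    using op_exp_difference_quotient[of "- X"] by presburger
  then have "adj X = - X" using op_exp_difference_quotient[of "adj X"] LIMSEQ_unique by blast
  then show "X \<in> k_algebra" using X by (simp add: k_algebra_iff lie_algebra_def)
next
  fix X :: "'a \<Rightarrow>\<^sub>L 'a" assume X: "X \<in> k_algebra"
  then have b: "t *\<^sub>R X \<in> bounded_operators" for t
    by (simp add: k_algebra_iff subspace_scale[OF subspace_bounded_operators])
  have "adj (op_exp (t *\<^sub>R X)) = op_exp (- (t *\<^sub>R X))" for t
    using X by (simp add: adj_op_exp adj_scaleR k_algebra_iff)
  then have "op_exp (t *\<^sub>R X) \<in> K_group" for t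
    using op_exp_minus[of "t *\<^sub>R X"] op_exp_minus[of "- (t *\<^sub>R X)"]
    by (simp add: K_group_iff op_exp_bounded_operators[OF b])
  then show "X \<in> lie_algebra K_group" using X by (simp add: lie_algebra_def k_algebra_iff)
qed

text \<open>The Cayley transform, centred at each \<open>k \<in> K\<close>, gives charts of the unitary group whose
  transition maps are rational in operators, and which map onto all of \<open>k_algebra\<close>.\<close>

definition cay :: "('a::complex_hilbert \<Rightarrow>\<^sub>L 'a) \<Rightarrow> ('a \<Rightarrow>\<^sub>L 'a)"
  where "cay T = 2 *\<^sub>R op_inv (id_blinfun + T) - id_blinfun"

text \<open>\<open>cay T\<close> is the quotient of \<open>1 - T\<close> by \<open>1 + T\<close>. In
  the form that \<open>1 + cay T\<close> is twice the inverse of \<open>1 + T\<close> it is visibly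
  an involution, so one formula serves for the chart and for its inverse.\<close>

lemma cay_cay:
  assumes "invertible_op (id_blinfun + T)"
  shows "invertible_op (id_blinfun + cay T)" "cay (cay T) = T"
proof -
  have e: "id_blinfun + cay T = 2 *\<^sub>R op_inv (id_blinfun + T)" by (simp add: cay_def)
  note i = invertible_op_inv[OF assms]
  show "invertible_op (id_blinfun + cay T)" unfolding e by (rule invertible_op_scaleR[OF i(1)]) simp
  have "op_inv (id_blinfun + cay T) = (1 / 2) *\<^sub>R (id_blinfun + T)"
    unfolding e using invertible_op_scaleR(2)[OF i(1), of 2] i(2) by simp
  then show "cay (cay T) = T" by (simp add: cay_def[of "cay T"])
qed

text \<open>For unitary \<open>v\<close> and \<open>R\<close> the inverse of \<open>1 + v\<close>,
  the inverse of \<open>1 + adj v\<close> is \<open>1 - R\<close>. Passing to the adjoint therefore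
  changes the sign of \<open>2 R - 1\<close>.\<close>

lemma cay_K_group:
  assumes v: "v \<in> K_group" and i: "invertible_op (id_blinfun + v)"
  shows "cay v \<in> k_algebra"
proof -
  define R where "R = op_inv (id_blinfun + v)"
  have R: "R + (R o\<^sub>L v) = id_blinfun" "R + (v o\<^sub>L R) = id_blinfun"
    using op_inv[OF i] by (simp_all add: R_def compose_distribs)
  have v': "adj v o\<^sub>L v = id_blinfun" "v o\<^sub>L adj v = id_blinfun" using K_groupD v by auto
  have "(R + (R o\<^sub>L v)) o\<^sub>L adj v = adj v" "adj v o\<^sub>L (R + (v o\<^sub>L R)) = adj v"
    by (simp_all only: R blinfun_compose_id)
  then have Rv: "(R o\<^sub>L adj v) + R = adj v" "(adj v o\<^sub>L R) + R = adj v"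
    by (simp_all add: compose_distribs blinfun_compose_assoc v')
      (simp add: blinfun_compose_assoc[symmetric] v')
  have "op_inv (id_blinfun + adj v) = id_blinfun - R"
  proof (rule op_inv_eqI)
    have "(id_blinfun - R) o\<^sub>L (id_blinfun + adj v) = id_blinfun + adj v - ((R o\<^sub>L adj v) + R)"
      by (simp add: compose_distribs)
    then show "(id_blinfun - R) o\<^sub>L (id_blinfun + adj v) = id_blinfun" using Rv by simp
    have "(id_blinfun + adj v) o\<^sub>L (id_blinfun - R) = id_blinfun + adj v - ((adj v o\<^sub>L R) + R)"
      by (simp add: compose_distribs)
    then show "(id_blinfun + adj v) o\<^sub>L (id_blinfun - R) = id_blinfun" using Rv by simp
  qed
  moreover have "adj (cay v) = 2 *\<^sub>R op_inv (id_blinfun + adj v) - id_blinfun"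
    using invertible_op_adj(2)[OF i] by (simp add: cay_def adj_diff adj_scaleR adj_add)
  ultimately have "adj (cay v) = - cay v"
    by (simp add: cay_def R_def[symmetric] scaleR_diff_right) (simp add: scaleR_2)
  moreover have "cay v \<in> bounded_operators"
    unfolding cay_def
    using K_groupD(1)[OF v] i
    by (intro subspace_diff subspace_scale subspace_bounded_operators op_inv_bounded_operators subspace_add
        id_bounded_operators)
  ultimately show ?thesis by (simp add: k_algebra_iff)
qed

text \<open>A skew-adjoint operator satisfies \<open>X x \<bullet> x = 0\<close>, so
  \<open>1 + X\<close> is coercive with constant 1. This is why the inverse Cayley chart is defined
  on all of \<open>k_algebra\<close>.\<close>

lemma invertible_id_plus_skew:
  assumes X: "X \<in> k_algebra"
  shows "invertible_op (id_blinfun + X)"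
proof (rule invertible_op_coercive[of 1])
  fix x
  have "blinfun_apply X x \<bullet> x = - (blinfun_apply X x \<bullet> x)"
    using inner_adj[of X x x] X by (simp add: k_algebra_iff blinfun.bilinear_simps inner_commute)
  then show "1 * (norm x)\<^sup>2 \<le> blinfun_apply (id_blinfun + X) x \<bullet> x"
    by (simp add: blinfun.bilinear_simps inner_add_left power2_norm_eq_inner)
qed simp

lemma cay_k_algebra:
  assumes X: "X \<in> k_algebra"
  shows "cay X \<in> K_group"
proof -
  define R where "R = op_inv (id_blinfun + X)"
  note i = invertible_id_plus_skew[OF X]
  have X': "X \<in> bounded_operators" "adj X = - X" using X by (auto simp: k_algebra_iff)
  have R: "(id_blinfun + X) o\<^sub>L R = id_blinfun" "R o\<^sub>L (id_blinfun + X) = id_blinfun"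
    using op_inv[OF i] by (simp_all add: R_def)
  then have "adj ((id_blinfun + X) o\<^sub>L R) = id_blinfun" "adj (R o\<^sub>L (id_blinfun + X)) = id_blinfun"
    by simp_all
  then have R': "adj R o\<^sub>L (id_blinfun - X) = id_blinfun" "(id_blinfun - X) o\<^sub>L adj R = id_blinfun"
    by (simp_all add: adj_compose adj_add X')
  \<comment> \<open>Inserting the identities \<open>adj R (1 - X)\<close> and
    \<open>(1 + X) R\<close> makes the terms in \<open>X\<close> cancel. For
    \<open>cay X = 2 R - 1\<close>, the relation \<open>R + adj R = 2 (adj R) R\<close> is unitarity
    from one side; its counterpart below gives the other side.\<close>
  have "R + adj R = ((adj R o\<^sub>L (id_blinfun - X)) o\<^sub>L R) + (adj R o\<^sub>L ((id_blinfun + X) o\<^sub>L R))"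
    by (simp add: R R' blinfun_compose_assoc)
  also have "\<dots> = 2 *\<^sub>R (adj R o\<^sub>L R)"
    by (simp add: compose_distribs blinfun_compose_assoc scaleR_2)
  finally have s1: "R + adj R = 2 *\<^sub>R (adj R o\<^sub>L R)" .
  have "R + adj R = (R o\<^sub>L ((id_blinfun - X) o\<^sub>L adj R)) + ((R o\<^sub>L (id_blinfun + X)) o\<^sub>L adj R)"
    by (simp add: R R' blinfun_compose_assoc)
  also have "\<dots> = 2 *\<^sub>R (R o\<^sub>L adj R)"
    by (simp add: compose_distribs blinfun_compose_assoc scaleR_2)
  finally have s2: "R + adj R = 2 *\<^sub>R (R o\<^sub>L adj R)" .
  have c: "cay X = 2 *\<^sub>R R - id_blinfun" by (simp add: cay_def R_def)
  have "adj (cay X) o\<^sub>L cay X = 2 *\<^sub>R (2 *\<^sub>R (adj R o\<^sub>L R)) - 2 *\<^sub>R (R + adj R) + id_blinfun"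
    unfolding c by (simp add: adj_diff adj_scaleR compose_distribs scaleR_add_right scaleR_diff_right)
  moreover have "cay X o\<^sub>L adj (cay X) = 2 *\<^sub>R (2 *\<^sub>R (R o\<^sub>L adj R)) - 2 *\<^sub>R (R + adj R) + id_blinfun"
    unfolding c by (simp add: adj_diff adj_scaleR compose_distribs scaleR_add_right scaleR_diff_right)
  moreover have "cay X \<in> bounded_operators"
    unfolding cay_def
    using X' i
    by (intro subspace_diff subspace_scale subspace_bounded_operators op_inv_bounded_operators subspace_add
        id_bounded_operators)
  ultimately show ?thesis unfolding K_group_iff s1[symmetric] s2[symmetric] by simp
qed

lemma smooth_on_cay:
  assumes "subspace E" "smooth_on E W g" "\<And>x. x \<in> W \<Longrightarrow> invertible_op (id_blinfun + g x)"
  shows "smooth_on E W (\<lambda>x. cay (g x))"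
  unfolding cay_def
  using assms
  by (intro smooth_on_diff smooth_on_linear_image[OF bounded_linear_scaleR_right] smooth_on_op_inv
      smooth_on_add smooth_on_const smooth_on_openin) auto

text \<open>The Cayley transform of \<open>adj k o\<^sub>L u\<close> exists when \<open>- 1\<close>
  is not in its spectrum. These sets are relatively open, and each unitary \<open>k\<close> lies in
  its own, since there the sum is twice the identity.\<close>

definition K_domain :: "('a::complex_hilbert \<Rightarrow>\<^sub>L 'a) \<Rightarrow> ('a \<Rightarrow>\<^sub>L 'a) set"
  where "K_domain k = {u \<in> K_group. invertible_op (id_blinfun + (adj k o\<^sub>L u))}"

definition K_manifold :: "('a::complex_hilbert \<Rightarrow>\<^sub>L 'a, 'a \<Rightarrow>\<^sub>L 'a) manifold"
  where "K_manifold = \<lparr>points = K_group, model_space = k_algebra,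
    charts = {(K_domain k, \<lambda>u. cay (adj k o\<^sub>L u)) |k. k \<in> K_group}\<rparr>"

lemma K_chart_inverse:
  assumes "k \<in> K_group" "u \<in> K_domain k"
  shows "k o\<^sub>L cay (cay (adj k o\<^sub>L u)) = u"
  using assms by (simp add: K_domain_def cay_cay blinfun_compose_assoc[symmetric] K_groupD)

lemma K_chart_image:
  assumes k: "k \<in> K_group"
  shows "(\<lambda>u. cay (adj k o\<^sub>L u)) ` K_domain k = k_algebra"
proof (intro equalityI subsetI)
  fix X assume "X \<in> (\<lambda>u. cay (adj k o\<^sub>L u)) ` K_domain k"
  then show "X \<in> k_algebra"
    using k by (auto simp: K_domain_def intro!: cay_K_group K_group_compose K_group_adj)
next
  fix X :: "'a \<Rightarrow>\<^sub>L 'a" assume X: "X \<in> k_algebra"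
  note c = cay_cay[OF invertible_id_plus_skew[OF X]]
  have a: "adj k o\<^sub>L (k o\<^sub>L cay X) = cay X" using k by (simp add: blinfun_compose_assoc[symmetric] K_groupD)
  have "k o\<^sub>L cay X \<in> K_domain k"
    using k c by (simp add: K_domain_def K_group_compose cay_k_algebra[OF X] a)
  then show "X \<in> (\<lambda>u. cay (adj k o\<^sub>L u)) ` K_domain k" using c a by force
qed

lemma smooth_on_K_chart:
  assumes "subspace E" "smooth_on E W g" "g ` W \<subseteq> K_domain k"
  shows "smooth_on E W (\<lambda>x. cay (adj k o\<^sub>L g x))"
  using assms
  by (intro smooth_on_cay smooth_on_compose smooth_on_const smooth_on_openin) (auto simp: K_domain_def)

lemma smooth_on_K_chart_inverse:
  fixes k :: "'a::complex_hilbert \<Rightarrow>\<^sub>L 'a"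
  assumes "subspace E" "smooth_on E W g" "g ` W \<subseteq> k_algebra"
  shows "smooth_on E W (\<lambda>x. k o\<^sub>L cay (g x))"
  using assms
  by (intro smooth_on_compose smooth_on_const smooth_on_cay smooth_on_openin[OF assms(2)])
    (auto intro: invertible_id_plus_skew)

lemma K_domain_open: "\<exists>Q. open Q \<and> K_domain k = K_group \<inter> Q"
proof (intro exI conjI)
  have "open ((\<lambda>u. id_blinfun + (adj k o\<^sub>L u)) -` {T. invertible_op T})"
    by (intro open_vimage open_invertible_op continuous_intros)
  then show "open {u. invertible_op (id_blinfun + (adj k o\<^sub>L u))}" by (simp add: vimage_def)
qed (auto simp: K_domain_def)

lemma smooth_on_identity: "subspace E \<Longrightarrow> openin (top_of_set E) U \<Longrightarrow> smooth_on E U (\<lambda>x. x)"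
  by (rule smooth_on_bounded_linear) (auto intro: bounded_linear_ident)

lemma banach_manifold_K: "banach_manifold (K_manifold :: ('a::complex_hilbert \<Rightarrow>\<^sub>L 'a, 'a \<Rightarrow>\<^sub>L 'a) manifold)"
proof (rule banach_manifoldI)
  have "u \<in> K_domain u" if "u \<in> K_group" for u :: "'a \<Rightarrow>\<^sub>L 'a"
  proof -
    have "id_blinfun + (adj u o\<^sub>L u) = 2 *\<^sub>R id_blinfun" using that by (simp add: K_groupD scaleR_2)
    moreover have "invertible_op (2 *\<^sub>R (id_blinfun :: 'a \<Rightarrow>\<^sub>L 'a))" by (rule invertible_op_scaleR) auto
    ultimately show ?thesis using that by (simp add: K_domain_def)
  qed
  then show "(\<Union>(U, \<phi>)\<in>charts (K_manifold :: ('a \<Rightarrow>\<^sub>L 'a, 'a \<Rightarrow>\<^sub>L 'a) manifold). U) = points K_manifold"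
    by (auto simp: K_manifold_def K_domain_def)
next
  fix U :: "('a \<Rightarrow>\<^sub>L 'a) set" and \<phi> assume "(U, \<phi>) \<in> charts K_manifold"
  then obtain k where k: "k \<in> K_group" "U = K_domain k" "\<phi> = (\<lambda>u. cay (adj k o\<^sub>L u))"
    by (auto simp: K_manifold_def)
  have "continuous_on U \<phi>"
    unfolding k(2,3) cay_def by (intro continuous_intros) (auto simp: K_domain_def)
  moreover have "smooth_on k_algebra (\<phi> ` U) (\<lambda>X. k o\<^sub>L cay X)"
    unfolding k(2,3) K_chart_image[OF k(1)]
    by (intro smooth_on_K_chart_inverse smooth_on_identity subspace_k) auto
  ultimately show "\<exists>\<psi>. lie_chart (points K_manifold) (model_space K_manifold) U \<phi> \<psi>"
    unfolding lie_chart_def using k K_chart_inverse K_domain_open[of k]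
    by (intro exI[of _ "\<lambda>X. k o\<^sub>L cay X"]) (auto simp: K_manifold_def)
next
  fix U \<phi> W and g :: "('a \<Rightarrow>\<^sub>L 'a) \<Rightarrow> ('a \<Rightarrow>\<^sub>L 'a)" 
  assume "(U, \<phi>) \<in> charts K_manifold" "smooth_on (model_space K_manifold) W g" "g ` W \<subseteq> U"
  then show "smooth_on (model_space K_manifold) W (\<lambda>x. \<phi> (g x))"
    using smooth_on_K_chart[OF subspace_k] by (auto simp: K_manifold_def)
qed (simp_all add: K_manifold_def subspace_k closed_k)

lemma charts_prod_manifold:
  "(U, \<phi>) \<in> charts (prod_manifold M N) \<longleftrightarrow>
    (\<exists>U1 \<phi>1 U2 \<phi>2. (U1, \<phi>1) \<in> charts M \<and> (U2, \<phi>2) \<in> charts N \<and> U = U1 \<times> U2 \<and> \<phi> = map_prod \<phi>1 \<phi>2)"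
  by (auto simp: prod_manifold_def)

lemma points_prod_manifold [simp]: "points (prod_manifold M N) = points M \<times> points N"
  and model_space_prod_manifold [simp]: "model_space (prod_manifold M N) = model_space M \<times> model_space N"
  by (simp_all add: prod_manifold_def)

lemma map_prod_image_Times: "map_prod f g ` (A \<times> B) = f ` A \<times> g ` B"
  by force

lemma lie_group_structureI:
  fixes M :: "('a::complex_hilbert \<Rightarrow>\<^sub>L 'a, 'a \<Rightarrow>\<^sub>L 'a) manifold"
  assumes "subgroup S GL" "closed_real_lie_subalgebra L" "lie_algebra S = L"
    and M: "points M = S" "model_space M = L" "banach_manifold M"
    and mult: "smooth_map (prod_manifold M M) M (\<lambda>(x, y). x o\<^sub>L y)"
    and inv: "smooth_map M M (m_inv (GL\<lparr>carrier := S\<rparr>))"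
  shows "lie_group_structure S L M"
  using assms subgroup.subgroup_is_group[OF assms(1) group_GL]
  by (simp add: lie_group_structure_def banach_lie_group_def)

lemma smooth_mult_K:
  "smooth_map (prod_manifold K_manifold K_manifold) (K_manifold :: ('a::complex_hilbert \<Rightarrow>\<^sub>L 'a, 'a \<Rightarrow>\<^sub>L 'a) manifold)
    (\<lambda>(x, y). x o\<^sub>L y)"
proof (rule smooth_mapI)
  let ?KK = "prod_manifold (K_manifold :: ('a \<Rightarrow>\<^sub>L 'a, 'a \<Rightarrow>\<^sub>L 'a) manifold) (K_manifold :: ('a \<Rightarrow>\<^sub>L 'a, 'a \<Rightarrow>\<^sub>L 'a) manifold)"
  have ms: "model_space ?KK = k_algebra \<times> k_algebra" by (simp add: K_manifold_def)
  show sub: "subspace (model_space ?KK)" unfolding ms by (intro subspace_Times subspace_k)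
  show "(\<lambda>(x, y). x o\<^sub>L y) ` points ?KK \<subseteq> points K_manifold"
    by (auto simp: K_manifold_def K_group_compose)
  show "continuous_on (points ?KK) (\<lambda>(x, y). x o\<^sub>L y)"
    by (simp add: case_prod_unfold continuous_intros)
  show "\<exists>Q. open Q \<and> V = points K_manifold \<inter> Q" if "(V, \<rho>) \<in> charts K_manifold"
    for V :: "('a \<Rightarrow>\<^sub>L 'a) set" and \<rho>
    using that K_domain_open by (auto simp: K_manifold_def)
  show "smooth_on (model_space ?KK) W (\<lambda>x. \<rho> (g x))"
    if "(V, \<rho>) \<in> charts K_manifold" "smooth_on (model_space ?KK) W g" "g ` W \<subseteq> V" for V \<rho> W g
    using that smooth_on_K_chart[OF sub] by (auto simp: K_manifold_def)
  fix U \<phi> assume "(U, \<phi>) \<in> charts ?KK"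
  then obtain k l where kl: "k \<in> K_group" "l \<in> K_group" "U = K_domain k \<times> K_domain l"
    "\<phi> = map_prod (\<lambda>u. cay (adj k o\<^sub>L u)) (\<lambda>u. cay (adj l o\<^sub>L u))"
    by (auto simp: charts_prod_manifold) (auto simp: K_manifold_def)
  have im: "\<phi> ` U = k_algebra \<times> k_algebra"
    by (simp add: kl map_prod_image_Times K_chart_image)
  have "smooth_on (k_algebra \<times> k_algebra) (k_algebra \<times> k_algebra)
      (\<lambda>x. (k o\<^sub>L cay (fst x)) o\<^sub>L (l o\<^sub>L cay (snd x)) :: 'a \<Rightarrow>\<^sub>L 'a)"
    by (intro smooth_on_compose smooth_on_K_chart_inverse smooth_on_fst_snd subspace_Times subspace_k) auto
  then have "smooth_on (model_space ?KK) (\<phi> ` U) (\<lambda>x. case map_prod (\<lambda>X. k o\<^sub>L cay X) (\<lambda>X. l o\<^sub>L cay X) x of (x, y) \<Rightarrow> x o\<^sub>L y)"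
    unfolding im ms by (simp add: case_prod_unfold)
  then show "U \<subseteq> points ?KK \<and> (\<exists>\<psi>. (\<forall>x\<in>U. \<psi> (\<phi> x) = x) \<and>
      smooth_on (model_space ?KK) (\<phi> ` U) (\<lambda>x. case \<psi> x of (x, y) \<Rightarrow> x o\<^sub>L y))"
    using kl K_chart_inverse
    by (intro conjI exI[of _ "map_prod (\<lambda>X. k o\<^sub>L cay X) (\<lambda>X. l o\<^sub>L cay X)"])
      (auto simp: K_domain_def, auto simp: K_manifold_def)
qed

lemma smooth_inv_K:
  "smooth_map K_manifold (K_manifold :: ('a::complex_hilbert \<Rightarrow>\<^sub>L 'a, 'a \<Rightarrow>\<^sub>L 'a) manifold)
    (m_inv (GL\<lparr>carrier := K_group\<rparr>))"
proof (rule smooth_mapI)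
  have inv: "inv\<^bsub>GL\<lparr>carrier := K_group\<rparr>\<^esub> u = adj u" if "u \<in> K_group" for u :: "'a \<Rightarrow>\<^sub>L 'a"
    using inv_GL_subgroup[OF subgroup_K that] K_groupD[OF that] by simp
  have ms: "model_space K_manifold = k_algebra" by (simp add: K_manifold_def)
  show "subspace (model_space K_manifold)" by (simp add: ms subspace_k)
  show "m_inv (GL\<lparr>carrier := K_group\<rparr>) ` points K_manifold \<subseteq> points (K_manifold :: ('a \<Rightarrow>\<^sub>L 'a, 'a \<Rightarrow>\<^sub>L 'a) manifold)"
  proof (rule image_subsetI)
    fix u :: "'a \<Rightarrow>\<^sub>L 'a" assume "u \<in> points K_manifold"
    then have "u \<in> K_group" by (simp add: K_manifold_def)
    then show "inv\<^bsub>GL\<lparr>carrier := K_group\<rparr>\<^esub> u \<in> points K_manifold"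
      using inv[of u] K_group_adj[of u] by (simp add: K_manifold_def)
  qed
  show "continuous_on (points (K_manifold :: ('a \<Rightarrow>\<^sub>L 'a, 'a \<Rightarrow>\<^sub>L 'a) manifold)) (\<lambda>u. inv\<^bsub>GL\<lparr>carrier := K_group\<rparr>\<^esub> u)"
  proof (rule continuous_on_eq[OF continuous_on_adj[OF continuous_on_id]])
    fix u :: "'a \<Rightarrow>\<^sub>L 'a" assume "u \<in> points K_manifold"
    then have "u \<in> K_group" by (simp add: K_manifold_def)
    from inv[OF this] show "adj u = inv\<^bsub>GL\<lparr>carrier := K_group\<rparr>\<^esub> u" by (rule sym)
  qed
  show "\<exists>Q. open Q \<and> V = points K_manifold \<inter> Q" if "(V, \<rho>) \<in> charts K_manifold"
    for V :: "('a \<Rightarrow>\<^sub>L 'a) set" and \<rho>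
    using that K_domain_open by (auto simp: K_manifold_def)
  show "smooth_on (model_space K_manifold) W (\<lambda>x. \<rho> (g x))"
    if "(V, \<rho>) \<in> charts K_manifold" "smooth_on (model_space K_manifold) W g" "g ` W \<subseteq> V"
    for V \<rho> W and g :: "('a \<Rightarrow>\<^sub>L 'a) \<Rightarrow> ('a \<Rightarrow>\<^sub>L 'a)"
    using that smooth_on_K_chart[OF subspace_k] by (auto simp: K_manifold_def)
  fix U :: "('a \<Rightarrow>\<^sub>L 'a) set" and \<phi> assume "(U, \<phi>) \<in> charts K_manifold"
  then obtain k where k: "k \<in> K_group" "U = K_domain k" "\<phi> = (\<lambda>u. cay (adj k o\<^sub>L u))"
    by (auto simp: K_manifold_def)
  have im: "\<phi> ` U = k_algebra" by (simp add: k K_chart_image)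
  have "smooth_on k_algebra k_algebra (\<lambda>X. adj (k o\<^sub>L cay X))"
    by (intro smooth_on_linear_image[OF bounded_linear_adj] smooth_on_K_chart_inverse smooth_on_identity subspace_k) auto
  then have "smooth_on (model_space K_manifold) (\<phi> ` U) (\<lambda>X. inv\<^bsub>GL\<lparr>carrier := K_group\<rparr>\<^esub> (k o\<^sub>L cay X))"
    unfolding im ms by (rule smooth_on_cong) (rule inv[OF K_group_compose[OF k(1) cay_k_algebra]])
  then show "U \<subseteq> points K_manifold \<and> (\<exists>\<psi>. (\<forall>x\<in>U. \<psi> (\<phi> x) = x) \<and>
      smooth_on (model_space K_manifold) (\<phi> ` U) (\<lambda>x. inv\<^bsub>GL\<lparr>carrier := K_group\<rparr>\<^esub> (\<psi> x)))"
    using k K_chart_inverse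
    by (intro conjI exI[of _ "\<lambda>X. k o\<^sub>L cay X"]) (auto simp: K_domain_def K_manifold_def)
qed

lemma lie_group_structure_K: "lie_group_structure K_group k_algebra K_manifold"
  by (rule lie_group_structureI[OF subgroup_K closed_real_lie_subalgebra_k lie_algebra_K _ _
        banach_manifold_K smooth_mult_K smooth_inv_K]) (simp_all add: K_manifold_def)

section \<open>Groups with a single affine chart\<close>

text \<open>Translation by \<open>p\<close> carries the group into its linear model space:
  \<open>p = 0\<close> for the diagonal group and for \<open>GL\<close>,
  \<open>p = id_blinfun\<close> for the unitriangular group.\<close>

definition affine_manifold :: "'e::banach \<Rightarrow> 'e set \<Rightarrow> 'e set \<Rightarrow> ('e, 'e) manifold"
  where "affine_manifold p E S = \<lparr>points = S, model_space = E, charts = {(S, \<lambda>x. x - p)}\<rparr>"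

lemma affine_manifold_0: "affine_manifold 0 E S = open_submanifold E S"
  by (simp add: affine_manifold_def open_submanifold_def)

lemma affine_manifold_simps [simp]:
  "points (affine_manifold p E S) = S" "model_space (affine_manifold p E S) = E"
  "charts (affine_manifold p E S) = {(S, \<lambda>x. x - p)}"
  by (simp_all add: affine_manifold_def)

lemma smooth_on_translate:
  assumes "subspace E" "smooth_on E W g"
  shows "smooth_on E W (\<lambda>x. g x - p)" "smooth_on E W (\<lambda>x. g x + p)"
  by (intro smooth_on_diff smooth_on_add smooth_on_const smooth_on_openin[OF assms(2)] assms)+

lemma banach_manifold_affine:
  assumes E: "subspace E" "closed E" and S: "openin (top_of_set E) ((\<lambda>x. x - p) ` S)"
  shows "banach_manifold (affine_manifold p E S)"
proof (rule banach_manifoldI)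
  fix U \<phi> assume U: "(U, \<phi>) \<in> charts (affine_manifold p E S)"
  have "lie_chart S E S (\<lambda>x. x - p) (\<lambda>x. x + p)"
    unfolding lie_chart_def
    using S by (auto intro!: continuous_intros smooth_on_translate smooth_on_identity E exI[of _ UNIV])
  then show "\<exists>\<psi>. lie_chart (points (affine_manifold p E S)) (model_space (affine_manifold p E S)) U \<phi> \<psi>"
    using U by auto
qed (auto simp: E intro: smooth_on_translate)

lemma smooth_map_affine_target:
  assumes E: "subspace (model_space M)" and f: "f ` points M \<subseteq> S" "continuous_on (points M) f"
    and M: "\<And>U \<phi>. (U, \<phi>) \<in> charts M \<Longrightarrow> U \<subseteq> points M \<and>
      (\<exists>\<psi>. (\<forall>x\<in>U. \<psi> (\<phi> x) = x) \<and> smooth_on (model_space M) (\<phi> ` U) (\<lambda>x. f (\<psi> x)))"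
  shows "smooth_map M (affine_manifold p L S) f"
  using assms by (intro smooth_mapI) (auto intro: smooth_on_translate exI[of _ UNIV])

text \<open>In the only chart, multiplication and inversion are \<open>(x + p) (y + p)\<close> and
  \<open>op_inv (x + p)\<close> up to translation, and these are smooth operator
  expressions.\<close>

lemma lie_group_structure_affine:
  fixes S :: "('a::complex_hilbert \<Rightarrow>\<^sub>L 'a) set"
  assumes S: "subgroup S GL" and L: "closed_real_lie_subalgebra L" "lie_algebra S = L"
    and op: "openin (top_of_set L) ((\<lambda>x. x - p) ` S)"
  shows "lie_group_structure S L (affine_manifold p L S)"
proof (rule lie_group_structureI[OF S L])
  have sub: "subspace L" "closed L" using L by (auto simp: closed_real_lie_subalgebra_def)
  show "banach_manifold (affine_manifold p L S)"
    by (rule banach_manifold_affine[OF sub op])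
  have closedS: "s o\<^sub>L t \<in> S" if "s \<in> S" "t \<in> S" for s t
    using subgroup.m_closed[OF S that] by simp
  have inv: "inv\<^bsub>GL\<lparr>carrier := S\<rparr>\<^esub> s = op_inv s" "invertible_op s" "op_inv s \<in> S" if "s \<in> S" for s
    using inv_GL_subgroup[OF S that] subgroup.mem_carrier[OF S that] subgroup.m_inv_closed[OF S that] inv_GL[of s]
    by (auto simp: carrier_GL)
  define D where "D = (\<lambda>x. x - p) ` S"
  have D: "x + p \<in> S" if "x \<in> D" for x using that by (auto simp: D_def)
  show "smooth_map (prod_manifold (affine_manifold p L S) (affine_manifold p L S)) (affine_manifold p L S)
      (\<lambda>(x, y). x o\<^sub>L y)"
  proof (rule smooth_map_affine_target)
    fix U \<phi> assume "(U, \<phi>) \<in> charts (prod_manifold (affine_manifold p L S) (affine_manifold p L S))"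
    then have U: "U = S \<times> S" "\<phi> = map_prod (\<lambda>x. x - p) (\<lambda>x. x - p)" by (auto simp: charts_prod_manifold)
    have im: "\<phi> ` U = D \<times> D" by (simp add: U map_prod_image_Times D_def)
    have "smooth_on (L \<times> L) (D \<times> D) (\<lambda>x. (fst x + p) o\<^sub>L (snd x + p))"
      using op by (intro smooth_on_compose smooth_on_translate smooth_on_fst_snd subspace_Times sub)
        (auto simp: D_def openin_Times)
    then show "U \<subseteq> points (prod_manifold (affine_manifold p L S) (affine_manifold p L S)) \<and>
        (\<exists>\<psi>. (\<forall>x\<in>U. \<psi> (\<phi> x) = x) \<and> smooth_on (model_space (prod_manifold (affine_manifold p L S) (affine_manifold p L S)))
           (\<phi> ` U) (\<lambda>x. case \<psi> x of (x, y) \<Rightarrow> x o\<^sub>L y))"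
      unfolding im by (intro conjI exI[of _ "map_prod (\<lambda>x. x + p) (\<lambda>x. x + p)"]) (auto simp: U case_prod_unfold)
  qed (use closedS in \<open>auto simp: subspace_Times sub case_prod_unfold intro!: continuous_intros\<close>)
  show "smooth_map (affine_manifold p L S) (affine_manifold p L S) (m_inv (GL\<lparr>carrier := S\<rparr>))"
  proof (rule smooth_map_affine_target)
    have "continuous_on S op_inv" using continuous_on_op_inv[OF continuous_on_id] inv by blast
    then show "continuous_on (points (affine_manifold p L S)) (\<lambda>s. inv\<^bsub>GL\<lparr>carrier := S\<rparr>\<^esub> s)"
      by (simp add: inv cong: continuous_on_cong)
    fix U \<phi> assume "(U, \<phi>) \<in> charts (affine_manifold p L S)"
    then have U: "U = S" "\<phi> = (\<lambda>x. x - p)" by auto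
    have im: "\<phi> ` U = D" by (simp add: U D_def)
    have "smooth_on L D (\<lambda>x. op_inv (x + p))"
      by (intro smooth_on_op_inv smooth_on_translate smooth_on_identity sub) (use op D inv in \<open>auto simp: D_def\<close>)
    then have "smooth_on L D (\<lambda>x. inv\<^bsub>GL\<lparr>carrier := S\<rparr>\<^esub> (x + p))"
      by (rule smooth_on_cong) (simp add: inv D)
    then show "U \<subseteq> points (affine_manifold p L S) \<and> (\<exists>\<psi>. (\<forall>x\<in>U. \<psi> (\<phi> x) = x) \<and>
        smooth_on (model_space (affine_manifold p L S)) (\<phi> ` U) (\<lambda>x. inv\<^bsub>GL\<lparr>carrier := S\<rparr>\<^esub> (\<psi> x)))"
      unfolding im by (intro conjI exI[of _ "\<lambda>x. x + p"]) (auto simp: U)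
  qed (use inv in \<open>auto simp: sub\<close>)
qed simp_all

section \<open>Triangular operators\<close>

locale orthonormal =
  fixes \<omega> :: enat and \<xi> :: "nat \<Rightarrow> 'a::complex_hilbert"
  assumes onb: "orthonormal_basis \<omega> \<xi>"
begin

lemma ortho: "enat j < \<omega> \<Longrightarrow> enat l < \<omega> \<Longrightarrow> cinner (\<xi> j) (\<xi> l) = (if j = l then 1 else 0)"
  using onb by (simp add: orthonormal_basis_def)

lemma norm_basis [simp]: "enat j < \<omega> \<Longrightarrow> norm (\<xi> j) = 1"
  using ortho[of j j] cinner_self[of "\<xi> j"] by (metis norm_ge_zero of_real_eq_1_iff power2_eq_1_iff one_neq_neg_one
      not_one_le_zero neg_0_le_iff_le le_minus_one_simps(3))

text \<open>Vectors \<open>\<xi> l\<close> with \<open>l\<close> not below \<omega> are arbitrary,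
  so \<open>flag j\<close> has its intended meaning only for \<open>enat j \<le> \<omega>\<close>;
  facts on expansion and closedness carry this bound.\<close>

definition flag :: "nat \<Rightarrow> 'a set"
  where "flag j = cspan {\<xi> l |l. l < j}"

lemma flag_subspace: "complex_vector.subspace (flag j)"
  by (simp add: flag_def complex_vector.subspace_span)

lemmas flag_add = complex_vector.subspace_add[OF flag_subspace]
  and flag_scale = complex_vector.subspace_scale[OF flag_subspace]
  and flag_zero = complex_vector.subspace_0[OF flag_subspace]
  and flag_neg = complex_vector.subspace_neg[OF flag_subspace]
  and flag_sum = complex_vector.subspace_sum[OF flag_subspace]

lemma flag_scaleR: "v \<in> flag j \<Longrightarrow> r *\<^sub>R v \<in> flag j"
  by (simp add: scaleR_eq_scaleC flag_scale)

lemma basis_in_flag: "l < j \<Longrightarrow> \<xi> l \<in> flag j"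
  unfolding flag_def by (rule complex_vector.span_base) auto

lemma flag_mono: "i \<le> j \<Longrightarrow> v \<in> flag i \<Longrightarrow> v \<in> flag j"
  unfolding flag_def using complex_vector.span_mono[of "{\<xi> l |l. l < i}" "{\<xi> l |l. l < j}"] by fastforce

lemma flag_minimal:
  assumes "complex_vector.subspace S" "\<And>l. l < j \<Longrightarrow> \<xi> l \<in> S" "v \<in> flag j"
  shows "v \<in> S"
  using complex_vector.span_minimal[of "{\<xi> l |l. l < j}" S] assms unfolding flag_def by blast

lemma flag_map:
  assumes T: "T \<in> bounded_operators" and "\<And>l. l < j \<Longrightarrow> T (\<xi> l) \<in> flag i" "v \<in> flag j"
  shows "T v \<in> flag i"
proof -
  have "complex_vector.subspace {v. T v \<in> flag i}"
    by (auto simp: complex_vector.subspace_def blinfun.bilinear_simps bounded_operatorsD[OF T]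
        intro: flag_add flag_scale flag_zero)
  from flag_minimal[OF this _ assms(3)] assms(2) show ?thesis by blast
qed

lemma index_less: "l < j \<Longrightarrow> enat j \<le> \<omega> \<Longrightarrow> enat l < \<omega>"
  by (metis enat_ord_simps(2) order_less_le_trans)

lemma index_trans: "l \<le> j \<Longrightarrow> enat j < \<omega> \<Longrightarrow> enat l < \<omega>"
  by (metis enat_ord_simps(1) order_le_less_trans)

lemma flag_coefficient_zero:
  assumes "v \<in> flag j" "j \<le> l" "enat l < \<omega>"
  shows "cinner v (\<xi> l) = 0"
proof -
  have "complex_vector.subspace {v. cinner v (\<xi> l) = 0}"
    by (auto simp: complex_vector.subspace_def cinner_simps)
  moreover have "cinner (\<xi> i) (\<xi> l) = 0" if "i < j" for i
    using ortho[of i l] that assms index_trans[of i l] by simp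
  ultimately show ?thesis using flag_minimal[OF _ _ assms(1)] by blast
qed

text \<open>The finite expansion is an equation between continuous functions of \<open>v\<close>. It
  shows that the algebraic span is closed, on which closedness of \<open>n_algebra\<close>
  rests.\<close>

lemma flag_expansion:
  assumes j: "enat j \<le> \<omega>"
  shows "v \<in> flag j \<longleftrightarrow> v = (\<Sum>l<j. cinner v (\<xi> l) *\<^sub>C \<xi> l)"
proof
  assume v: "v \<in> flag j"
  have "complex_vector.subspace {v. v = (\<Sum>l<j. cinner v (\<xi> l) *\<^sub>C \<xi> l)}"
  proof (rule complex_vector.subspaceI; clarsimp)
    fix x y assume "x = (\<Sum>l<j. cinner x (\<xi> l) *\<^sub>C \<xi> l)" "y = (\<Sum>l<j. cinner y (\<xi> l) *\<^sub>C \<xi> l)"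
    then have "x + y = (\<Sum>l<j. cinner x (\<xi> l) *\<^sub>C \<xi> l) + (\<Sum>l<j. cinner y (\<xi> l) *\<^sub>C \<xi> l)"
      by (rule arg_cong2[where f = "(+)"])
    also have "\<dots> = (\<Sum>l<j. cinner (x + y) (\<xi> l) *\<^sub>C \<xi> l)"
      by (simp only: cinner_add_left scaleC_add_left sum.distrib)
    finally show "x + y = (\<Sum>l<j. cinner (x + y) (\<xi> l) *\<^sub>C \<xi> l)" .
  next
    fix c x assume "x = (\<Sum>l<j. cinner x (\<xi> l) *\<^sub>C \<xi> l)"
    then have "c *\<^sub>C x = c *\<^sub>C (\<Sum>l<j. cinner x (\<xi> l) *\<^sub>C \<xi> l)" by (rule arg_cong[where f = "\<lambda>v. c *\<^sub>C v"])
    also have "\<dots> = (\<Sum>l<j. cinner (c *\<^sub>C x) (\<xi> l) *\<^sub>C \<xi> l)"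
      by (simp only: cinner_scaleC_left scaleC_scaleC complex_vector.scale_sum_right)
    finally show "c *\<^sub>C x = (\<Sum>l<j. cinner (c *\<^sub>C x) (\<xi> l) *\<^sub>C \<xi> l)" .
  qed
  moreover have "\<xi> i = (\<Sum>l<j. cinner (\<xi> i) (\<xi> l) *\<^sub>C \<xi> l)" if "i < j" for i
  proof -
    have "(\<Sum>l<j. cinner (\<xi> i) (\<xi> l) *\<^sub>C \<xi> l) = (\<Sum>l<j. if l = i then \<xi> l else 0)"
      by (rule sum.cong) (use that index_less[OF _ j] ortho in auto)
    then show ?thesis using that by simp
  qed
  ultimately show "v = (\<Sum>l<j. cinner v (\<xi> l) *\<^sub>C \<xi> l)" using flag_minimal[OF _ _ v] by blast
next
  assume "v = (\<Sum>l<j. cinner v (\<xi> l) *\<^sub>C \<xi> l)"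
  moreover have "(\<Sum>l<j. cinner v (\<xi> l) *\<^sub>C \<xi> l) \<in> flag j"
    by (intro flag_sum flag_scale basis_in_flag) auto
  ultimately show "v \<in> flag j" by metis
qed

lemma closed_flag:
  assumes j: "enat j \<le> \<omega>" shows "closed (flag j)"
proof -
  have "continuous_on UNIV (\<lambda>v. cinner v (\<xi> l) *\<^sub>C \<xi> l)" for l
  proof -
    have "bounded_linear (\<lambda>v. cinner v (\<xi> l) *\<^sub>C \<xi> l)"
      by (rule bounded_linear_intro[of _ "norm (\<xi> l) * norm (\<xi> l)"])
        (simp_all add: cinner_simps scaleC_add_left scaleR_eq_scaleC scaleC_scaleC norm_scaleC,
          metis cmod_cinner_le mult.assoc mult_right_mono norm_ge_zero)
    then show ?thesis by (rule bounded_linear.continuous_on[OF _ continuous_on_id])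
  qed
  then have "closed {v. v = (\<Sum>l<j. cinner v (\<xi> l) *\<^sub>C \<xi> l)}"
    by (intro closed_Collect_eq continuous_intros) auto
  moreover have "flag j = {v. v = (\<Sum>l<j. cinner v (\<xi> l) *\<^sub>C \<xi> l)}" using flag_expansion[OF j] by blast
  ultimately show ?thesis by simp
qed

lemma basis_separates:
  assumes "\<And>j. enat j < \<omega> \<Longrightarrow> cinner (\<xi> j) x = 0"
  shows "x = 0"
proof -
  let ?S = "{y. cinner y x = 0}"
  have "complex_vector.subspace ?S" by (auto simp: complex_vector.subspace_def cinner_simps)
  then have "cspan {\<xi> j |j. enat j < \<omega>} \<subseteq> ?S"
    using assms by (intro complex_vector.span_minimal) auto
  moreover have "closed ?S" by (intro closed_Collect_eq continuous_intros continuous_on_cinner)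
  ultimately have "closure (cspan {\<xi> j |j. enat j < \<omega>}) \<subseteq> ?S" by (rule closure_minimal)
  then have "UNIV \<subseteq> ?S" using onb by (simp add: orthonormal_basis_def)
  then have "cinner x x = 0" by blast
  then show ?thesis by (simp add: cinner_self)
qed

lemma operator_eqI:
  assumes "S \<in> bounded_operators" "T \<in> bounded_operators" "\<And>j. enat j < \<omega> \<Longrightarrow> S (\<xi> j) = T (\<xi> j)"
  shows "S = T"
proof (rule blinfun_eqI)
  fix x
  let ?S = "{x. S x = T x}"
  have "complex_vector.subspace ?S"
    by (auto simp: complex_vector.subspace_def blinfun.bilinear_simps bounded_operatorsD assms)
  then have "cspan {\<xi> j |j. enat j < \<omega>} \<subseteq> ?S"
    using assms by (intro complex_vector.span_minimal) auto
  moreover have "closed ?S" by (intro closed_Collect_eq continuous_intros)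
  ultimately have "closure (cspan {\<xi> j |j. enat j < \<omega>}) \<subseteq> ?S" by (rule closure_minimal)
  then have "UNIV \<subseteq> ?S" using onb by (simp add: orthonormal_basis_def)
  then show "S x = T x" by blast
qed

section \<open>The diagonal and the unitriangular group as subgroups that respect the flag\<close>

lemma n_algebra_iff: "Z \<in> n_algebra \<omega> \<xi> \<longleftrightarrow> Z \<in> bounded_operators \<and> (\<forall>j. enat j < \<omega> \<longrightarrow> Z (\<xi> j) \<in> flag j)"
  by (simp add: n_algebra_def flag_def)

lemma a_algebra_iff: "Y \<in> a_algebra \<omega> \<xi> \<longleftrightarrow> Y \<in> bounded_operators \<and>
    (\<forall>j. enat j < \<omega> \<longrightarrow> (\<exists>r::real. Y (\<xi> j) = r *\<^sub>R \<xi> j))"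
  by (auto simp: a_algebra_def)

lemma A_group_iff: "a \<in> A_group \<omega> \<xi> \<longleftrightarrow> a \<in> bounded_operators \<and> invertible_op a \<and>
    (\<forall>j. enat j < \<omega> \<longrightarrow> (\<exists>r::real. r > 0 \<and> a (\<xi> j) = r *\<^sub>R \<xi> j))"
  by (auto simp: A_group_def carrier_GL)

lemma N_group_iff: "n \<in> N_group \<omega> \<xi> \<longleftrightarrow> n \<in> bounded_operators \<and> invertible_op n \<and>
    (\<forall>j. enat j < \<omega> \<longrightarrow> n (\<xi> j) - \<xi> j \<in> flag j)"
proof -
  have "x \<in> {\<xi> j + v |v. v \<in> cspan {\<xi> l |l. l < j}} \<longleftrightarrow> x - \<xi> j \<in> flag j" for x j
    unfolding flag_def by (force simp: algebra_simps)
  then show ?thesis by (auto simp: N_group_def carrier_GL)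
qed

lemma N_group_iff_n_algebra: "n \<in> N_group \<omega> \<xi> \<longleftrightarrow> invertible_op n \<and> n - id_blinfun \<in> n_algebra \<omega> \<xi>"
  using subspace_add[OF subspace_bounded_operators, of "n - id_blinfun" id_blinfun]
    subspace_diff[OF subspace_bounded_operators, of n id_blinfun]
  by (auto simp: N_group_iff n_algebra_iff blinfun.bilinear_simps)

lemma n_algebra_flag:
  assumes "Z \<in> n_algebra \<omega> \<xi>" "enat j \<le> \<omega>" "v \<in> flag j"
  shows "Z v \<in> flag j"
proof (rule flag_map[OF _ _ assms(3)])
  fix l assume "l < j"
  then have "Z (\<xi> l) \<in> flag l" using assms(1) index_less[OF _ assms(2)] by (simp add: n_algebra_iff)
  then show "Z (\<xi> l) \<in> flag j" using \<open>l < j\<close> by (rule flag_mono[OF less_imp_le, rotated])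
qed (use assms(1) in \<open>simp add: n_algebra_iff\<close>)

lemma N_group_flag:
  assumes n: "n \<in> N_group \<omega> \<xi>" and j: "enat j \<le> \<omega>" and v: "v \<in> flag j"
  shows "n v \<in> flag j"
proof -
  have "n - id_blinfun \<in> n_algebra \<omega> \<xi>" using n by (simp add: N_group_iff_n_algebra)
  then have "(n - id_blinfun) v \<in> flag j" using n_algebra_flag j v by blast
  from flag_add[OF this v] show ?thesis by (simp add: blinfun.bilinear_simps)
qed

lemma a_algebra_flag:
  assumes a: "a \<in> a_algebra \<omega> \<xi>" and j: "enat j \<le> \<omega>" and v: "v \<in> flag j"
  shows "a v \<in> flag j"
proof (rule flag_map[OF _ _ v])
  fix l assume "l < j"
  with a index_less[OF this j] obtain r :: real where "a (\<xi> l) = r *\<^sub>R \<xi> l" by (auto simp: a_algebra_iff)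
  then show "a (\<xi> l) \<in> flag j" using \<open>l < j\<close> by (simp add: flag_scaleR basis_in_flag)
qed (use a in \<open>simp add: a_algebra_iff\<close>)

text \<open>Since \<open>\<xi> j - op_inv n (\<xi> j) = op_inv n (n (\<xi> j) - \<xi> j)\<close>,
  the inverse at the \<open>j\<close>-th basis vector is governed by its values at the earlier ones;
  induction on \<open>j\<close> works in infinite dimension as well.\<close>

lemma N_group_inverse:
  assumes n: "n \<in> N_group \<omega> \<xi>"
  shows "op_inv n \<in> N_group \<omega> \<xi>"
proof -
  have n': "n \<in> bounded_operators" "invertible_op n" "\<And>j. enat j < \<omega> \<Longrightarrow> n (\<xi> j) - \<xi> j \<in> flag j"
    using n by (auto simp: N_group_iff)
  have "op_inv n (\<xi> j) - \<xi> j \<in> flag j" if "enat j < \<omega>" for j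
    using that
  proof (induction j rule: less_induct)
    case (less j)
    have "op_inv n (\<xi> l) \<in> flag j" if "l < j" for l
    proof -
      have "enat l < \<omega>" by (rule index_trans[OF less_imp_le[OF that] less.prems])
      from flag_mono[OF less_imp_le[OF that] less.IH[OF that this]] have "op_inv n (\<xi> l) - \<xi> l \<in> flag j" .
      from flag_add[OF this basis_in_flag[OF that]] show ?thesis by simp
    qed
    then have "op_inv n (n (\<xi> j) - \<xi> j) \<in> flag j"
      by (rule flag_map[OF op_inv_bounded_operators[OF n'(1,2)] _ n'(3)[OF less.prems]])
    then have "\<xi> j - op_inv n (\<xi> j) \<in> flag j" by (simp add: blinfun.bilinear_simps op_inv_apply n')
    from flag_neg[OF this] show ?case by simp
  qed
  then show ?thesis using n' by (simp add: N_group_iff invertible_op_inv)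
qed

lemma N_group_compose:
  assumes n: "n \<in> N_group \<omega> \<xi>" and m: "m \<in> N_group \<omega> \<xi>"
  shows "(n o\<^sub>L m) \<in> N_group \<omega> \<xi>"
proof -
  have "n (m (\<xi> j)) - \<xi> j \<in> flag j" if j: "enat j < \<omega>" for j
  proof -
    have "n (m (\<xi> j) - \<xi> j) \<in> flag j" using N_group_flag[OF n] j m by (simp add: N_group_iff)
    moreover have "n (\<xi> j) - \<xi> j \<in> flag j" using n j by (simp add: N_group_iff)
    ultimately have "n (m (\<xi> j) - \<xi> j) + (n (\<xi> j) - \<xi> j) \<in> flag j" by (rule flag_add)
    then show ?thesis by (simp add: blinfun.bilinear_simps)
  qed
  then show ?thesis using n m by (simp add: N_group_iff invertible_op_compose)
qed

lemma subgroup_N: "subgroup (N_group \<omega> \<xi>) GL"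
proof (rule subgroup_GL_I)
  show "N_group \<omega> \<xi> \<subseteq> carrier GL" by (auto simp: N_group_iff carrier_GL)
  show "id_blinfun \<in> N_group \<omega> \<xi>" by (simp add: N_group_iff flag_zero)
qed (simp_all add: N_group_inverse N_group_compose)

lemma subgroup_A: "subgroup (A_group \<omega> \<xi>) GL"
proof (rule subgroup_GL_I)
  show "A_group \<omega> \<xi> \<subseteq> carrier GL" by (auto simp: A_group_iff carrier_GL)
  show "id_blinfun \<in> A_group \<omega> \<xi>" by (auto simp: A_group_iff intro!: exI[of _ 1])
  fix s assume s: "s \<in> A_group \<omega> \<xi>"
  show "op_inv s \<in> A_group \<omega> \<xi>"
    unfolding A_group_iff
  proof (intro conjI allI impI)
    fix j assume "enat j < \<omega>"
    with s obtain r where r: "r > 0" "s (\<xi> j) = r *\<^sub>R \<xi> j" by (auto simp: A_group_iff)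
    have "\<xi> j = op_inv s (s (\<xi> j))" using s by (simp add: A_group_iff op_inv_apply)
    then have "\<xi> j = r *\<^sub>R op_inv s (\<xi> j)" by (simp add: r blinfun.bilinear_simps)
    from arg_cong[OF this, of "\<lambda>v. (1 / r) *\<^sub>R v"] have "op_inv s (\<xi> j) = (1 / r) *\<^sub>R \<xi> j" using r by simp
    then show "\<exists>r>0. op_inv s (\<xi> j) = r *\<^sub>R \<xi> j" using r by (intro exI[of _ "1 / r"]) simp
  qed (use s in \<open>auto simp: A_group_iff invertible_op_inv\<close>)
  fix t assume t: "t \<in> A_group \<omega> \<xi>"
  show "s o\<^sub>L t \<in> A_group \<omega> \<xi>"
    unfolding A_group_iff
  proof (intro conjI allI impI)
    fix j assume "enat j < \<omega>"
    with s t obtain r r' where "r > 0" "s (\<xi> j) = r *\<^sub>R \<xi> j" "r' > 0" "t (\<xi> j) = r' *\<^sub>R \<xi> j"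
      by (metis A_group_iff)
    then show "\<exists>r>0. (s o\<^sub>L t) (\<xi> j) = r *\<^sub>R \<xi> j"
      by (intro exI[of _ "r' * r"]) (simp add: blinfun.bilinear_simps)
  qed (use s t in \<open>auto simp: A_group_iff invertible_op_compose\<close>)
qed

section \<open>Diagonal and strictly triangular operators as Lie algebras of these groups\<close>

lemma closed_basis_condition:
  assumes "\<And>j. enat j < \<omega> \<Longrightarrow> closed (C j)"
  shows "closed {T. \<forall>j. enat j < \<omega> \<longrightarrow> blinfun_apply T (\<xi> j) \<in> C j}"
proof -
  have "closed {T. blinfun_apply T (\<xi> j) \<in> C j}" if "enat j < \<omega>" for j
    using closed_vimage[OF assms[OF that], of "\<lambda>T. blinfun_apply T (\<xi> j)"]
    by (simp add: vimage_def continuous_intros)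
  then have "closed (\<Inter>j\<in>{j. enat j < \<omega>}. {T. blinfun_apply T (\<xi> j) \<in> C j})" by blast
  moreover have "{T. \<forall>j. enat j < \<omega> \<longrightarrow> blinfun_apply T (\<xi> j) \<in> C j} =
      (\<Inter>j\<in>{j. enat j < \<omega>}. {T. blinfun_apply T (\<xi> j) \<in> C j})" by blast
  ultimately show ?thesis by simp
qed

lemma subspace_basis_condition:
  assumes "\<And>j. enat j < \<omega> \<Longrightarrow> subspace (C j)"
  shows "subspace {T. \<forall>j. enat j < \<omega> \<longrightarrow> blinfun_apply T (\<xi> j) \<in> C j}"
proof (rule subspaceI)
  show "0 \<in> {T. \<forall>j. enat j < \<omega> \<longrightarrow> blinfun_apply T (\<xi> j) \<in> C j}"
    using subspace_0[OF assms] by (auto simp: blinfun.bilinear_simps)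
  show "x + y \<in> {T. \<forall>j. enat j < \<omega> \<longrightarrow> blinfun_apply T (\<xi> j) \<in> C j}"
    if "x \<in> {T. \<forall>j. enat j < \<omega> \<longrightarrow> blinfun_apply T (\<xi> j) \<in> C j}" "y \<in> {T. \<forall>j. enat j < \<omega> \<longrightarrow> blinfun_apply T (\<xi> j) \<in> C j}" for x y
    using that subspace_add[OF assms] by (auto simp: blinfun.bilinear_simps)
  show "c *\<^sub>R x \<in> {T. \<forall>j. enat j < \<omega> \<longrightarrow> blinfun_apply T (\<xi> j) \<in> C j}"
    if "x \<in> {T. \<forall>j. enat j < \<omega> \<longrightarrow> blinfun_apply T (\<xi> j) \<in> C j}" for c x
    using that subspace_scale[OF assms] by (auto simp: blinfun.bilinear_simps)
qed

lemma n_algebra_compose: "X \<in> n_algebra \<omega> \<xi> \<Longrightarrow> Y \<in> n_algebra \<omega> \<xi> \<Longrightarrow> (X o\<^sub>L Y) \<in> n_algebra \<omega> \<xi>"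
  using n_algebra_flag[of X] by (auto simp: n_algebra_iff less_imp_le)

lemma closed_real_lie_subalgebra_n: "closed_real_lie_subalgebra (n_algebra \<omega> \<xi>)"
proof -
  have n: "n_algebra \<omega> \<xi> = bounded_operators \<inter> {Z. \<forall>j. enat j < \<omega> \<longrightarrow> blinfun_apply Z (\<xi> j) \<in> flag j}"
    using n_algebra_iff by blast
  have "closed (n_algebra \<omega> \<xi>)"
    unfolding n by (intro closed_Int closed_bounded_operators closed_basis_condition closed_flag less_imp_le)
  moreover have sub: "subspace (n_algebra \<omega> \<xi>)"
    unfolding n by (intro subspace_inter subspace_bounded_operators subspace_basis_condition
        complex_subspace_imp_subspace flag_subspace)
  moreover have "n_algebra \<omega> \<xi> \<subseteq> bounded_operators" by (simp add: n)
  ultimately show ?thesis unfolding closed_real_lie_subalgebra_def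
    by (intro conjI ballI subspace_diff[OF sub] n_algebra_compose)
qed

lemma closed_real_lie_subalgebra_a: "closed_real_lie_subalgebra (a_algebra \<omega> \<xi>)"
proof -
  have a: "a_algebra \<omega> \<xi> = bounded_operators \<inter> {Y. \<forall>j. enat j < \<omega> \<longrightarrow> blinfun_apply Y (\<xi> j) \<in> {r *\<^sub>R \<xi> j |r. True}}"
    unfolding a_algebra_def by blast
  have "closed {r *\<^sub>R \<xi> j |r. True}" if "enat j < \<omega>" for j
  proof -
    have "v = (v \<bullet> \<xi> j) *\<^sub>R \<xi> j \<longleftrightarrow> (\<exists>r. v = r *\<^sub>R \<xi> j)" for v
      using norm_basis[OF that] by (auto simp: dot_square_norm)
    then have "{r *\<^sub>R \<xi> j |r. True} = {v. v = (v \<bullet> \<xi> j) *\<^sub>R \<xi> j}" by blast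
    moreover have "closed {v. v = (v \<bullet> \<xi> j) *\<^sub>R \<xi> j}" by (intro closed_Collect_eq continuous_intros)
    ultimately show ?thesis by simp
  qed
  then have "closed (a_algebra \<omega> \<xi>)"
    unfolding a by (intro closed_Int closed_bounded_operators closed_basis_condition)
  moreover have "subspace (a_algebra \<omega> \<xi>)"
  proof -
    have "subspace {r *\<^sub>R \<xi> j |r. True}" for j
      using subspace_span[of "{\<xi> j}"] by (simp add: span_singleton full_SetCompr_eq)
    then show ?thesis
      unfolding a by (intro subspace_inter subspace_bounded_operators subspace_basis_condition)
  qed
  moreover have "(X o\<^sub>L Y) - (Y o\<^sub>L X) \<in> a_algebra \<omega> \<xi>" if X: "X \<in> a_algebra \<omega> \<xi>" and Y: "Y \<in> a_algebra \<omega> \<xi>" for X Y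
    unfolding a_algebra_iff
  proof (intro conjI allI impI)
    show "(X o\<^sub>L Y) - (Y o\<^sub>L X) \<in> bounded_operators"
      using X Y by (intro subspace_diff[OF subspace_bounded_operators]) (auto simp: a_algebra_iff)
    fix j assume "enat j < \<omega>"
    with X Y obtain r r' :: real where "X (\<xi> j) = r *\<^sub>R \<xi> j" "Y (\<xi> j) = r' *\<^sub>R \<xi> j"
      by (metis a_algebra_iff)
    then show "\<exists>r. ((X o\<^sub>L Y) - (Y o\<^sub>L X)) (\<xi> j) = r *\<^sub>R \<xi> j"
      by (intro exI[of _ 0]) (simp add: blinfun.bilinear_simps)
  qed
  ultimately show ?thesis unfolding closed_real_lie_subalgebra_def by (auto simp: a_algebra_iff)
qed

lemma subspace_a: "subspace (a_algebra \<omega> \<xi>)" and closed_a: "closed (a_algebra \<omega> \<xi>)"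
  and subspace_n: "subspace (n_algebra \<omega> \<xi>)" and closed_n: "closed (n_algebra \<omega> \<xi>)"
  using closed_real_lie_subalgebra_a closed_real_lie_subalgebra_n by (auto simp: closed_real_lie_subalgebra_def)

lemma A_group_subset: "A_group \<omega> \<xi> \<subseteq> a_algebra \<omega> \<xi>"
  unfolding A_group_iff a_algebra_iff subset_iff by blast

lemma lie_algebra_A: "lie_algebra (A_group \<omega> \<xi>) = a_algebra \<omega> \<xi>"
proof
  have "id_blinfun \<in> a_algebra \<omega> \<xi>" by (auto simp: a_algebra_iff intro: exI[of _ 1])
  then show "lie_algebra (A_group \<omega> \<xi>) \<subseteq> a_algebra \<omega> \<xi>"
    using A_group_subset subspace_diff[OF subspace_a]
    by (intro closed_subspace_lie_algebra_subset closed_a subspace_a) blast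
  have "op_exp Y \<in> A_group \<omega> \<xi>" if Y: "Y \<in> a_algebra \<omega> \<xi>" for Y
    unfolding A_group_iff
  proof (intro conjI allI impI)
    show "op_exp Y \<in> bounded_operators" using Y by (simp add: a_algebra_iff op_exp_bounded_operators)
    show "invertible_op (op_exp Y)" by (rule invertible_op_exp)
    fix j assume "enat j < \<omega>"
    with Y obtain r :: real where r: "Y (\<xi> j) = r *\<^sub>R \<xi> j" by (auto simp: a_algebra_iff)
    have "op_pow Y n (\<xi> j) = r ^ n *\<^sub>R \<xi> j" for n
      by (induction n) (simp_all add: blinfun.bilinear_simps r mult.commute)
    then have "op_exp Y (\<xi> j) = (\<Sum>n. (r ^ n /\<^sub>R fact n) *\<^sub>R \<xi> j)"
      by (simp add: op_exp_apply divide_inverse mult.commute)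
    also have "\<dots> = exp r *\<^sub>R \<xi> j"
      unfolding exp_def
      by (rule bounded_linear.suminf[OF bounded_linear_scaleR_left summable_exp_generic, symmetric])
    finally show "\<exists>r>0. op_exp Y (\<xi> j) = r *\<^sub>R \<xi> j" by (intro exI[of _ "exp r"]) simp
  qed
  then show "a_algebra \<omega> \<xi> \<subseteq> lie_algebra (A_group \<omega> \<xi>)"
    using subspace_scale[OF subspace_a] by (auto simp: lie_algebra_def) (simp add: a_algebra_iff)
qed

lemma lie_algebra_N: "lie_algebra (N_group \<omega> \<xi>) = n_algebra \<omega> \<xi>"
proof
  show "lie_algebra (N_group \<omega> \<xi>) \<subseteq> n_algebra \<omega> \<xi>"
    by (intro closed_subspace_lie_algebra_subset closed_n subspace_n) (simp add: N_group_iff_n_algebra)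
  have "op_exp Z \<in> N_group \<omega> \<xi>" if Z: "Z \<in> n_algebra \<omega> \<xi>" for Z
  proof -
    have p: "op_pow Z (Suc n) \<in> n_algebra \<omega> \<xi>" for n
      using Z n_algebra_compose[OF Z] by (induction n) simp_all
    \<comment> \<open>The term of degree 0 is split off; all others are multiples of powers of
      \<open>Z\<close> and lie in the closed space \<open>n_algebra\<close>.\<close>
    have "op_exp Z - id_blinfun = (\<Sum>n. (1 / fact (Suc n)) *\<^sub>R op_pow Z (Suc n))"
      unfolding op_exp_op_pow using suminf_split_head[OF summable_op_exp[of Z]] by simp
    also have "\<dots> \<in> n_algebra \<omega> \<xi>"
    proof (rule suminf_in_closed_subspace[OF closed_n subspace_n])
      show "summable (\<lambda>n. (1 / fact (Suc n)) *\<^sub>R op_pow Z (Suc n))"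
        using summable_op_exp[of Z] by (subst summable_Suc_iff)
    qed (intro subspace_scale[OF subspace_n] p)
    finally show ?thesis by (simp add: N_group_iff_n_algebra invertible_op_exp)
  qed
  then show "n_algebra \<omega> \<xi> \<subseteq> lie_algebra (N_group \<omega> \<xi>)"
    using subspace_scale[OF subspace_n] by (auto simp: lie_algebra_def) (simp add: n_algebra_iff)
qed

text \<open>Possibly infinitely many diagonal entries have to stay positive at once. As
  \<open>a\<close> is invertible, every entry exceeds \<open>1 / (norm (op_inv a) + 1)\<close>, a
  margin common to all; within this distance \<open>y\<close> is invertible too.\<close>

lemma openin_A: "openin (top_of_set (a_algebra \<omega> \<xi>)) (A_group \<omega> \<xi>)"
  unfolding openin_euclidean_subtopology_iff
proof (intro conjI ballI A_group_subset)
  fix a assume a: "a \<in> A_group \<omega> \<xi>"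
  then have ia: "invertible_op a" by (simp add: A_group_iff)
  define e where "e = 1 / (norm (op_inv a) + 1)"
  have p: "norm (op_inv a) + 1 > 0" by (simp add: add_nonneg_pos)
  have e: "e > 0" using p by (simp add: e_def)
  have "y \<in> A_group \<omega> \<xi>" if y: "y \<in> a_algebra \<omega> \<xi>" "dist y a < e" for y
    unfolding A_group_iff
  proof (intro conjI allI impI)
    show "y \<in> bounded_operators" using y by (simp add: a_algebra_iff)
    have d: "norm (y - a) < e" using y by (simp add: dist_norm)
    have "norm (y - a) * norm (op_inv a) \<le> e * norm (op_inv a)" using d by (intro mult_right_mono) auto
    also have "\<dots> < 1" using p by (simp add: e_def field_simps)
    finally show "invertible_op y" by (rule invertible_op_near[OF ia])
    fix j assume j: "enat j < \<omega>"
    obtain r where r: "r > 0" "a (\<xi> j) = r *\<^sub>R \<xi> j" using a j by (auto simp: A_group_iff)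
    obtain r' where r': "y (\<xi> j) = r' *\<^sub>R \<xi> j" using y j by (auto simp: a_algebra_iff)
    have "1 = norm (op_inv a (a (\<xi> j)))" using j by (simp add: op_inv_apply[OF ia])
    also have "\<dots> = r * norm (op_inv a (\<xi> j))" using r by (simp add: blinfun.bilinear_simps)
    also have "\<dots> \<le> r * norm (op_inv a)"
      using norm_blinfun[of "op_inv a" "\<xi> j"] r j by (intro mult_left_mono) auto
    finally have "1 < r * (norm (op_inv a) + 1)" using r by (simp add: algebra_simps)
    then have "e < r" using p by (simp add: e_def field_simps)
    moreover have "\<bar>r' - r\<bar> = norm ((y - a) (\<xi> j))"
      using j by (simp add: blinfun.bilinear_simps r r' scaleR_diff_left[symmetric])
    moreover have "\<dots> \<le> norm (y - a)" using norm_blinfun[of "y - a" "\<xi> j"] j by simp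
    ultimately have "r' > 0" using d by linarith
    then show "\<exists>r>0. y (\<xi> j) = r *\<^sub>R \<xi> j" using r' by blast
  qed
  then show "\<exists>e>0. \<forall>x'\<in>a_algebra \<omega> \<xi>. dist x' a < e \<longrightarrow> x' \<in> A_group \<omega> \<xi>" using e by blast
qed

lemma openin_N: "openin (top_of_set (n_algebra \<omega> \<xi>)) ((\<lambda>x. x - id_blinfun) ` N_group \<omega> \<xi>)"
proof -
  have "open ((\<lambda>u. u + id_blinfun) -` {T::'a \<Rightarrow>\<^sub>L 'a. invertible_op T})"
    by (intro open_vimage open_invertible_op continuous_intros)
  moreover have "(\<lambda>x. x - id_blinfun) ` N_group \<omega> \<xi> = n_algebra \<omega> \<xi> \<inter> ((\<lambda>u. u + id_blinfun) -` {T. invertible_op T})"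
    by (force simp: N_group_iff_n_algebra image_iff intro: bexI[of _ "_ + id_blinfun"])
  ultimately show ?thesis by (auto simp: openin_open)
qed

definition A_manifold where "A_manifold = affine_manifold 0 (a_algebra \<omega> \<xi>) (A_group \<omega> \<xi>)"
definition N_manifold where "N_manifold = affine_manifold id_blinfun (n_algebra \<omega> \<xi>) (N_group \<omega> \<xi>)"

lemma lie_group_structure_A: "lie_group_structure (A_group \<omega> \<xi>) (a_algebra \<omega> \<xi>) A_manifold"
  unfolding A_manifold_def
  by (rule lie_group_structure_affine[OF subgroup_A closed_real_lie_subalgebra_a lie_algebra_A]) (simp add: openin_A)

lemma lie_group_structure_N: "lie_group_structure (N_group \<omega> \<xi>) (n_algebra \<omega> \<xi>) N_manifold"
  unfolding N_manifold_def
  by (rule lie_group_structure_affine[OF subgroup_N closed_real_lie_subalgebra_n lie_algebra_N openin_N])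

section \<open>Gram-Schmidt orthogonalization and the Iwasawa decomposition\<close>

lemma bessel:
  assumes F: "finite F" "\<And>j. j \<in> F \<Longrightarrow> enat j < \<omega>"
  shows "(\<Sum>j\<in>F. (cmod (cinner x (\<xi> j)))\<^sup>2) \<le> (norm x)\<^sup>2"
proof -
  define s where "s = (\<Sum>j\<in>F. cinner x (\<xi> j) *\<^sub>C \<xi> j)"
  have "cinner s (\<xi> j) = cinner x (\<xi> j)" if "j \<in> F" for j
  proof -
    have "cinner s (\<xi> j) = (\<Sum>i\<in>F. if i = j then cinner x (\<xi> j) else 0)"
      unfolding s_def cinner_simps by (rule sum.cong) (use F that ortho in auto)
    then show ?thesis using F that by simp
  qed
  then have "cinner (x - s) s = 0"
    unfolding s_def[THEN arg_cong[where f = "cinner (x - s)"]]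
    by (simp add: cinner_simps)
  then have "orthogonal (x - s) s" by (simp add: orthogonal_def inner_eq_Re_cinner)
  from norm_add_Pythagorean[OF this] have "(norm s)\<^sup>2 \<le> (norm x)\<^sup>2" by simp
  moreover have "(norm s)\<^sup>2 = (\<Sum>j\<in>F. (cmod (cinner x (\<xi> j)))\<^sup>2 * (norm (\<xi> j))\<^sup>2)"
    unfolding s_def using F ortho by (intro norm_sum_orthogonal) auto
  ultimately show ?thesis using F by simp
qed

text \<open>By orthogonality the squared norms of the terms
  \<open>cinner x (\<xi> j) *\<^sub>C y j\<close> add up, and Bessel's inequality controls them;
  this gives both convergence and the bound. For columns that are merely bounded no such operator
  need exist.\<close>

lemma operator_with_orthogonal_images:
  fixes y :: "nat \<Rightarrow> 'a"
  assumes C: "C \<ge> 0" "\<And>j. enat j < \<omega> \<Longrightarrow> norm (y j) \<le> C"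
    and y: "\<And>i j. enat i < \<omega> \<Longrightarrow> enat j < \<omega> \<Longrightarrow> i \<noteq> j \<Longrightarrow> cinner (y i) (y j) = 0"
  obtains T where "T \<in> bounded_operators" "\<And>j. enat j < \<omega> \<Longrightarrow> blinfun_apply T (\<xi> j) = y j"
proof -
  \<comment> \<open>Indices not below \<omega> contribute 0, so finite and infinite bases are
    treated by one series.\<close>
  define f where "f = (\<lambda>x j. if enat j < \<omega> then cinner x (\<xi> j) *\<^sub>C y j else 0)"
  define q where "q = (\<lambda>x j. if enat j < \<omega> then (cmod (cinner x (\<xi> j)))\<^sup>2 else 0)"
  have nf: "(norm (sum (f x) F))\<^sup>2 \<le> C\<^sup>2 * sum (q x) F" if F: "finite F" for x F
  proof -
    let ?F = "{j \<in> F. enat j < \<omega>}"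
    have "sum (f x) F = (\<Sum>j\<in>?F. cinner x (\<xi> j) *\<^sub>C y j)" "sum (q x) F = (\<Sum>j\<in>?F. (cmod (cinner x (\<xi> j)))\<^sup>2)"
      using F by (simp_all add: f_def q_def sum.inter_filter)
    moreover have "(norm (\<Sum>j\<in>?F. cinner x (\<xi> j) *\<^sub>C y j))\<^sup>2 = (\<Sum>j\<in>?F. (cmod (cinner x (\<xi> j)))\<^sup>2 * (norm (y j))\<^sup>2)"
      using F y by (intro norm_sum_orthogonal) auto
    moreover have "\<dots> \<le> (\<Sum>j\<in>?F. C\<^sup>2 * (cmod (cinner x (\<xi> j)))\<^sup>2)"
      by (rule sum_mono) (use C in \<open>auto simp: mult.commute[of "C\<^sup>2"] intro!: mult_left_mono power_mono\<close>)
    ultimately show ?thesis by (simp add: sum_distrib_left)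
  qed
  have q0: "0 \<le> q x j" for x j by (simp add: q_def)
  have qb: "sum (q x) F \<le> (norm x)\<^sup>2" if F: "finite F" for x F
  proof -
    have "sum (q x) F = (\<Sum>j\<in>{j \<in> F. enat j < \<omega>}. (cmod (cinner x (\<xi> j)))\<^sup>2)"
      using F by (simp add: q_def sum.inter_filter)
    also have "\<dots> \<le> (norm x)\<^sup>2" using F by (intro bessel) auto
    finally show ?thesis .
  qed
  have sq: "summable (q x)" for x
    by (rule summableI_nonneg_bounded[OF q0 qb]) simp
  have sf: "summable (f x)" for x
    unfolding summable_Cauchy
  proof (intro allI impI)
    fix e :: real assume e: "e > 0"
    then have "e\<^sup>2 / (C\<^sup>2 + 1) > 0" by (simp add: add_nonneg_pos)
    then obtain N where N: "\<And>m n. m \<ge> N \<Longrightarrow> norm (sum (q x) {m..<n}) < e\<^sup>2 / (C\<^sup>2 + 1)"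
      using sq[of x] unfolding summable_Cauchy by blast
    have "norm (sum (f x) {m..<n}) < e" if "m \<ge> N" for m n
    proof (rule power2_less_imp_less)
      have s: "sum (q x) {m..<n} < e\<^sup>2 / (C\<^sup>2 + 1)" "0 \<le> sum (q x) {m..<n}"
        using N[OF that, of n] q0 by (auto intro: sum_nonneg)
      have "(norm (sum (f x) {m..<n}))\<^sup>2 \<le> C\<^sup>2 * sum (q x) {m..<n}" by (rule nf) simp
      also have "\<dots> \<le> (C\<^sup>2 + 1) * sum (q x) {m..<n}" using s by (intro mult_right_mono) auto
      also have "\<dots> < (C\<^sup>2 + 1) * (e\<^sup>2 / (C\<^sup>2 + 1))" using s by (intro mult_strict_left_mono) (auto simp: add_nonneg_pos)
      also have "\<dots> = e\<^sup>2" using add_nonneg_pos[of "C\<^sup>2" 1] by simp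
      finally show "(norm (sum (f x) {m..<n}))\<^sup>2 < e\<^sup>2" .
    qed (use e in simp)
    then show "\<exists>N. \<forall>m\<ge>N. \<forall>n. norm (sum (f x) {m..<n}) < e" by blast
  qed
  define S where "S = (\<lambda>x. suminf (f x))"
  have "norm (S x) \<le> norm x * C" for x
  proof -
    have "norm (sum (f x) {..<n}) \<le> norm x * C" for n
    proof (rule power2_le_imp_le)
      have "(norm (sum (f x) {..<n}))\<^sup>2 \<le> C\<^sup>2 * sum (q x) {..<n}" by (rule nf) simp
      also have "\<dots> \<le> C\<^sup>2 * (norm x)\<^sup>2" using qb by (intro mult_left_mono) auto
      finally show "(norm (sum (f x) {..<n}))\<^sup>2 \<le> (norm x * C)\<^sup>2" by (simp add: power_mult_distrib mult.commute)
    qed (use C in simp)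
    then show ?thesis
      unfolding S_def by (intro LIMSEQ_le_const2[OF tendsto_norm[OF summable_LIMSEQ[OF sf]]]) blast
  qed
  moreover have "S (x + x') = S x + S x'" for x x'
    unfolding S_def suminf_add[OF sf sf]
    by (rule arg_cong[where f = suminf]) (auto simp: f_def cinner_simps scaleC_add_left)
  moreover have S_scaleC: "S (c *\<^sub>C x) = c *\<^sub>C S x" for c x
    unfolding S_def bounded_linear.suminf[OF bounded_linear_scaleC sf]
    by (rule arg_cong[where f = suminf]) (auto simp: f_def cinner_simps scaleC_scaleC)
  ultimately have bl: "bounded_linear S"
    by (intro bounded_linear_intro[of _ C]) (simp_all add: scaleR_eq_scaleC)
  show ?thesis
  proof (rule that[of "Blinfun S"])
    show "Blinfun S \<in> bounded_operators"
      using S_scaleC by (simp add: bounded_operators_iff bounded_linear_Blinfun_apply[OF bl])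
    fix j assume j: "enat j < \<omega>"
    have "f (\<xi> j) = (\<lambda>i. if i = j then y i else 0)"
      using j ortho by (auto simp: f_def)
    then have "S (\<xi> j) = y j" unfolding S_def using sums_unique[OF sums_single[of j y]] by simp
    then show "blinfun_apply (Blinfun S) (\<xi> j) = y j" by (simp add: bounded_linear_Blinfun_apply[OF bl])
  qed
qed

section \<open>Orthogonal projections onto the members of the flag\<close>

definition basis_proj :: "nat \<Rightarrow> 'a \<Rightarrow>\<^sub>L 'a"
  where "basis_proj j = Blinfun (\<lambda>x. cinner x (\<xi> j) *\<^sub>C \<xi> j)"

lemma basis_proj_apply: "basis_proj j x = cinner x (\<xi> j) *\<^sub>C \<xi> j"
proof -
  have "bounded_linear (\<lambda>v. cinner v (\<xi> j) *\<^sub>C \<xi> j)"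
    by (rule bounded_linear_intro[of _ "norm (\<xi> j) * norm (\<xi> j)"])
      (simp_all add: cinner_simps scaleC_add_left scaleR_eq_scaleC scaleC_scaleC norm_scaleC,
        metis cmod_cinner_le mult.assoc mult_right_mono norm_ge_zero)
  then show ?thesis by (simp add: basis_proj_def bounded_linear_Blinfun_apply)
qed

lemma basis_proj_bounded_operators [simp]: "basis_proj j \<in> bounded_operators"
  by (simp add: bounded_operators_iff basis_proj_apply cinner_simps scaleC_scaleC)

lemma adj_basis_proj: "adj (basis_proj j) = basis_proj j"
proof (rule adj_eqI)
  fix x y
  show "basis_proj j x \<bullet> y = x \<bullet> basis_proj j y"
    unfolding inner_eq_Re_cinner basis_proj_apply cinner_simps
    by (simp add: cinner_commute[of "\<xi> j" y] mult.commute)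
qed

definition flag_proj :: "nat \<Rightarrow> 'a \<Rightarrow>\<^sub>L 'a"
  where "flag_proj j = (\<Sum>l<j. basis_proj l)"

lemma flag_proj_apply: "flag_proj j x = (\<Sum>l<j. cinner x (\<xi> l) *\<^sub>C \<xi> l)"
  by (simp add: flag_proj_def blinfun.sum_left basis_proj_apply)

lemma flag_proj_bounded_operators [simp]: "flag_proj j \<in> bounded_operators"
  unfolding flag_proj_def by (intro subspace_sum[OF subspace_bounded_operators] basis_proj_bounded_operators)

lemma adj_flag_proj: "adj (flag_proj j) = flag_proj j"
  using bounded_linear.linear[OF bounded_linear_adj] linear_sum[of adj basis_proj "{..<j}"]
  by (simp add: flag_proj_def adj_basis_proj)

lemma flag_proj_in_flag: "flag_proj j x \<in> flag j"
  unfolding flag_proj_apply by (intro flag_sum flag_scale basis_in_flag) auto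

lemma flag_proj_fixed: "enat j \<le> \<omega> \<Longrightarrow> v \<in> flag j \<Longrightarrow> flag_proj j v = v"
  using flag_expansion[of j v] by (simp add: flag_proj_apply)

lemma flag_proj_idem: "enat j \<le> \<omega> \<Longrightarrow> flag_proj j (flag_proj j x) = flag_proj j x"
  by (simp add: flag_proj_fixed flag_proj_in_flag)

text \<open>\<open>u\<^sub>j = \<xi>\<^sub>j - v\<close> with \<open>v\<close> in the span of the preceding basis vectors chosen such that
  \<open>g u\<^sub>j\<close> is orthogonal to the image of that span (Gram-Schmidt); \<open>v\<close> solves the normal equations,
  whose operator \<open>P g\<^sup>* g P\<close> is completed by \<open>1 - P\<close> to an invertible one.\<close>

definition gram_op :: "('a \<Rightarrow>\<^sub>L 'a) \<Rightarrow> nat \<Rightarrow> ('a \<Rightarrow>\<^sub>L 'a)"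
  where "gram_op g j = (flag_proj j o\<^sub>L ((adj g o\<^sub>L g) o\<^sub>L flag_proj j)) + (id_blinfun - flag_proj j)"

definition gram_solution :: "('a \<Rightarrow>\<^sub>L 'a) \<Rightarrow> nat \<Rightarrow> ('a \<Rightarrow>\<^sub>L 'a)"
  where "gram_solution g j = op_inv (gram_op g j) o\<^sub>L (flag_proj j o\<^sub>L (adj g o\<^sub>L g))"

definition gram_vector :: "('a \<Rightarrow>\<^sub>L 'a) \<Rightarrow> nat \<Rightarrow> 'a"
  where "gram_vector g j = \<xi> j - gram_solution g j (\<xi> j)"

lemma invertible_gram_op:
  assumes g: "invertible_op g" and j: "enat j \<le> \<omega>"
  shows "invertible_op (gram_op g j)"
proof -
  \<comment> \<open>On the flag, \<open>g\<close> shrinks norms at most by the factor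
    \<open>1 / s\<close>; on the complement the operator acts as the identity. As
    \<open>s \<ge> 1\<close>, the constant \<open>1 / s^2\<close> serves both parts.\<close>
  define s where "s = norm (op_inv g) + 1"
  define c where "c = 1 / s\<^sup>2"
  have s: "s \<ge> 1" by (simp add: s_def)
  have c: "c > 0" "c \<le> 1" using s by (auto simp: c_def)
  have "gram_op g j x \<bullet> x \<ge> c * (norm x)\<^sup>2" for x
  proof -
    define p q where "p = flag_proj j x" and "q = x - p"
    have pq: "p \<bullet> q = 0"
    proof -
      have "p \<bullet> q = x \<bullet> (flag_proj j q)"
        unfolding p_def using inner_adj[of "flag_proj j" x q] by (simp add: adj_flag_proj)
      also have "flag_proj j q = 0"
        by (simp add: q_def p_def blinfun.bilinear_simps flag_proj_idem[OF j])
      finally show ?thesis by simp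
    qed
    have x: "x = p + q" by (simp add: q_def)
    have "gram_op g j x \<bullet> x = flag_proj j (adj g (g p)) \<bullet> x + q \<bullet> x"
      by (simp add: gram_op_def blinfun.bilinear_simps p_def q_def inner_add_left)
    also have "flag_proj j (adj g (g p)) \<bullet> x = adj g (g p) \<bullet> p"
      using inner_adj[of "flag_proj j" "adj g (g p)" x] by (simp add: adj_flag_proj p_def)
    also have "\<dots> = (norm (g p))\<^sup>2" by (simp add: inner_adj_left power2_norm_eq_inner)
    also have "q \<bullet> x = (norm q)\<^sup>2"
      using pq by (simp add: x inner_add_right inner_commute power2_norm_eq_inner)
    finally have e: "gram_op g j x \<bullet> x = (norm (g p))\<^sup>2 + (norm q)\<^sup>2" .
    have "norm p \<le> norm (op_inv g) * norm (g p)"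
      using norm_blinfun[of "op_inv g" "g p"] by (simp add: op_inv_apply[OF g])
    also have "\<dots> \<le> s * norm (g p)" by (intro mult_right_mono) (auto simp: s_def)
    finally have "(norm p)\<^sup>2 \<le> (s * norm (g p))\<^sup>2" by (intro power_mono) auto
    then have "c * (norm p)\<^sup>2 \<le> c * (s * norm (g p))\<^sup>2" using c by (intro mult_left_mono) auto
    also have "\<dots> = (norm (g p))\<^sup>2" using s by (simp add: c_def power_mult_distrib)
    finally have 1: "c * (norm p)\<^sup>2 \<le> (norm (g p))\<^sup>2" .
    have 2: "c * (norm q)\<^sup>2 \<le> 1 * (norm q)\<^sup>2" using c by (intro mult_right_mono) auto
    have "(norm x)\<^sup>2 = (norm p)\<^sup>2 + (norm q)\<^sup>2"
      using norm_add_Pythagorean[of p q] pq by (simp add: orthogonal_def x)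
    then show ?thesis using 1 2 e by (simp add: algebra_simps)
  qed
  then show ?thesis using invertible_op_coercive c by blast
qed

text \<open>Applying the projection \<open>P\<close> to the equation for \<open>v\<close> removes
  the completing part \<open>1 - P\<close> and leaves the normal equations for \<open>P v\<close>.
  Comparison with the equation itself gives \<open>v = P v\<close>.\<close>

lemma gram_solution_in_flag:
  assumes g: "invertible_op g" and j: "enat j \<le> \<omega>"
  shows "gram_solution g j x \<in> flag j"
    and "flag_proj j (adj g (g (gram_solution g j x))) = flag_proj j (adj g (g x))"
proof -
  define v where "v = gram_solution g j x"
  have e: "gram_op g j v = flag_proj j (adj g (g x))"
    by (simp add: v_def gram_solution_def op_inv_apply[OF invertible_gram_op[OF assms]])
  have "flag_proj j (gram_op g j v) = flag_proj j (adj g (g (flag_proj j v)))"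
    by (simp add: gram_op_def blinfun.bilinear_simps flag_proj_idem[OF j])
  then have 1: "flag_proj j (adj g (g (flag_proj j v))) = flag_proj j (adj g (g x))"
    by (simp add: e flag_proj_idem[OF j])
  have "gram_op g j v = flag_proj j (adj g (g (flag_proj j v))) + (v - flag_proj j v)"
    by (simp add: gram_op_def blinfun.bilinear_simps)
  then have v: "v = flag_proj j v" using e 1 by simp
  then show "gram_solution g j x \<in> flag j" unfolding v_def[symmetric] using flag_proj_in_flag[of j v] by simp
  show "flag_proj j (adj g (g (gram_solution g j x))) = flag_proj j (adj g (g x))"
    using 1 v unfolding v_def[symmetric] by simp
qed

lemma gram_vector_flag:
  assumes g: "invertible_op g" and j: "enat j < \<omega>"
  shows "\<xi> j - gram_vector g j \<in> flag j" "gram_vector g j - \<xi> j \<in> flag j"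
  using gram_solution_in_flag(1)[OF g less_imp_le[OF j], of "\<xi> j"] flag_neg by (auto simp: gram_vector_def)

lemma gram_vector_orthogonal:
  assumes g: "g \<in> bounded_operators" "invertible_op g" and j: "enat j < \<omega>" and v: "v \<in> flag j"
  shows "cinner (g (gram_vector g j)) (g v) = 0"
proof -
  have j': "enat j \<le> \<omega>" using j by simp
  have z: "flag_proj j (adj g (g (gram_vector g j))) = 0"
    using gram_solution_in_flag(2)[OF g(2) j'] by (simp add: gram_vector_def blinfun.bilinear_simps)
  have "cinner (g (gram_vector g j)) (g v) = cnj (cinner (g v) (g (gram_vector g j)))" by (rule cinner_commute)
  also have "cinner (g v) (g (gram_vector g j)) = cinner (flag_proj j v) (adj g (g (gram_vector g j)))"
    by (simp add: cinner_adj[OF g(1)] flag_proj_fixed[OF j' v])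
  also have "\<dots> = cinner v (flag_proj j (adj g (g (gram_vector g j))))"
    by (simp add: cinner_adj adj_flag_proj)
  finally show ?thesis by (simp add: z)
qed

lemma gram_vector_coefficient:
  assumes g: "invertible_op g" and j: "enat j < \<omega>"
  shows "cinner (gram_vector g j) (\<xi> j) = 1"
  using flag_coefficient_zero[OF gram_vector_flag(2)[OF assms] order_refl j] ortho[OF j j]
  by (simp add: cinner_simps)

text \<open>For the upper bound, \<open>g (\<xi> j)\<close> is the sum of \<open>g u\<close> and an
  orthogonal vector. For the lower one, \<open>u\<close> has coefficient 1 at
  \<open>\<xi> j\<close>, so \<open>norm u \<ge> 1\<close>, and \<open>op_inv g\<close> recovers
  \<open>u\<close>. Uniformity in \<open>j\<close> makes the diagonal factor and its inverse
  bounded.\<close>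

lemma norm_gram_vector:
  assumes g: "g \<in> bounded_operators" "invertible_op g" and j: "enat j < \<omega>"
  shows "norm (g (gram_vector g j)) \<le> norm g" "1 \<le> norm (op_inv g) * norm (g (gram_vector g j))"
proof -
  let ?u = "gram_vector g j" and ?v = "\<xi> j - gram_vector g j"
  have "orthogonal (g ?u) (g ?v)"
    using gram_vector_orthogonal[OF g j gram_vector_flag(1)[OF g(2) j]] by (simp add: orthogonal_def inner_eq_Re_cinner)
  from norm_add_Pythagorean[OF this] have "(norm (g ?u))\<^sup>2 \<le> (norm (g (\<xi> j)))\<^sup>2"
    by (simp add: blinfun.bilinear_simps)
  then have "norm (g ?u) \<le> norm (g (\<xi> j))" by (rule power2_le_imp_le) simp
  also have "\<dots> \<le> norm g" using norm_blinfun[of g "\<xi> j"] j by simp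
  finally show "norm (g ?u) \<le> norm g" .
  have "1 \<le> norm ?u" using cmod_cinner_le[of ?u "\<xi> j"] gram_vector_coefficient[OF g(2) j] j by simp
  also have "\<dots> = norm (op_inv g (g ?u))" by (simp add: op_inv_apply[OF g(2)])
  also have "\<dots> \<le> norm (op_inv g) * norm (g ?u)" by (rule norm_blinfun)
  finally show "1 \<le> norm (op_inv g) * norm (g ?u)" .
qed

lemma diagonal_operator:
  fixes r :: "nat \<Rightarrow> real"
  assumes "\<And>j. enat j < \<omega> \<Longrightarrow> 0 < r j \<and> r j \<le> C \<and> 1 \<le> C' * r j"
  obtains a where "a \<in> A_group \<omega> \<xi>" "\<And>j. enat j < \<omega> \<Longrightarrow> blinfun_apply a (\<xi> j) = r j *\<^sub>R \<xi> j"
proof -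
  obtain a where a: "a \<in> bounded_operators" "\<And>j. enat j < \<omega> \<Longrightarrow> blinfun_apply a (\<xi> j) = r j *\<^sub>R \<xi> j"
  proof (rule operator_with_orthogonal_images[of "max C 0" "\<lambda>j. r j *\<^sub>R \<xi> j"])
    show "norm (r j *\<^sub>R \<xi> j) \<le> max C 0" if "enat j < \<omega>" for j using assms[OF that] that by simp
  qed (auto simp: cinner_simps ortho)
  obtain b where b: "b \<in> bounded_operators" "\<And>j. enat j < \<omega> \<Longrightarrow> blinfun_apply b (\<xi> j) = (1 / r j) *\<^sub>R \<xi> j"
  proof (rule operator_with_orthogonal_images[of "max C' 0" "\<lambda>j. (1 / r j) *\<^sub>R \<xi> j"])
    show "norm ((1 / r j) *\<^sub>R \<xi> j) \<le> max C' 0" if "enat j < \<omega>" for j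
      using assms[OF that] that by (simp add: pos_divide_le_eq le_max_iff_disj)
  qed (auto simp: cinner_simps ortho)
  have r0: "r j \<noteq> 0" if "enat j < \<omega>" for j using assms[OF that] by simp
  have "a o\<^sub>L b = id_blinfun" "b o\<^sub>L a = id_blinfun"
    using r0 by (auto intro!: operator_eqI simp: a b blinfun.bilinear_simps)
  then have "invertible_op a" using op_inv_eqI by blast
  then have "a \<in> A_group \<omega> \<xi>" using a assms by (auto simp: A_group_iff)
  then show ?thesis using that a by blast
qed

text \<open>The columns of \<open>n\<close> are not orthogonal and do not define it as an operator.
  Instead \<open>k\<close> and \<open>a\<close> come from the orthogonal system
  \<open>g (u j)\<close> and its norms; the product \<open>m\<close> of \<open>op_inv g\<close>,
  \<open>k\<close> and \<open>a\<close>, bounded by construction, maps \<open>\<xi> j\<close> to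
  \<open>u j\<close>, and \<open>n\<close> is its inverse. The last conclusion feeds the explicit
  formulas in finite dimension.\<close>

lemma iwasawa_exists:
  assumes g: "g \<in> bounded_operators" "invertible_op g"
  obtains k a n where "k \<in> K_group" "a \<in> A_group \<omega> \<xi>" "n \<in> N_group \<omega> \<xi>" "g = k o\<^sub>L a o\<^sub>L n"
    "\<And>j. enat j < \<omega> \<Longrightarrow> op_inv n (\<xi> j) = gram_vector g j"
proof -
  define u r where "u = gram_vector g" and "r = (\<lambda>j. norm (g (u j)))"
  have r: "0 < r j \<and> r j \<le> norm g \<and> 1 \<le> norm (op_inv g) * r j" if "enat j < \<omega>" for j
    using norm_gram_vector[OF g that] unfolding r_def u_def
    by (metis mult_zero_right norm_ge_zero not_one_le_zero order_le_less)
  have uflag: "u l \<in> flag j" if "l < j" "enat l < \<omega>" for l j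
  proof -
    have "u l - \<xi> l \<in> flag j"
      using gram_vector_flag(2)[OF g(2) that(2)] that(1) flag_mono less_imp_le unfolding u_def by blast
    from flag_add[OF this basis_in_flag[OF that(1)]] show ?thesis by simp
  qed
  have orth: "cinner (g (u i)) (g (u j)) = 0" if "enat i < \<omega>" "enat j < \<omega>" "i \<noteq> j" for i j
  proof (cases "j < i")
    case True
    then show ?thesis using gram_vector_orthogonal[OF g that(1) uflag[OF True that(2)]] by (simp add: u_def)
  next
    case False
    then have "i < j" using that by simp
    then have "cinner (g (u j)) (g (u i)) = 0"
      using gram_vector_orthogonal[OF g that(2) uflag[OF _ that(1)]] by (simp add: u_def)
    then show ?thesis by (metis cinner_commute complex_cnj_zero)
  qed
  obtain k where k: "k \<in> bounded_operators" "\<And>j. enat j < \<omega> \<Longrightarrow> blinfun_apply k (\<xi> j) = (1 / r j) *\<^sub>R g (u j)"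
  proof (rule operator_with_orthogonal_images[of 1 "\<lambda>j. (1 / r j) *\<^sub>R g (u j)"])
    show "norm ((1 / r j) *\<^sub>R g (u j)) \<le> 1" for j by (simp add: r_def)
  qed (auto simp: cinner_simps orth)
  have kk: "cinner (k (\<xi> i)) (k (\<xi> j)) = cinner (\<xi> i) (\<xi> j)" if "enat i < \<omega>" "enat j < \<omega>" for i j
  proof (cases "i = j")
    case True
    have "norm (k (\<xi> j)) = 1" using r[OF that(2)] by (simp add: k that r_def)
    then show ?thesis using True that by (simp add: cinner_self)
  next
    case False
    then show ?thesis using that by (simp add: k cinner_simps orth ortho)
  qed
  have k1: "adj k o\<^sub>L k = id_blinfun"
  proof (rule operator_eqI)
    fix j assume j: "enat j < \<omega>"
    have "adj k (k (\<xi> j)) - \<xi> j = 0"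
      by (rule basis_separates) (simp add: cinner_simps cinner_adj[OF k(1), symmetric] kk j)
    then show "(adj k o\<^sub>L k) (\<xi> j) = id_blinfun (\<xi> j)" by simp
  qed (use k in simp_all)
  \<comment> \<open>This is for surjectivity of \<open>k\<close>: a vector orthogonal to all
    \<open>g (u j)\<close> is inductively orthogonal to all \<open>g (\<xi> j)\<close>, because
    \<open>\<xi> j - u j\<close> lies in the flag. So \<open>adj g\<close> annihilates it, and
    \<open>adj g\<close> is injective.\<close>
  have adjk_inj: "x = 0" if x: "adj k x = 0" for x
  proof -
    have gu: "cinner (g (u j)) x = 0" if j: "enat j < \<omega>" for j
    proof -
      have "cinner (k (\<xi> j)) x = 0" by (simp add: cinner_adj[OF k(1)] x)
      then show ?thesis using r[OF j] by (simp add: k j cinner_simps)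
    qed
    have "cinner (\<xi> j) (adj g x) = 0" if "enat j < \<omega>" for j
      using that
    proof (induction j rule: less_induct)
      case (less j)
      have sub: "complex_vector.subspace {v. cinner v (adj g x) = 0}"
        by (auto simp: complex_vector.subspace_def cinner_simps)
      have "cinner (\<xi> l) (adj g x) = 0" if "l < j" for l
        using less.IH[OF that] index_trans[OF less_imp_le[OF that] less.prems] by blast
      then have "cinner (\<xi> j - u j) (adj g x) = 0"
        using flag_minimal[OF sub _ gram_vector_flag(1)[OF g(2) less.prems]] by (simp add: u_def)
      moreover have "cinner (u j) (adj g x) = 0" using gu[OF less.prems] by (simp add: cinner_adj[OF g(1)])
      ultimately show ?case by (simp add: cinner_simps)
    qed
    then have "adj g x = 0" by (rule basis_separates)
    then show ?thesis using op_inv_apply(1)[OF invertible_op_adj(1)[OF g(2)], of x] by (simp add: blinfun.bilinear_simps)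
  qed
  have "k o\<^sub>L adj k = id_blinfun"
  proof (rule blinfun_eqI)
    fix x
    have "adj k (k (adj k x)) = adj k x" using arg_cong[OF k1, of "\<lambda>T. blinfun_apply T (adj k x)"] by simp
    from this have "adj k (k (adj k x) - x) = 0" by (simp add: blinfun.bilinear_simps)
    then have "k (adj k x) - x = 0" by (rule adjk_inj)
    then show "(k o\<^sub>L adj k) x = id_blinfun x" by simp
  qed
  then have K: "k \<in> K_group" using k k1 by (simp add: K_group_iff)
  obtain a where a: "a \<in> A_group \<omega> \<xi>" "\<And>j. enat j < \<omega> \<Longrightarrow> blinfun_apply a (\<xi> j) = r j *\<^sub>R \<xi> j"
    using diagonal_operator[of r "norm g" "norm (op_inv g)"] r by blast
  have a': "a \<in> bounded_operators" "invertible_op a" using a(1) by (auto simp: A_group_iff)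
  note k' = K_groupD[OF K]
  define m where "m = op_inv g o\<^sub>L (k o\<^sub>L a)"
  have m: "m \<in> bounded_operators" "invertible_op m"
    using g k' a' by (auto simp: m_def invertible_op_compose invertible_op_inv)
  have mu: "m (\<xi> j) = u j" if "enat j < \<omega>" for j
    using r[OF that] that by (simp add: m_def a k blinfun.bilinear_simps op_inv_apply[OF g(2)])
  have "m \<in> N_group \<omega> \<xi>"
    using m mu gram_vector_flag(2)[OF g(2)] by (simp add: N_group_iff u_def)
  then have n: "op_inv m \<in> N_group \<omega> \<xi>" by (rule N_group_inverse)
  have "g o\<^sub>L m = k o\<^sub>L a" by (rule blinfun_eqI) (simp add: m_def op_inv_apply[OF g(2)])
  then have "g = k o\<^sub>L a o\<^sub>L op_inv m" by (metis blinfun_compose_assoc blinfun_compose_id(1) op_inv(2)[OF m(2)])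
  then show ?thesis using that[OF K a(1) n] mu by (simp add: invertible_op_inv[OF m(2)] u_def)
qed

text \<open>The earlier basis vectors are already fixed, so isometry makes
  \<open>q (\<xi> j)\<close> orthogonal to them and only the diagonal entry survives. That entry is
  positive and of modulus 1.\<close>

lemma unitary_triangular_id:
  assumes q: "q \<in> K_group" and t: "\<And>j. enat j < \<omega> \<Longrightarrow> \<exists>\<rho>::real. \<rho> > 0 \<and> q (\<xi> j) - \<rho> *\<^sub>R \<xi> j \<in> flag j"
  shows "q = id_blinfun"
proof (rule operator_eqI)
  have iso: "cinner (q x) (q y) = cinner x y" for x y
    using K_groupD[OF q] by (metis blinfun_apply_blinfun_compose blinfun_apply_id_blinfun cinner_adj id_apply)
  fix j assume "enat j < \<omega>"
  then have "q (\<xi> j) = \<xi> j"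
  proof (induction j rule: less_induct)
    case (less j)
    obtain \<rho> :: real where \<rho>: "\<rho> > 0" "q (\<xi> j) - \<rho> *\<^sub>R \<xi> j \<in> flag j" using t[OF less.prems] by blast
    define v where "v = q (\<xi> j) - \<rho> *\<^sub>R \<xi> j"
    have "cinner v (\<xi> l) = 0" if l: "l < j" for l
    proof -
      have l': "enat l < \<omega>" by (rule index_trans[OF less_imp_le[OF l] less.prems])
      have "cinner (q (\<xi> j)) (\<xi> l) = cinner (q (\<xi> j)) (q (\<xi> l))" using less.IH[OF l l'] by simp
      also have "\<dots> = 0" using iso ortho[OF less.prems l'] l by simp
      finally show ?thesis using ortho[OF less.prems l'] l by (simp add: v_def cinner_simps)
    qed
    then have "v = 0" using flag_expansion[of j v] \<rho>(2) less.prems by (simp add: v_def less_imp_le)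
    then have e: "q (\<xi> j) = \<rho> *\<^sub>R \<xi> j" by (simp add: v_def)
    have "cinner (q (\<xi> j)) (q (\<xi> j)) = 1" using iso ortho[OF less.prems less.prems] by simp
    then have "complex_of_real ((norm (q (\<xi> j)))\<^sup>2) = of_real 1" by (simp only: cinner_self of_real_1)
    then have "(norm (q (\<xi> j)))\<^sup>2 = 1" by (simp only: of_real_eq_iff)
    then have "norm (q (\<xi> j)) = 1" using norm_ge_zero[of "q (\<xi> j)"] by (simp add: power2_eq_1_iff)
    then have "\<rho> = 1" using e \<rho>(1) less.prems by simp
    then show ?case using e by simp
  qed
  then show "q (\<xi> j) = id_blinfun (\<xi> j)" by simp
qed (use K_groupD[OF q] in auto)

text \<open>The unitary operator \<open>q\<close> formed from \<open>adj k'\<close> and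
  \<open>k\<close> equals \<open>a' n' n^-1 a^-1\<close>, which is triangular with positive
  diagonal; so it is the identity. Comparing diagonal entries then separates \<open>a\<close> from
  \<open>n\<close>.\<close>

lemma iwasawa_unique:
  assumes k: "k \<in> K_group" "k' \<in> K_group" and a: "a \<in> A_group \<omega> \<xi>" "a' \<in> A_group \<omega> \<xi>"
    and n: "n \<in> N_group \<omega> \<xi>" "n' \<in> N_group \<omega> \<xi>" and e: "k o\<^sub>L a o\<^sub>L n = k' o\<^sub>L a' o\<^sub>L n'"
  shows "k = k'" "a = a'" "n = n'"
proof -
  have ia: "invertible_op a" "invertible_op a'" "a \<in> bounded_operators" "a' \<in> bounded_operators" 
    using a by (auto simp: A_group_iff)
  have inn: "invertible_op n" "invertible_op n'" using n by (auto simp: N_group_iff)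
  define s where "s = n' o\<^sub>L op_inv n"
  have s: "s \<in> N_group \<omega> \<xi>" unfolding s_def by (intro N_group_compose N_group_inverse n)
  define q where "q = adj k' o\<^sub>L k"
  have kk: "adj k' (k' x) = x" "k' (adj k' x) = x" for x
    using K_groupD[OF k(2)] by (metis blinfun_apply_blinfun_compose blinfun_apply_id_blinfun id_apply)+
  have e': "k (a (n x)) = k' (a' (n' x))" for x
    using e by (metis blinfun_apply_blinfun_compose)
  have qe: "q x = a' (s (op_inv a x))" for x
    using e'[of "op_inv n (op_inv a x)"]
    by (simp add: q_def s_def op_inv_apply ia inn kk)
  have "q = id_blinfun"
  proof (rule unitary_triangular_id)
    show "q \<in> K_group" unfolding q_def by (intro K_group_compose K_group_adj k)
    fix j assume j: "enat j < \<omega>"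
    have ainv: "op_inv a \<in> A_group \<omega> \<xi>"
      using subgroup.m_inv_closed[OF subgroup_A a(1)] inv_GL[of a] subgroup.mem_carrier[OF subgroup_A a(1)] by simp
    obtain r r' :: real where r: "r > 0" "op_inv a (\<xi> j) = r *\<^sub>R \<xi> j" "r' > 0" "a' (\<xi> j) = r' *\<^sub>R \<xi> j"
      using ainv a(2) j by (metis A_group_iff)
    define v where "v = s (\<xi> j) - \<xi> j"
    have "v \<in> flag j" using s j by (simp add: v_def N_group_iff)
    then have "a' v \<in> flag j"
      using a_algebra_flag a(2) A_group_subset less_imp_le[OF j] by blast
    moreover have "q (\<xi> j) - (r * r') *\<^sub>R \<xi> j = r *\<^sub>R a' v"
      by (simp add: qe r v_def blinfun.bilinear_simps scaleR_diff_right)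
    ultimately show "\<exists>\<rho>>0. q (\<xi> j) - \<rho> *\<^sub>R \<xi> j \<in> flag j"
      using r flag_scaleR by (intro exI[of _ "r * r'"]) simp
  qed
  then show keq: "k = k'" unfolding q_def
    by (metis K_groupD(5)[OF k(2)] blinfun_compose_assoc blinfun_compose_id)
  have an: "a (n x) = a' (n' x)" for x
    using e'[of x] kk(1) unfolding keq by metis
  show "a = a'"
  proof (rule operator_eqI[OF ia(3,4)])
    fix j assume j: "enat j < \<omega>"
    obtain r r' :: real where r: "a (\<xi> j) = r *\<^sub>R \<xi> j" "a' (\<xi> j) = r' *\<^sub>R \<xi> j"
      using a j by (metis A_group_iff)
    define v where "v = s (\<xi> j) - \<xi> j"
    have "v \<in> flag j" using s j by (simp add: v_def N_group_iff)
    then have v: "a' v \<in> flag j"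
      using a_algebra_flag a(2) A_group_subset less_imp_le[OF j] by blast
    have "r *\<^sub>R \<xi> j = a' (s (\<xi> j))"
      using an[of "op_inv n (\<xi> j)"] by (simp add: s_def op_inv_apply inn r)
    also have "\<dots> = r' *\<^sub>R \<xi> j + a' v" by (simp add: v_def blinfun.bilinear_simps r)
    finally have "cinner (r *\<^sub>R \<xi> j) (\<xi> j) = cinner (r' *\<^sub>R \<xi> j + a' v) (\<xi> j)" by simp
    then have "r = r'"
      using flag_coefficient_zero[OF v order_refl j] ortho[OF j j] by (simp add: cinner_simps)
    then show "a (\<xi> j) = a' (\<xi> j)" using r by simp
  qed
  then have "n x = n' x" for x using an[of x] op_inv_apply(1)[OF ia(2)] by metis
  then show "n = n'" by (rule blinfun_eqI)
qed

lemma iwasawa_mult_GL: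
  assumes "k \<in> K_group" "a \<in> A_group \<omega> \<xi>" "n \<in> N_group \<omega> \<xi>"
  shows "iwasawa_mult (k, a, n) \<in> carrier GL"
  using assms K_groupD[OF assms(1)]
  by (auto simp: iwasawa_mult_def carrier_GL A_group_iff N_group_iff invertible_op_compose)

lemma bij_betw_iwasawa:
  "bij_betw iwasawa_mult (K_group \<times> A_group \<omega> \<xi> \<times> N_group \<omega> \<xi>) (carrier GL)"
  unfolding bij_betw_def
proof (intro conjI inj_onI equalityI subsetI)
  fix x y assume xy: "x \<in> K_group \<times> A_group \<omega> \<xi> \<times> N_group \<omega> \<xi>" "y \<in> K_group \<times> A_group \<omega> \<xi> \<times> N_group \<omega> \<xi>"
    and e: "iwasawa_mult x = iwasawa_mult y"
  obtain k a n where x: "x = (k, a, n)" by (cases x) auto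
  obtain k' a' n' where y: "y = (k', a', n')" by (cases y) auto
  show "x = y"
    using iwasawa_unique[of k k' a a' n n'] xy e unfolding x y iwasawa_mult_def by auto
next
  fix g assume "g \<in> iwasawa_mult ` (K_group \<times> A_group \<omega> \<xi> \<times> N_group \<omega> \<xi>)"
  then show "g \<in> carrier GL" using iwasawa_mult_GL by auto
next
  fix g :: "'a \<Rightarrow>\<^sub>L 'a" assume "g \<in> carrier GL"
  then have "g \<in> bounded_operators" "invertible_op g" by (auto simp: carrier_GL)
  then obtain k a n where "k \<in> K_group" "a \<in> A_group \<omega> \<xi>" "n \<in> N_group \<omega> \<xi>" "g = k o\<^sub>L a o\<^sub>L n"
    using iwasawa_exists by metis
  then show "g \<in> iwasawa_mult ` (K_group \<times> A_group \<omega> \<xi> \<times> N_group \<omega> \<xi>)"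
    by (intro image_eqI[of _ _ "(k, a, n)"]) (auto simp: iwasawa_mult_def)
qed

section \<open>The multiplication map in charts\<close>

abbreviation KAN_manifold ::
    "(('a \<Rightarrow>\<^sub>L 'a) \<times> ('a \<Rightarrow>\<^sub>L 'a) \<times> ('a \<Rightarrow>\<^sub>L 'a), ('a \<Rightarrow>\<^sub>L 'a) \<times> ('a \<Rightarrow>\<^sub>L 'a) \<times> ('a \<Rightarrow>\<^sub>L 'a)) manifold"
  where "KAN_manifold \<equiv> prod_manifold K_manifold (prod_manifold A_manifold N_manifold)"

abbreviation GL_manifold :: "('a \<Rightarrow>\<^sub>L 'a, 'a \<Rightarrow>\<^sub>L 'a) manifold"
  where "GL_manifold \<equiv> open_submanifold bounded_operators (carrier GL)"

lemma A_manifold_simps [simp]: "points A_manifold = A_group \<omega> \<xi>" "model_space A_manifold = a_algebra \<omega> \<xi>"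
  "charts A_manifold = {(A_group \<omega> \<xi>, \<lambda>x. x - 0)}"
  by (simp_all add: A_manifold_def)

lemma N_manifold_simps [simp]: "points N_manifold = N_group \<omega> \<xi>" "model_space N_manifold = n_algebra \<omega> \<xi>"
  "charts N_manifold = {(N_group \<omega> \<xi>, \<lambda>x. x - id_blinfun)}"
  by (simp_all add: N_manifold_def)

lemma K_manifold_simps [simp]: "points K_manifold = K_group" "model_space K_manifold = k_algebra"
  by (simp_all add: K_manifold_def)

lemma charts_K: "(U, \<phi>) \<in> charts K_manifold \<longleftrightarrow> (\<exists>k\<in>K_group. U = K_domain k \<and> \<phi> = (\<lambda>u. cay (adj k o\<^sub>L u)))"
  by (auto simp: K_manifold_def)

definition KAN_chart :: "('a \<Rightarrow>\<^sub>L 'a) \<Rightarrow> ('a \<Rightarrow>\<^sub>L 'a) \<times> ('a \<Rightarrow>\<^sub>L 'a) \<times> ('a \<Rightarrow>\<^sub>L 'a) \<Rightarrow> ('a \<Rightarrow>\<^sub>L 'a) \<times> ('a \<Rightarrow>\<^sub>L 'a) \<times> ('a \<Rightarrow>\<^sub>L 'a)"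
  where "KAN_chart k = map_prod (\<lambda>u. cay (adj k o\<^sub>L u)) (map_prod (\<lambda>x. x - 0) (\<lambda>x. x - id_blinfun))"

definition KAN_domain :: "('a \<Rightarrow>\<^sub>L 'a) \<Rightarrow> (('a \<Rightarrow>\<^sub>L 'a) \<times> ('a \<Rightarrow>\<^sub>L 'a) \<times> ('a \<Rightarrow>\<^sub>L 'a)) set"
  where "KAN_domain k = K_domain k \<times> A_group \<omega> \<xi> \<times> N_group \<omega> \<xi>"

lemma charts_KAN: "(U, \<phi>) \<in> charts KAN_manifold \<longleftrightarrow> (\<exists>k\<in>K_group. U = KAN_domain k \<and> \<phi> = KAN_chart k)"
  unfolding charts_prod_manifold charts_K by (auto simp: KAN_chart_def KAN_domain_def)

lemma KAN_chart_image:
  assumes "k \<in> K_group"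
  shows "KAN_chart k ` KAN_domain k = k_algebra \<times> A_group \<omega> \<xi> \<times> (\<lambda>x. x - id_blinfun) ` N_group \<omega> \<xi>"
  by (simp add: KAN_chart_def KAN_domain_def map_prod_image_Times K_chart_image[OF assms])

lemma openin_KAN:
  "openin (top_of_set (k_algebra \<times> a_algebra \<omega> \<xi> \<times> n_algebra \<omega> \<xi>))
     (k_algebra \<times> A_group \<omega> \<xi> \<times> (\<lambda>x. x - id_blinfun) ` N_group \<omega> \<xi>)"
  by (intro openin_Times openin_A openin_N) auto

lemma subspace_KAN: "subspace (k_algebra \<times> a_algebra \<omega> \<xi> \<times> n_algebra \<omega> \<xi>)"
  by (intro subspace_Times subspace_k subspace_a subspace_n)

text \<open>The multiplication map in the coordinates of the chart at \<open>k\<close>. As a formula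
  on all triples of operators it can be differentiated in the full product space, not only along the
  model space.\<close>

definition KAN_param :: "('a \<Rightarrow>\<^sub>L 'a) \<Rightarrow> ('a \<Rightarrow>\<^sub>L 'a) \<times> ('a \<Rightarrow>\<^sub>L 'a) \<times> ('a \<Rightarrow>\<^sub>L 'a) \<Rightarrow> ('a \<Rightarrow>\<^sub>L 'a)"
  where "KAN_param k x = ((k o\<^sub>L cay (fst x)) o\<^sub>L fst (snd x)) o\<^sub>L (snd (snd x) + id_blinfun)"

lemma KAN_param_chart:
  assumes "k \<in> K_group" "x \<in> KAN_domain k"
  shows "KAN_param k (KAN_chart k x) = iwasawa_mult x"
  using assms by (cases x) (auto simp: KAN_param_def KAN_chart_def KAN_domain_def iwasawa_mult_def K_chart_inverse)

lemma smooth_iwasawa_mult: "smooth_map KAN_manifold GL_manifold iwasawa_mult"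
  unfolding affine_manifold_0[symmetric]
proof (rule smooth_map_affine_target)
  show "subspace (model_space KAN_manifold)" using subspace_KAN by simp
  show "iwasawa_mult ` points KAN_manifold \<subseteq> carrier GL" using iwasawa_mult_GL by auto
  show "continuous_on (points KAN_manifold) iwasawa_mult"
    unfolding iwasawa_mult_def case_prod_unfold by (intro continuous_intros)
  fix U \<phi> assume "(U, \<phi>) \<in> charts KAN_manifold"
  then obtain k where k: "k \<in> K_group" "U = KAN_domain k" "\<phi> = KAN_chart k" unfolding charts_KAN by blast
  let ?E = "k_algebra \<times> a_algebra \<omega> \<xi> \<times> n_algebra \<omega> \<xi>"
  have sn: "smooth_on ?E (\<phi> ` U) snd" and sf: "smooth_on ?E (\<phi> ` U) fst"
    using openin_KAN subspace_KAN unfolding k(2,3) KAN_chart_image[OF k(1)]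
    by (auto intro!: smooth_on_bounded_linear bounded_linear_fst bounded_linear_snd)
  have "smooth_on ?E (\<phi> ` U) (KAN_param k)"
    unfolding KAN_param_def
    using smooth_on_linear_image[OF bounded_linear_fst sn] smooth_on_linear_image[OF bounded_linear_snd sn]
    by (intro smooth_on_compose smooth_on_translate smooth_on_K_chart_inverse[OF _ sf] subspace_KAN)
      (auto simp: k KAN_chart_image)
  let ?\<psi> = "map_prod (\<lambda>X. k o\<^sub>L cay X) (map_prod (\<lambda>x. x) (\<lambda>x. x + id_blinfun))"
  have "smooth_on ?E (\<phi> ` U) (\<lambda>x. iwasawa_mult (?\<psi> x))"
    by (rule smooth_on_cong[OF \<open>smooth_on ?E (\<phi> ` U) (KAN_param k)\<close>])
      (simp add: KAN_param_def iwasawa_mult_def case_prod_unfold)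
  moreover have "\<forall>x\<in>U. ?\<psi> (\<phi> x) = x"
    using k K_chart_inverse by (auto simp: KAN_chart_def KAN_domain_def)
  moreover have "U \<subseteq> points KAN_manifold" by (auto simp: k KAN_domain_def K_domain_def)
  ultimately show "U \<subseteq> points KAN_manifold \<and> (\<exists>\<psi>. (\<forall>x\<in>U. \<psi> (\<phi> x) = x) \<and>
      smooth_on (model_space KAN_manifold) (\<phi> ` U) (\<lambda>x. iwasawa_mult (\<psi> x)))"
    by (intro conjI exI[of _ ?\<psi>]) auto
qed

lemma iwasawa_decomposition:
  assumes "g \<in> carrier GL"
  shows "\<exists>k a n. k \<in> K_group \<and> a \<in> A_group \<omega> \<xi> \<and> n \<in> N_group \<omega> \<xi> \<and> g = k o\<^sub>L a o\<^sub>L n"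
proof -
  have "g \<in> bounded_operators" "invertible_op g" using assms by (auto simp: carrier_GL)
  then obtain k a n where "k \<in> K_group" "a \<in> A_group \<omega> \<xi>" "n \<in> N_group \<omega> \<xi>" "g = k o\<^sub>L a o\<^sub>L n"
    using iwasawa_exists by metis
  then show ?thesis by blast
qed

section \<open>Finite dimension\<close>

lemma finite_dimensional_iff: "finite_dimensional TYPE('a) \<longleftrightarrow> \<omega> \<noteq> \<infinity>"
proof
  assume "finite_dimensional TYPE('a)"
  then obtain B :: "'a set" where B: "finite B" "cspan B = UNIV" unfolding finite_dimensional_def by blast
  show "\<omega> \<noteq> \<infinity>"
  proof
    assume \<omega>: "\<omega> = \<infinity>"
    have nspan: "\<xi> j \<notin> cspan (range \<xi> - {\<xi> j})" for j
    proof
      assume *: "\<xi> j \<in> cspan (range \<xi> - {\<xi> j})"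
      have "complex_vector.subspace {v. cinner v (\<xi> j) = 0}"
        by (auto simp: complex_vector.subspace_def cinner_simps)
      moreover have "range \<xi> - {\<xi> j} \<subseteq> {v. cinner v (\<xi> j) = 0}" using ortho \<omega> by auto
      ultimately have "\<xi> j \<in> {v. cinner v (\<xi> j) = 0}" using * complex_vector.span_minimal by blast
      then show False using ortho[of j j] \<omega> by simp
    qed
    then have "complex_vector.independent (range \<xi>)" unfolding complex_vector.dependent_def by blast
    then have "finite (range \<xi>)" using complex_vector.independent_span_bound[OF B(1)] B(2) by blast
    moreover have "inj \<xi>"
    proof (rule injI)
      fix i j assume "\<xi> i = \<xi> j"
      then show "i = j" using ortho[of i j] ortho[of i i] \<omega> by (auto split: if_splits)
    qed
    ultimately show False using finite_imageD infinite_UNIV_nat by blast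
  qed
next
  assume "\<omega> \<noteq> \<infinity>"
  then obtain m where m: "\<omega> = enat m" by (cases \<omega>) auto
  have "closure (flag m) = UNIV" using onb by (simp add: orthonormal_basis_def flag_def m)
  then have "flag m = UNIV" using closed_flag[of m] m by simp
  then show "finite_dimensional TYPE('a)"
    unfolding finite_dimensional_def by (intro exI[of _ "{\<xi> l |l. l < m}"]) (simp add: flag_def)
qed

text \<open>In dimension \<open>m\<close> the inverse of \<open>n\<close>, whose columns are
  \<open>gram_vector g j\<close>, is a finite sum and so inherits smoothness in \<open>g\<close>
  from its terms.\<close>

definition gram_sum :: "nat \<Rightarrow> ('a \<Rightarrow>\<^sub>L 'a) \<Rightarrow> ('a \<Rightarrow>\<^sub>L 'a)"
  where "gram_sum m g = id_blinfun - (\<Sum>j<m. gram_solution g j o\<^sub>L basis_proj j)"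

text \<open>The square of the \<open>j\<close>-th diagonal entry of \<open>a\<close>, namely the
  squared length of \<open>g\<close> at the \<open>j\<close>-th Gram-Schmidt vector. Written as a
  linear function of an operator product it falls under the rules for smooth maps.\<close>

definition column_norm :: "nat \<Rightarrow> ('a \<Rightarrow>\<^sub>L 'a) \<Rightarrow> nat \<Rightarrow> real"
  where "column_norm m g j = ((adj (g o\<^sub>L gram_sum m g) o\<^sub>L (g o\<^sub>L gram_sum m g)) (\<xi> j)) \<bullet> \<xi> j"

definition inverse_diagonal :: "nat \<Rightarrow> ('a \<Rightarrow>\<^sub>L 'a) \<Rightarrow> ('a \<Rightarrow>\<^sub>L 'a)"
  where "inverse_diagonal m g = (\<Sum>j<m. (1 / sqrt (column_norm m g j)) *\<^sub>R basis_proj j)"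

lemma basis_proj_basis: "enat i < \<omega> \<Longrightarrow> enat j < \<omega> \<Longrightarrow> basis_proj i (\<xi> j) = (if i = j then \<xi> j else 0)"
  by (simp add: basis_proj_apply ortho)

text \<open>Uniqueness identifies the given \<open>n\<close> with the one of
  \<open>iwasawa_exists\<close>, whose inverse has known columns. Then \<open>g n^-1 = k a\<close>,
  and the unitary factor drops out of the product of this operator with its adjoint.\<close>

lemma iwasawa_finite:
  assumes \<omega>: "\<omega> = enat m" and k: "k \<in> K_group" and a: "a \<in> A_group \<omega> \<xi>" and n: "n \<in> N_group \<omega> \<xi>"
    and g: "g = k o\<^sub>L a o\<^sub>L n"
  shows "op_inv n = gram_sum m g" "op_inv a = inverse_diagonal m g"
    "\<And>j. j < m \<Longrightarrow> column_norm m g j > 0"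
proof -
  have gG: "g \<in> carrier GL" using iwasawa_mult_GL[OF k a n] by (simp add: iwasawa_mult_def g)
  then have g': "g \<in> bounded_operators" "invertible_op g" by (auto simp: carrier_GL)
  obtain k' a' n' where e: "k' \<in> K_group" "a' \<in> A_group \<omega> \<xi>" "n' \<in> N_group \<omega> \<xi>" "g = k' o\<^sub>L a' o\<^sub>L n'"
    "\<And>j. enat j < \<omega> \<Longrightarrow> op_inv n' (\<xi> j) = gram_vector g j"
    using iwasawa_exists[OF g'] by metis
  have "n = n'" using iwasawa_unique(3)[OF k e(1) a e(2) n e(3)] g e(4) by simp
  then have ninv: "op_inv n (\<xi> j) = gram_vector g j" if "enat j < \<omega>" for j using e(5) that by simp
  have gs: "gram_sum m g \<in> bounded_operators"
  proof -
    have "(gram_solution g j o\<^sub>L basis_proj j) \<in> bounded_operators" if "j < m" for j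
      unfolding gram_solution_def using invertible_gram_op[OF g'(2), of j] that \<omega> g'
      by (intro compose_bounded_operators op_inv_bounded_operators)
        (auto simp: gram_op_def intro!: subspace_add[OF subspace_bounded_operators] subspace_diff[OF subspace_bounded_operators])
    then show ?thesis unfolding gram_sum_def
      by (intro subspace_diff[OF subspace_bounded_operators] subspace_sum[OF subspace_bounded_operators]) auto
  qed
  have inn: "invertible_op n" "n \<in> bounded_operators" using n by (auto simp: N_group_iff)
  show n_eq: "op_inv n = gram_sum m g"
  proof (rule operator_eqI[OF _ gs])
    fix j assume j: "enat j < \<omega>"
    have "(\<Sum>i<m. gram_solution g i (basis_proj i (\<xi> j))) = (\<Sum>i<m. if i = j then gram_solution g i (\<xi> j) else 0)"
      by (rule sum.cong) (use j \<omega> in \<open>auto simp: basis_proj_basis blinfun.bilinear_simps\<close>)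
    also have "\<dots> = gram_solution g j (\<xi> j)" using j \<omega> by simp
    finally show "op_inv n (\<xi> j) = gram_sum m g (\<xi> j)"
      using ninv[OF j] by (simp add: gram_sum_def gram_vector_def blinfun.diff_left blinfun.sum_left)
  qed (use inn in simp)
  have c: "g o\<^sub>L gram_sum m g = k o\<^sub>L a"
    unfolding n_eq[symmetric] by (rule blinfun_eqI) (simp add: g op_inv_apply[OF inn(1)])
  have r: "\<exists>\<rho>>0. a (\<xi> j) = \<rho> *\<^sub>R \<xi> j \<and> column_norm m g j = \<rho>\<^sup>2" if j: "enat j < \<omega>" for j
  proof -
    obtain \<rho> where \<rho>: "\<rho> > 0" "a (\<xi> j) = \<rho> *\<^sub>R \<xi> j" using a j by (auto simp: A_group_iff)
    have "adj (k o\<^sub>L a) o\<^sub>L (k o\<^sub>L a) = adj a o\<^sub>L ((adj k o\<^sub>L k) o\<^sub>L a)"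
      by (simp add: adj_compose blinfun_compose_assoc)
    also have "\<dots> = adj a o\<^sub>L a" by (simp add: K_groupD[OF k])
    finally have "column_norm m g j = adj a (a (\<xi> j)) \<bullet> \<xi> j" unfolding column_norm_def c by simp
    also have "\<dots> = \<rho>\<^sup>2" using j by (simp add: inner_adj_left \<rho> power2_eq_square dot_square_norm)
    finally show ?thesis using \<rho> by blast
  qed
  show "column_norm m g j > 0" if "j < m" for j using r[of j] that \<omega> by auto
  have ia: "invertible_op a" "a \<in> bounded_operators" using a by (auto simp: A_group_iff)
  show "op_inv a = inverse_diagonal m g"
  proof (rule operator_eqI)
    show "inverse_diagonal m g \<in> bounded_operators"
      unfolding inverse_diagonal_def
      by (intro subspace_sum[OF subspace_bounded_operators] subspace_scale[OF subspace_bounded_operators]) simp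
    fix j assume j: "enat j < \<omega>"
    obtain \<rho> where \<rho>: "\<rho> > 0" "a (\<xi> j) = \<rho> *\<^sub>R \<xi> j" "column_norm m g j = \<rho>\<^sup>2" using r[OF j] by blast
    have "op_inv a (a (\<xi> j)) = \<rho> *\<^sub>R op_inv a (\<xi> j)" by (simp add: \<rho> blinfun.bilinear_simps)
    then have "\<xi> j = \<rho> *\<^sub>R op_inv a (\<xi> j)" by (simp add: op_inv_apply[OF ia(1)])
    from arg_cong[OF this, of "\<lambda>v. (1 / \<rho>) *\<^sub>R v"] have 1: "op_inv a (\<xi> j) = (1 / \<rho>) *\<^sub>R \<xi> j" using \<rho> by simp
    have "inverse_diagonal m g (\<xi> j) = (\<Sum>i<m. if i = j then (1 / sqrt (column_norm m g i)) *\<^sub>R \<xi> j else 0)"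
      unfolding inverse_diagonal_def blinfun.sum_left
      by (rule sum.cong) (use j \<omega> in \<open>auto simp: basis_proj_basis blinfun.bilinear_simps\<close>)
    also have "\<dots> = (1 / \<rho>) *\<^sub>R \<xi> j" using j \<omega> \<rho> by simp
    finally show "op_inv a (\<xi> j) = inverse_diagonal m g (\<xi> j)" using 1 by simp
  qed (use ia in simp)
qed

text \<open>\<open>n\<close> and \<open>a\<close> are found through their inverses, for which there
  are formulas; \<open>k = g n^-1 a^-1\<close> is what remains.\<close>

definition iwasawa_inverse :: "nat \<Rightarrow> ('a \<Rightarrow>\<^sub>L 'a) \<Rightarrow> ('a \<Rightarrow>\<^sub>L 'a) \<times> ('a \<Rightarrow>\<^sub>L 'a) \<times> ('a \<Rightarrow>\<^sub>L 'a)"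
  where "iwasawa_inverse m g =
    ((g o\<^sub>L gram_sum m g) o\<^sub>L inverse_diagonal m g, op_inv (inverse_diagonal m g), op_inv (gram_sum m g))"

lemma iwasawa_inverse:
  assumes \<omega>: "\<omega> = enat m" and k: "k \<in> K_group" and a: "a \<in> A_group \<omega> \<xi>" and n: "n \<in> N_group \<omega> \<xi>"
    and g: "g = k o\<^sub>L a o\<^sub>L n"
  shows "iwasawa_inverse m g = (k, a, n)"
    "invertible_op (inverse_diagonal m g)" "invertible_op (gram_sum m g)"
proof -
  note f = iwasawa_finite[OF assms]
  have i: "invertible_op a" "invertible_op n" using a n by (auto simp: A_group_iff N_group_iff)
  show "invertible_op (inverse_diagonal m g)" "invertible_op (gram_sum m g)"
    unfolding f(1,2)[symmetric] by (intro invertible_op_inv i)+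
  have "(g o\<^sub>L op_inv n) o\<^sub>L op_inv a = k"
    by (rule blinfun_eqI) (simp add: g op_inv_apply i)
  then show "iwasawa_inverse m g = (k, a, n)"
    unfolding iwasawa_inverse_def f(1,2)[symmetric] by (simp add: invertible_op_inv i)
qed

lemma smooth_on_iwasawa_inverse:
  assumes \<omega>: "\<omega> = enat m"
  shows "smooth_on bounded_operators (carrier GL) (iwasawa_inverse m)"
proof -
  let ?E = "bounded_operators :: ('a \<Rightarrow>\<^sub>L 'a) set" and ?U = "carrier GL :: ('a \<Rightarrow>\<^sub>L 'a) set"
  note sub = subspace_bounded_operators
  have inv: "invertible_op (inverse_diagonal m g)" "invertible_op (gram_sum m g)"
    "\<And>j. j < m \<Longrightarrow> column_norm m g j > 0" if g: "g \<in> ?U" for g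
  proof -
    obtain k a n where d: "k \<in> K_group" "a \<in> A_group \<omega> \<xi>" "n \<in> N_group \<omega> \<xi>" "g = k o\<^sub>L a o\<^sub>L n"
      using iwasawa_decomposition[OF g] by blast
    show "invertible_op (inverse_diagonal m g)" "invertible_op (gram_sum m g)"
      using iwasawa_inverse(2,3)[OF \<omega> d] by auto
    show "column_norm m g j > 0" if "j < m" for j using iwasawa_finite(3)[OF \<omega> d that] .
  qed
  have id: "smooth_on ?E ?U (\<lambda>g. g)" by (rule smooth_on_identity[OF sub openin_GL])
  have co: "smooth_on ?E ?U (\<lambda>g. c)" for c :: "'a \<Rightarrow>\<^sub>L 'a" by (rule smooth_on_const[OF openin_GL])
  have gg: "smooth_on ?E ?U (\<lambda>g. adj g o\<^sub>L g)"
    by (intro smooth_on_compose sub smooth_on_linear_image[OF bounded_linear_adj id] id)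
  have "smooth_on ?E ?U (\<lambda>g. gram_solution g j)" if "j < m" for j
    unfolding gram_solution_def gram_op_def
  proof (intro smooth_on_compose smooth_on_op_inv smooth_on_add smooth_on_diff sub co id
      smooth_on_linear_image[OF bounded_linear_adj id])
    fix g :: "'a \<Rightarrow>\<^sub>L 'a" assume "g \<in> ?U"
    then have "invertible_op (gram_op g j)" using that \<omega> by (intro invertible_gram_op) (auto simp: carrier_GL)
    then show "invertible_op ((flag_proj j o\<^sub>L ((adj g o\<^sub>L g) o\<^sub>L flag_proj j)) + (id_blinfun - flag_proj j))"
      by (simp add: gram_op_def)
  qed
  then have ns: "smooth_on ?E ?U (gram_sum m)"
    unfolding gram_sum_def by (intro smooth_on_diff smooth_on_sum smooth_on_compose sub co openin_GL) auto
  have cs: "smooth_on ?E ?U (\<lambda>g. g o\<^sub>L gram_sum m g)" by (intro smooth_on_compose sub id ns)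
  have "smooth_on ?E ?U (\<lambda>g. column_norm m g j)" for j
  proof -
    have bl: "bounded_linear (\<lambda>T::'a \<Rightarrow>\<^sub>L 'a. T (\<xi> j) \<bullet> \<xi> j)"
      by (rule bounded_linear_compose[OF bounded_linear_inner_left blinfun.bounded_linear_left])
    show ?thesis unfolding column_norm_def
      by (rule smooth_on_linear_image[OF bl]) (intro smooth_on_compose sub smooth_on_linear_image[OF bounded_linear_adj] cs)
  qed
  then have "smooth_on ?E ?U (\<lambda>g. 1 / sqrt (column_norm m g j))" if "j < m" for j
    using inv(3) that by (intro smooth_on_inverse_sqrt sub) auto
  then have ds: "smooth_on ?E ?U (inverse_diagonal m)"
    unfolding inverse_diagonal_def
    by (intro smooth_on_sum sub openin_GL smooth_on_linear_image[OF bounded_linear_scaleR_left]) auto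
  show ?thesis unfolding iwasawa_inverse_def
    by (intro smooth_on_Pair smooth_on_compose smooth_on_op_inv sub cs ds ns inv)
qed

lemma the_inv_into_iwasawa:
  assumes "k \<in> K_group" "a \<in> A_group \<omega> \<xi>" "n \<in> N_group \<omega> \<xi>"
  shows "the_inv_into (points KAN_manifold) iwasawa_mult (k o\<^sub>L a o\<^sub>L n) = (k, a, n)"
proof -
  have "the_inv_into (points KAN_manifold) iwasawa_mult (iwasawa_mult (k, a, n)) = (k, a, n)"
    using bij_betw_iwasawa assms by (intro the_inv_into_f_f) (auto simp: bij_betw_def)
  then show ?thesis by (simp add: iwasawa_mult_def)
qed

lemma diffeo_if_finite:
  assumes \<omega>: "\<omega> = enat m"
  shows "diffeo KAN_manifold GL_manifold iwasawa_mult"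
  unfolding diffeo_def
proof (intro conjI smooth_iwasawa_mult)
  show "bij_betw iwasawa_mult (points KAN_manifold) (points GL_manifold)"
    using bij_betw_iwasawa by (simp add: open_submanifold_def)
  let ?f = "the_inv_into (points KAN_manifold) iwasawa_mult"
  have f: "?f g = iwasawa_inverse m g" if "g \<in> carrier GL" for g
    using iwasawa_decomposition[OF that] the_inv_into_iwasawa iwasawa_inverse(1)[OF \<omega>] by metis
  have fs: "smooth_on bounded_operators (carrier GL) ?f"
    by (rule smooth_on_cong[OF smooth_on_iwasawa_inverse[OF \<omega>] f])
  show "smooth_map GL_manifold KAN_manifold ?f"
  proof (rule smooth_mapI)
    show "subspace (model_space GL_manifold)" by (simp add: open_submanifold_def subspace_bounded_operators)
    show "?f ` points GL_manifold \<subseteq> points KAN_manifold"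
    proof (rule image_subsetI)
      fix g assume "g \<in> points GL_manifold"
      then have "g \<in> carrier GL" by (simp add: open_submanifold_def)
      from iwasawa_decomposition[OF this] show "?f g \<in> points KAN_manifold" using the_inv_into_iwasawa by auto
    qed
    show "continuous_on (points GL_manifold) ?f"
      using smooth_on_continuous[OF subspace_bounded_operators fs] by (simp add: open_submanifold_def)
    show "U \<subseteq> points GL_manifold \<and> (\<exists>\<psi>. (\<forall>x\<in>U. \<psi> (\<phi> x) = x) \<and>
        smooth_on (model_space GL_manifold) (\<phi> ` U) (\<lambda>x. ?f (\<psi> x)))" if "(U, \<phi>) \<in> charts GL_manifold" for U \<phi>
      using that fs by (auto simp: open_submanifold_def intro!: exI[of _ "\<lambda>x. x"])
    show "\<exists>Q. open Q \<and> V = points KAN_manifold \<inter> Q" if V: "(V, \<rho>) \<in> charts KAN_manifold" for V \<rho>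
    proof -
      obtain k where k: "V = KAN_domain k" using V charts_KAN by blast
      obtain Q where Q: "open Q" "K_domain k = K_group \<inter> Q" using K_domain_open by blast
      show ?thesis
        by (intro exI[of _ "Q \<times> UNIV"]) (use Q k in \<open>auto simp: KAN_domain_def open_Times\<close>)
    qed
    show "smooth_on (model_space GL_manifold) W (\<lambda>x. \<rho> (h x))"
      if V: "(V, \<rho>) \<in> charts KAN_manifold" and h: "smooth_on (model_space GL_manifold) W h" "h ` W \<subseteq> V" for V \<rho> W h
    proof -
      have ms: "model_space GL_manifold = bounded_operators" by (simp add: open_submanifold_def)
      obtain k where k: "V = KAN_domain k" "\<rho> = KAN_chart k" using V charts_KAN by blast
      note fst = smooth_on_linear_image[OF bounded_linear_fst] and snd = smooth_on_linear_image[OF bounded_linear_snd]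
      have "smooth_on bounded_operators W (\<lambda>x. (cay (adj k o\<^sub>L fst (h x)), fst (snd (h x)) - 0, snd (snd (h x)) - id_blinfun))"
        using h k unfolding ms
        by (intro smooth_on_Pair smooth_on_K_chart smooth_on_translate fst snd subspace_bounded_operators)
          (auto simp: KAN_domain_def)
      then show ?thesis unfolding ms k(2) by (rule smooth_on_cong) (simp add: KAN_chart_def map_prod_def case_prod_unfold)
    qed
  qed
qed

section \<open>Differentiating the inverse of the multiplication map\<close>

text \<open>\<open>u = - (v + w)\<close> is triangular with real diagonal. Skew-adjointness carries
  the vanishing lower part to the upper one and makes the diagonal imaginary, hence zero. The
  argument is independent of the dimension, so only spanning is at stake in the equivalence.\<close>

lemma direct_sum_trivial:
  assumes "u \<in> k_algebra" "v \<in> a_algebra \<omega> \<xi>" "w \<in> n_algebra \<omega> \<xi>" and s: "u + v + w = 0"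
  shows "u = 0 \<and> v = 0 \<and> w = 0"
proof -
  have u: "u \<in> bounded_operators" "adj u = - u" using assms by (auto simp: k_algebra_iff)
  have v: "v \<in> bounded_operators" using assms by (auto simp: a_algebra_iff)
  have w: "w \<in> bounded_operators" using assms by (auto simp: n_algebra_iff)
  have skew: "cinner (u x) y = - cnj (cinner (u y) x)" for x y
    using cinner_adj[OF u(1), of x y] cinner_commute[of x "u y"] u(2)
    by (simp add: blinfun.bilinear_simps cinner_simps)
  have ue: "u x = - (v x + w x)" for x
  proof -
    have "u x + (v x + w x) = 0"
      using arg_cong[OF s, of "\<lambda>T. blinfun_apply T x"] by (simp add: blinfun.bilinear_simps add.assoc)
    then show ?thesis by (simp only: eq_neg_iff_add_eq_0)
  qed
  have lower: "cinner (u (\<xi> j)) (\<xi> l) = 0" if j: "enat j < \<omega>" "enat l < \<omega>" "j < l" for j l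
  proof -
    obtain r :: real where "v (\<xi> j) = r *\<^sub>R \<xi> j" using assms(2) j by (auto simp: a_algebra_iff)
    moreover have "cinner (w (\<xi> j)) (\<xi> l) = 0"
      using assms(3) j by (intro flag_coefficient_zero[of _ j]) (auto simp: n_algebra_iff)
    ultimately show ?thesis using j ortho by (simp add: ue cinner_simps)
  qed
  have diag: "cinner (u (\<xi> j)) (\<xi> j) = 0" if j: "enat j < \<omega>" for j
  proof -
    obtain r :: real where "v (\<xi> j) = r *\<^sub>R \<xi> j" using assms(2) j by (auto simp: a_algebra_iff)
    moreover have "cinner (w (\<xi> j)) (\<xi> j) = 0"
      using assms(3) j by (intro flag_coefficient_zero[of _ j]) (auto simp: n_algebra_iff)
    ultimately have "cinner (u (\<xi> j)) (\<xi> j) = - of_real r" using j ortho by (simp add: ue cinner_simps)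
    with skew[of "\<xi> j" "\<xi> j"] show ?thesis by simp
  qed
  have "u (\<xi> j) = 0" if j: "enat j < \<omega>" for j
  proof (rule basis_separates)
    fix l assume l: "enat l < \<omega>"
    have "cinner (u (\<xi> j)) (\<xi> l) = 0"
      using lower[OF j l] lower[OF l j] diag[OF j] skew[of "\<xi> j" "\<xi> l"] by (cases j l rule: linorder_cases) auto
    then show "cinner (\<xi> l) (u (\<xi> j)) = 0" by (metis cinner_commute complex_cnj_zero)
  qed
  then have u0: "u = 0"
    using u(1) subspace_0[OF subspace_bounded_operators] by (intro operator_eqI) (auto simp: blinfun.bilinear_simps)
  have "v (\<xi> j) = 0" if j: "enat j < \<omega>" for j
  proof -
    obtain r :: real where r: "v (\<xi> j) = r *\<^sub>R \<xi> j" using assms(2) j by (auto simp: a_algebra_iff)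
    have "cinner (w (\<xi> j)) (\<xi> j) = 0"
      using assms(3) j by (intro flag_coefficient_zero[of _ j]) (auto simp: n_algebra_iff)
    moreover have "v (\<xi> j) + w (\<xi> j) = 0"
      using ue[of "\<xi> j"] u0 by (simp only: blinfun.zero_left neg_0_equal_iff_equal)
    then have "cinner (v (\<xi> j) + w (\<xi> j)) (\<xi> j) = 0" by simp
    ultimately show ?thesis using j ortho by (simp add: r cinner_simps)
  qed
  then have "v = 0"
    using v subspace_0[OF subspace_bounded_operators] by (intro operator_eqI) (auto simp: blinfun.bilinear_simps)
  then show ?thesis using u0 s by simp
qed

text \<open>The factor \<open>- 2\<close> is the derivative of the Cayley transform at 0, where
  \<open>cay X = 1 - 2 X + ...\<close>. The base point consists of the coordinates of the identity
  triple, as the Cayley transform of the identity is 0.\<close>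

lemma has_derivative_KAN_param:
  "(KAN_param id_blinfun has_derivative (\<lambda>h. - 2 *\<^sub>R fst h + fst (snd h) + snd (snd h))) (at (0, id_blinfun, 0))"
proof -
  have "(op_inv has_derivative (\<lambda>V. - (op_inv id_blinfun o\<^sub>L V o\<^sub>L op_inv id_blinfun)))
      (at (id_blinfun + fst (0 :: 'a \<Rightarrow>\<^sub>L 'a, id_blinfun :: 'a \<Rightarrow>\<^sub>L 'a, 0 :: 'a \<Rightarrow>\<^sub>L 'a)))"
    using has_derivative_op_inv[of "id_blinfun :: 'a \<Rightarrow>\<^sub>L 'a"] by simp
  then have i: "((\<lambda>x::('a \<Rightarrow>\<^sub>L 'a) \<times> ('a \<Rightarrow>\<^sub>L 'a) \<times> ('a \<Rightarrow>\<^sub>L 'a). op_inv (id_blinfun + fst x)) has_derivative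
      (\<lambda>h. - (op_inv id_blinfun o\<^sub>L (0 + fst h) o\<^sub>L op_inv id_blinfun))) (at (0, id_blinfun, 0))"
    by (rule has_derivative_compose[rotated])
      (intro has_derivative_add has_derivative_const has_derivative_fst has_derivative_ident)
  have "((\<lambda>x. (cay (fst x) o\<^sub>L fst (snd x)) o\<^sub>L (snd (snd x) + id_blinfun)) has_derivative
      (\<lambda>h. - 2 *\<^sub>R fst h + fst (snd h) + snd (snd h))) (at (0, id_blinfun :: 'a \<Rightarrow>\<^sub>L 'a, 0))"
    unfolding cay_def
    by (rule derivative_eq_intros i bounded_bilinear.FDERIV[OF bounded_bilinear_blinfun_compose] refl | simp add: compose_distribs scaleR_2 fun_eq_iff algebra_simps)+
  then show ?thesis by (simp add: KAN_param_def[abs_def])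
qed

text \<open>Let \<open>h\<close> be the inverse map in coordinates. The chain rule for
  \<open>KAN_param\<close> after \<open>h\<close> writes \<open>W\<close> as a combination of the
  components of \<open>h' W\<close>. These lie in the three subalgebras as limits of difference
  quotients, the model space being a closed subspace.\<close>

lemma direct_sum_if_diffeo:
  assumes d: "diffeo KAN_manifold GL_manifold iwasawa_mult"
  shows "direct_sum3 k_algebra (a_algebra \<omega> \<xi>) (n_algebra \<omega> \<xi>) bounded_operators"
proof -
  let ?f = "the_inv_into (points KAN_manifold) iwasawa_mult" and ?BO = "bounded_operators :: ('a \<Rightarrow>\<^sub>L 'a) set"
  let ?E = "k_algebra \<times> a_algebra \<omega> \<xi> \<times> n_algebra \<omega> \<xi>"
  note sub = subspace_bounded_operators
  define \<Omega> where "\<Omega> = carrier GL \<inter> ?f -` KAN_domain id_blinfun"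
  define h where "h = (\<lambda>g. KAN_chart id_blinfun (?f g))"
  have chart: "(KAN_domain id_blinfun, KAN_chart id_blinfun) \<in> charts KAN_manifold"
    unfolding charts_KAN using K_group_id by blast
  have sm: "smooth_on ?BO ((\<lambda>x. x) ` \<Omega>) (KAN_chart id_blinfun \<circ> ?f \<circ> the_inv_into (carrier GL) (\<lambda>x. x))"
    using d chart unfolding diffeo_def smooth_map_def \<Omega>_def by (auto simp: open_submanifold_def)
  have h: "smooth_on ?BO \<Omega> h"
  proof (rule smooth_on_cong[OF sm[unfolded image_ident]])
    fix g assume "g \<in> \<Omega>"
    then have "the_inv_into (carrier GL) (\<lambda>x. x) g = g" by (intro the_inv_into_f_eq) (auto simp: \<Omega>_def)
    then show "h g = (KAN_chart id_blinfun \<circ> ?f \<circ> the_inv_into (carrier GL) (\<lambda>x. x)) g" by (simp add: h_def)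
  qed
  have f1: "?f id_blinfun = (id_blinfun, id_blinfun, id_blinfun)"
    using the_inv_into_iwasawa[OF K_group_id subgroup.one_closed[OF subgroup_A] subgroup.one_closed[OF subgroup_N]] by simp
  have two: "op_inv (id_blinfun + id_blinfun) = (1 / 2) *\<^sub>R (id_blinfun :: 'a \<Rightarrow>\<^sub>L 'a)" "invertible_op (id_blinfun + id_blinfun :: 'a \<Rightarrow>\<^sub>L 'a)"
    using invertible_op_scaleR[OF invertible_op_id(1), of 2] by (simp_all add: scaleR_2)
  have h1: "h id_blinfun = (0, id_blinfun, 0)"
    by (simp only: h_def f1) (simp add: KAN_chart_def cay_def two)
  have id\<Omega>: "id_blinfun \<in> \<Omega>"
    using two(2) K_group_id subgroup.one_closed[OF subgroup_A] subgroup.one_closed[OF subgroup_N] f1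
    by (simp add: \<Omega>_def KAN_domain_def K_domain_def carrier_GL)
  have hE: "h g \<in> ?E" and hm: "KAN_param id_blinfun (h g) = g" if g: "g \<in> \<Omega>" for g
  proof -
    have "h g \<in> KAN_chart id_blinfun ` KAN_domain id_blinfun" using g by (auto simp: \<Omega>_def h_def)
    then show "h g \<in> ?E"
      unfolding KAN_chart_image[OF K_group_id] by (rule subsetD[OF openin_imp_subset[OF openin_KAN]])
    have "KAN_param id_blinfun (h g) = iwasawa_mult (?f g)"
      unfolding h_def by (rule KAN_param_chart[OF K_group_id]) (use g in \<open>auto simp: \<Omega>_def\<close>)
    also have "\<dots> = g"
      by (rule f_the_inv_into_f_bij_betw[of _ "points KAN_manifold" "carrier GL"])
        (use bij_betw_iwasawa g in \<open>auto simp: \<Omega>_def\<close>)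
    finally show "KAN_param id_blinfun (h g) = g" .
  qed
  obtain h' C where h': "\<And>v w a b. v \<in> ?BO \<Longrightarrow> w \<in> ?BO \<Longrightarrow> h' (a *\<^sub>R v + b *\<^sub>R w) = a *\<^sub>R h' v + b *\<^sub>R h' w"
    "\<And>\<epsilon>. \<epsilon> > 0 \<Longrightarrow> \<exists>\<delta>>0. \<forall>y\<in>\<Omega>. norm (y - id_blinfun) < \<delta> \<longrightarrow>
       norm (h y - h id_blinfun - h' (y - id_blinfun)) \<le> \<epsilon> * norm (y - id_blinfun)"
    by (rule smooth_on_derivative[OF h id\<Omega>]) blast
  obtain e0 where e0: "e0 > 0" "\<And>y. y \<in> ?BO \<Longrightarrow> dist y id_blinfun < e0 \<Longrightarrow> y \<in> \<Omega>"
    using smooth_on_openin[OF h] id\<Omega> unfolding openin_euclidean_subtopology_iff by blast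
  have "\<exists>u v w. u \<in> k_algebra \<and> v \<in> a_algebra \<omega> \<xi> \<and> w \<in> n_algebra \<omega> \<xi> \<and> W = u + v + w" if W: "W \<in> ?BO" for W
  proof -
    \<comment> \<open>\<open>h\<close> is differentiable only relative to
      \<open>bounded_operators\<close>; along a real line through the identity it becomes an
      ordinary differentiable curve, to which the chain rule applies.\<close>
    define p where "p = (\<lambda>t::real. h (id_blinfun + t *\<^sub>R W))"
    define c where "c = norm W + 1"
    have c: "c > 0" by (simp add: c_def add_nonneg_pos)
    have p0: "p 0 = (0, id_blinfun, 0)" by (simp add: p_def h1)
    have hs: "h' (t *\<^sub>R W) = t *\<^sub>R h' W" for t using h'(1)[OF W W, of t 0] by simp
    have in\<Omega>: "id_blinfun + t *\<^sub>R W \<in> \<Omega>" if t: "\<bar>t\<bar> < e0 / c" for t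
    proof (rule e0(2))
      show "id_blinfun + t *\<^sub>R W \<in> ?BO" using W by (intro subspace_add[OF sub] subspace_scale[OF sub]) auto
      have "\<bar>t\<bar> * norm W \<le> \<bar>t\<bar> * c" by (intro mult_left_mono) (auto simp: c_def)
      also have "\<dots> < e0" using t c by (simp add: pos_less_divide_eq)
      finally show "dist (id_blinfun + t *\<^sub>R W) id_blinfun < e0" by (simp add: dist_norm)
    qed
    have pd: "\<exists>\<delta>>0. \<forall>t. \<bar>t\<bar> < \<delta> \<longrightarrow> id_blinfun + t *\<^sub>R W \<in> \<Omega> \<and> norm (p t - p 0 - t *\<^sub>R h' W) \<le> e * \<bar>t\<bar>" if e: "e > 0" for e
    proof -
      obtain \<delta> where \<delta>: "\<delta> > 0" "\<And>y. y \<in> \<Omega> \<Longrightarrow> norm (y - id_blinfun) < \<delta> \<Longrightarrow>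
          norm (h y - h id_blinfun - h' (y - id_blinfun)) \<le> e / c * norm (y - id_blinfun)"
        using h'(2)[of "e / c"] e c by auto
      have "id_blinfun + t *\<^sub>R W \<in> \<Omega> \<and> norm (p t - p 0 - t *\<^sub>R h' W) \<le> e * \<bar>t\<bar>" if t: "\<bar>t\<bar> < min (e0 / c) (\<delta> / c)" for t
      proof
        show m: "id_blinfun + t *\<^sub>R W \<in> \<Omega>" using in\<Omega> t by simp
        have le: "\<bar>t\<bar> * norm W \<le> \<bar>t\<bar> * c" by (intro mult_left_mono) (auto simp: c_def)
        also have "\<bar>t\<bar> * c < \<delta>" using t c by (simp add: pos_less_divide_eq)
        finally have "norm (p t - p 0 - t *\<^sub>R h' W) \<le> e / c * norm (t *\<^sub>R W)"
          using \<delta>(2)[OF m] hs by (simp add: p_def)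
        also have "\<dots> \<le> e / c * (\<bar>t\<bar> * c)" using le e c by (intro mult_left_mono) auto
        also have "\<dots> = e * \<bar>t\<bar>" using c by simp
        finally show "norm (p t - p 0 - t *\<^sub>R h' W) \<le> e * \<bar>t\<bar>" .
      qed
      moreover have "min (e0 / c) (\<delta> / c) > 0" using e0 \<delta> c by simp
      ultimately show ?thesis by blast
    qed
    have "(p has_derivative (\<lambda>t. t *\<^sub>R h' W)) (at 0)"
      unfolding has_derivative_at_alt
    proof (intro conjI allI impI)
      fix e :: real assume "e > 0"
      from pd[OF this] show "\<exists>d>0. \<forall>y. norm (y - 0) < d \<longrightarrow> norm (p y - p 0 - (y - 0) *\<^sub>R h' W) \<le> e * norm (y - 0)"
        by (auto)
    qed (intro bounded_linear_intros)
    then have "((\<lambda>t. KAN_param id_blinfun (p t)) has_derivative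
        (\<lambda>t. - 2 *\<^sub>R fst (t *\<^sub>R h' W) + fst (snd (t *\<^sub>R h' W)) + snd (snd (t *\<^sub>R h' W)))) (at 0)"
      by (rule has_derivative_compose) (unfold p0, rule has_derivative_KAN_param)
    moreover have "((\<lambda>t. KAN_param id_blinfun (p t)) has_derivative (\<lambda>t. t *\<^sub>R W)) (at 0)"
    proof (rule has_derivative_transform_within_open)
      show "((\<lambda>t. id_blinfun + t *\<^sub>R W) has_derivative (\<lambda>t. t *\<^sub>R W)) (at 0)"
        by (auto intro!: derivative_eq_intros)
      show "open {- (e0 / c) <..< e0 / c}" by simp
      show "0 \<in> {- (e0 / c) <..< e0 / c}" using e0 c by simp
      show "id_blinfun + t *\<^sub>R W = KAN_param id_blinfun (p t)" if "t \<in> {- (e0 / c) <..< e0 / c}" for t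
        using hm[OF in\<Omega>] that by (simp add: p_def abs_less_iff)
    qed
    ultimately have "(\<lambda>t. - 2 *\<^sub>R fst (t *\<^sub>R h' W) + fst (snd (t *\<^sub>R h' W)) + snd (snd (t *\<^sub>R h' W))) = (\<lambda>t. t *\<^sub>R W)"
      by (rule has_derivative_unique)
    from fun_cong[OF this, of 1] have We: "W = - 2 *\<^sub>R fst (h' W) + fst (snd (h' W)) + snd (snd (h' W))" by simp
    have "closed ?E" by (intro closed_Times closed_k closed_a closed_n)
    moreover have "\<exists>y\<in>?E. dist y (h' W) < e" if e: "e > 0" for e
    proof -
      have e2: "e / 2 > 0" using e by simp
      obtain \<delta> where \<delta>: "\<delta> > 0" "\<And>t. \<bar>t\<bar> < \<delta> \<Longrightarrow> id_blinfun + t *\<^sub>R W \<in> \<Omega>"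
        "\<And>t. \<bar>t\<bar> < \<delta> \<Longrightarrow> norm (p t - p 0 - t *\<^sub>R h' W) \<le> e / 2 * \<bar>t\<bar>"
        using pd[OF e2] by blast
      define t where "t = \<delta> / 2"
      have t: "t > 0" "\<bar>t\<bar> < \<delta>" using \<delta>(1) by (auto simp: t_def)
      have "p t \<in> ?E" unfolding p_def by (rule hE[OF \<delta>(2)[OF t(2)]])
      moreover have "p 0 \<in> ?E" unfolding p_def using hE[OF id\<Omega>] by simp
      ultimately have "(1 / t) *\<^sub>R (p t - p 0) \<in> ?E"
        by (intro subspace_scale[OF subspace_KAN] subspace_diff[OF subspace_KAN])
      moreover have "dist ((1 / t) *\<^sub>R (p t - p 0)) (h' W) = norm ((1 / t) *\<^sub>R (p t - p 0 - t *\<^sub>R h' W))"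
        using t by (simp add: dist_norm scaleR_diff_right)
      moreover have "\<dots> \<le> (1 / t) * (e / 2 * \<bar>t\<bar>)"
        using \<delta>(3)[OF t(2)] t(1) by (simp add: pos_divide_le_eq)
      moreover have "\<dots> < e" using t e by simp
      ultimately show ?thesis by (intro bexI[of _ "(1 / t) *\<^sub>R (p t - p 0)"]) linarith+
    qed
    ultimately have hW: "h' W \<in> ?E" using closed_approachable by blast
    then have "- 2 *\<^sub>R fst (h' W) \<in> k_algebra" by (intro subspace_scale[OF subspace_k]) auto
    with hW We show ?thesis
      by (intro exI[of _ "- 2 *\<^sub>R fst (h' W)"] exI[of _ "fst (snd (h' W))"] exI[of _ "snd (snd (h' W))"]) auto
  qed
  moreover have "u + v + w \<in> ?BO" if "u \<in> k_algebra" "v \<in> a_algebra \<omega> \<xi>" "w \<in> n_algebra \<omega> \<xi>" for u v w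
    using that by (intro subspace_add[OF sub]) (auto simp: k_algebra_iff a_algebra_iff n_algebra_iff)
  ultimately show ?thesis unfolding direct_sum3_def using direct_sum_trivial by blast
qed

end

section \<open>A bounded operator with unbounded triangular truncation\<close>

text \<open>The factor \<open>\<i>\<close> makes an antisymmetric real matrix Hermitian. Up to the
  factor \<open>2 * pi\<close> the entries are the integrals of the sawtooth \<open>pi - t\<close>
  against exponentials.\<close>

definition hilbert_entry :: "nat \<Rightarrow> nat \<Rightarrow> complex"
  where "hilbert_entry j l = (if j = l then 0 else \<i> / of_int (int j - int l))"

lemma hilbert_entry_swap: "hilbert_entry l j = - hilbert_entry j l"
proof -
  have "complex_of_int (int l - int j) = - of_int (int j - int l)" by simp
  then show ?thesis by (simp only: hilbert_entry_def) (simp del: of_int_diff)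
qed

lemma has_integral_exp_multiple:
  "((\<lambda>t. exp (\<i> * of_int k * of_real t)) has_integral (if k = 0 then 2 * pi else 0)) {0..2 * pi}"
proof (cases "k = 0")
  case True
  then show ?thesis using has_integral_const_real[of "1::complex" 0 "2 * pi"] by (simp add: scaleR_conv_of_real)
next
  case False
  let ?F = "\<lambda>z. exp (\<i> * of_int k * z) / (\<i> * of_int k)"
  have "((\<lambda>t. exp (\<i> * of_int k * of_real t)) has_integral (?F (of_real (2 * pi)) - ?F (of_real 0))) {0..2 * pi}"
  proof (rule fundamental_theorem_of_calculus)
    fix t :: real
    have "(?F has_field_derivative exp (\<i> * of_int k * of_real t)) (at (of_real t))"
      using False by (auto intro!: derivative_eq_intros)
    then show "((\<lambda>t. ?F (of_real t)) has_vector_derivative exp (\<i> * of_int k * of_real t)) (at t within {0..2 * pi})"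
      by (rule has_vector_derivative_real_field)
  qed simp
  moreover have "exp (\<i> * of_int k * of_real (2 * pi)) = 1"
    using exp_integer_2pi[of "of_int k"] by (simp add: mult_ac)
  ultimately show ?thesis using False by simp
qed

lemma has_integral_sawtooth_exp:
  "((\<lambda>t. of_real (pi - t) * exp (\<i> * of_int (int j - int l) * of_real t)) has_integral (2 * pi * hilbert_entry j l)) {0..2 * pi}"
proof (cases "j = l")
  case True
  have "((\<lambda>t. complex_of_real (pi - t)) has_integral
      ((of_real pi * of_real (2 * pi) - (of_real (2 * pi))\<^sup>2 / 2) - (of_real pi * of_real 0 - (of_real 0 :: complex)\<^sup>2 / 2))) {0..2 * pi}"
  proof (rule fundamental_theorem_of_calculus)
    fix t :: real
    have "((\<lambda>z. of_real pi * z - z\<^sup>2 / 2) has_field_derivative complex_of_real (pi - t)) (at (of_real t))"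
      by (auto intro!: derivative_eq_intros)
    then show "((\<lambda>t. pi * complex_of_real t - (complex_of_real t)\<^sup>2 / 2) has_vector_derivative complex_of_real (pi - t)) (at t within {0..2 * pi})"
      by (rule has_vector_derivative_real_field)
  qed simp
  then show ?thesis using True by (simp add: hilbert_entry_def power2_eq_square)
next
  case False
  define c where "c = \<i> * complex_of_int (int j - int l)"
  have c: "c \<noteq> 0" using False by (simp add: c_def del: of_int_diff)
  \<comment> \<open>The antiderivative comes from integration by parts. The exponential is 1 at both
    ends of the interval, so only the difference \<open>- 2 * pi\<close> of the boundary values of
    the sawtooth survives.\<close>
  let ?F = "\<lambda>z. (of_real pi - z) * exp (c * z) / c + exp (c * z) / c\<^sup>2"
  have "((\<lambda>t. of_real (pi - t) * exp (c * of_real t)) has_integral (?F (of_real (2 * pi)) - ?F (of_real 0))) {0..2 * pi}"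
  proof (rule fundamental_theorem_of_calculus)
    fix t :: real
    have "(?F has_field_derivative of_real (pi - t) * exp (c * of_real t)) (at (of_real t))"
      using c by (auto intro!: derivative_eq_intros simp: field_simps power2_eq_square)
    then show "((\<lambda>t. ?F (of_real t)) has_vector_derivative of_real (pi - t) * exp (c * of_real t)) (at t within {0..2 * pi})"
      by (rule has_vector_derivative_real_field)
  qed simp
  moreover have "exp (c * of_real (2 * pi)) = 1"
    using exp_integer_2pi[of "of_int (int j - int l)"] by (simp add: c_def mult_ac del: of_int_diff)
  then have "?F (of_real (2 * pi)) - ?F (of_real 0) = - (2 * pi / c)" using c by (simp add: field_simps)
  moreover have "- (2 * pi / c) = 2 * pi * hilbert_entry j l"
  proof -
    have "- (1 / c) = \<i> / of_int (int j - int l)" unfolding c_def using False by (simp add: field_simps del: of_int_diff)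
    then have "complex_of_real (2 * pi) * - (1 / c) = 2 * pi * hilbert_entry j l"
      using False by (simp only: hilbert_entry_def if_False)
    then show ?thesis by simp
  qed
  ultimately show ?thesis by (simp add: c_def)
qed

text \<open>Hilbert's inequality: the form is the integral of the sawtooth function, bounded by \<open>\<pi>\<close>,
  against the product of two trigonometric polynomials.\<close>

lemma hilbert_inequality:
  fixes a b :: "nat \<Rightarrow> complex"
  shows "cmod (\<Sum>j<N. \<Sum>l<N. hilbert_entry j l * a l * cnj (b j)) \<le>
    pi / 2 * ((\<Sum>j<N. (cmod (a j))\<^sup>2) + (\<Sum>j<N. (cmod (b j))\<^sup>2))"
proof -
  define e where "e = (\<lambda>(k::int) t. exp (\<i> * of_int k * complex_of_real t))"
  \<comment> \<open>The frequencies are negative, so that the product of \<open>T a\<close> with the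
    conjugate of \<open>T b\<close> carries the frequencies \<open>int j - int l\<close> of the
    matrix entries.\<close>
  define T where "T = (\<lambda>c t. \<Sum>j<N. c j * e (- int j) t)"
  have e_mult: "e k t * e k' t = e (k + k') t" for k k' t by (simp add: e_def exp_add[symmetric] algebra_simps)
  have e_cnj: "cnj (e k t) = e (- k) t" for k t by (simp add: e_def exp_cnj)
  have prod: "T c t * cnj (T d t) = (\<Sum>j<N. \<Sum>l<N. c l * cnj (d j) * e (int j - int l) t)" for c d t
  proof -
    have "T c t * cnj (T d t) = (\<Sum>l<N. \<Sum>j<N. (c l * e (- int l) t) * (cnj (d j) * e (int j) t))"
      by (simp add: T_def e_cnj sum_product)
    also have "\<dots> = (\<Sum>j<N. \<Sum>l<N. (c l * e (- int l) t) * (cnj (d j) * e (int j) t))" by (rule sum.swap)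
    also have "\<dots> = (\<Sum>j<N. \<Sum>l<N. c l * cnj (d j) * e (int j - int l) t)"
      by (intro sum.cong refl) (simp add: mult_ac e_mult)
    finally show ?thesis .
  qed
  have i1: "((\<lambda>t. T c t * cnj (T c t)) has_integral (2 * pi * (\<Sum>j<N. (cmod (c j))\<^sup>2))) {0..2 * pi}" for c
  proof -
    have "((\<lambda>t. T c t * cnj (T c t)) has_integral (\<Sum>j<N. \<Sum>l<N. c l * cnj (c j) * (if int j - int l = 0 then 2 * pi else 0))) {0..2 * pi}"
      unfolding prod e_def
      by (intro has_integral_sum has_integral_mult_right has_integral_exp_multiple) auto
    also have "(\<Sum>j<N. \<Sum>l<N. c l * cnj (c j) * complex_of_real (if int j - int l = 0 then 2 * pi else 0)) =
        (\<Sum>j<N. \<Sum>l<N. if l = j then 2 * pi * (c j * cnj (c j)) else 0)"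
      by (intro sum.cong refl) auto
    also have "\<dots> = 2 * pi * (\<Sum>j<N. (cmod (c j))\<^sup>2)"
      by (simp add: sum_distrib_left complex_norm_square del: of_real_power)
    finally show ?thesis .
  qed
  have r1: "((\<lambda>t. (cmod (T c t))\<^sup>2) has_integral (2 * pi * (\<Sum>j<N. (cmod (c j))\<^sup>2))) {0..2 * pi}" for c
    using has_integral_linear[OF i1[of c] bounded_linear_Re]
    by (simp add: o_def complex_norm_square[symmetric] flip: of_real_sum of_real_mult of_real_power)
  have i2: "((\<lambda>t. of_real (pi - t) * (T a t * cnj (T b t))) has_integral
      (2 * pi * (\<Sum>j<N. \<Sum>l<N. hilbert_entry j l * a l * cnj (b j)))) {0..2 * pi}"
  proof -
    have "((\<lambda>t. \<Sum>j<N. \<Sum>l<N. a l * cnj (b j) * (of_real (pi - t) * e (int j - int l) t)) has_integral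
        (\<Sum>j<N. \<Sum>l<N. a l * cnj (b j) * (2 * pi * hilbert_entry j l))) {0..2 * pi}"
      unfolding e_def
      by (intro has_integral_sum has_integral_mult_right has_integral_sawtooth_exp) auto
    then show ?thesis unfolding prod by (simp add: sum_distrib_left mult_ac)
  qed
  let ?A = "\<Sum>j<N. (cmod (a j))\<^sup>2" and ?B = "\<Sum>j<N. (cmod (b j))\<^sup>2"
    and ?H = "\<Sum>j<N. \<Sum>l<N. hilbert_entry j l * a l * cnj (b j)"
  have g: "((\<lambda>t. pi / 2 * ((cmod (T a t))\<^sup>2 + (cmod (T b t))\<^sup>2)) has_integral (pi / 2 * (2 * pi * ?A + 2 * pi * ?B))) {0..2 * pi}"
    by (intro has_integral_mult_right has_integral_add r1)
  \<comment> \<open>The sawtooth is at most \<open>pi\<close> in modulus, and a product of two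
    moduli is at most half the sum of their squares, whose integrals \<open>r1\<close> has
    evaluated.\<close>
  have "norm (integral {0..2 * pi} (\<lambda>t. of_real (pi - t) * (T a t * cnj (T b t)))) \<le>
      integral {0..2 * pi} (\<lambda>t. pi / 2 * ((cmod (T a t))\<^sup>2 + (cmod (T b t))\<^sup>2))"
  proof (rule integral_norm_bound_integral[OF has_integral_integrable[OF i2] has_integral_integrable[OF g]])
    fix t :: real assume t: "t \<in> {0..2 * pi}"
    have "norm (of_real (pi - t) * (T a t * cnj (T b t))) = \<bar>pi - t\<bar> * (cmod (T a t) * cmod (T b t))"
      by (simp only: norm_mult norm_of_real complex_mod_cnj)
    also have "\<dots> \<le> pi * (((cmod (T a t))\<^sup>2 + (cmod (T b t))\<^sup>2) / 2)"
    proof (rule mult_mono)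
      show "cmod (T a t) * cmod (T b t) \<le> ((cmod (T a t))\<^sup>2 + (cmod (T b t))\<^sup>2) / 2"
        using sum_squares_bound[of "cmod (T a t)" "cmod (T b t)"] by simp
    qed (use t in auto)
    finally show "norm (of_real (pi - t) * (T a t * cnj (T b t))) \<le> pi / 2 * ((cmod (T a t))\<^sup>2 + (cmod (T b t))\<^sup>2)"
      by simp
  qed
  then have "norm (2 * pi * ?H) \<le> pi / 2 * (2 * pi * ?A + 2 * pi * ?B)"
    by (simp only: integral_unique[OF i2] integral_unique[OF g])
  also have "norm (2 * pi * ?H) = 2 * pi * cmod ?H" by (simp add: norm_mult)
  also have "pi / 2 * (2 * pi * ?A + 2 * pi * ?B) = 2 * pi * (pi / 2 * (?A + ?B))" by (simp add: algebra_simps)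
  finally show ?thesis by (simp only: mult_le_cancel_left_pos[OF mult_pos_pos[OF zero_less_numeral pi_gt_zero]])
qed

text \<open>Row \<open>j\<close> of the triangle sums to \<open>harm j\<close>. Only the rows with
  \<open>M \<le> j < 2 * M\<close> are kept, each of them at least \<open>harm M\<close>.\<close>

lemma sum_triangle_lower_bound:
  "real M * harm M \<le> (\<Sum>j<2 * M. \<Sum>l<j. 1 / (real j - real l))"
proof -
  have h: "(\<Sum>l<j. 1 / (real j - real l)) = harm j" for j :: nat
  proof -
    have "(\<Sum>l<j. 1 / (real j - real l)) = (\<Sum>l<j. inverse (real (Suc (j - Suc l))))"
      by (rule sum.cong) (auto simp: of_nat_diff inverse_eq_divide)
    also have "\<dots> = (\<Sum>i<j. inverse (real (Suc i)))"
      by (rule sum.nat_diff_reindex)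
    also have "\<dots> = harm j" unfolding harm_def by (simp add: sum.atLeast1_atMost_eq del: of_nat_Suc)
    finally show ?thesis .
  qed
  have "real M * harm M = (\<Sum>j\<in>{M..<2 * M}. harm M)" by simp
  also have "\<dots> \<le> (\<Sum>j\<in>{M..<2 * M}. harm j)" by (rule sum_mono) (simp add: harm_mono)
  also have "\<dots> \<le> (\<Sum>j<2 * M. harm j)" by (rule sum_mono2) (auto simp: harm_nonneg)
  finally show ?thesis by (simp add: h)
qed

section \<open>Truncated Hilbert matrices as operators\<close>

context orthonormal
begin

definition matrix_unit :: "complex \<Rightarrow> nat \<Rightarrow> nat \<Rightarrow> ('a \<Rightarrow>\<^sub>L 'a)"
  where "matrix_unit c j l = Blinfun (\<lambda>x. (c * cinner x (\<xi> l)) *\<^sub>C \<xi> j)"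

lemma matrix_unit_apply: "matrix_unit c j l x = (c * cinner x (\<xi> l)) *\<^sub>C \<xi> j"
proof -
  have "bounded_linear (\<lambda>x. (c * cinner x (\<xi> l)) *\<^sub>C \<xi> j)"
  proof (rule bounded_linear_intro[of _ "cmod c * norm (\<xi> l) * norm (\<xi> j)"])
    fix x
    have "norm ((c * cinner x (\<xi> l)) *\<^sub>C \<xi> j) = cmod c * cmod (cinner x (\<xi> l)) * norm (\<xi> j)"
      by (simp add: norm_scaleC norm_mult)
    also have "\<dots> \<le> cmod c * (norm x * norm (\<xi> l)) * norm (\<xi> j)"
      by (intro mult_right_mono mult_left_mono cmod_cinner_le) auto
    finally show "norm ((c * cinner x (\<xi> l)) *\<^sub>C \<xi> j) \<le> norm x * (cmod c * norm (\<xi> l) * norm (\<xi> j))"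
      by (simp add: mult_ac)
  qed (simp_all add: cinner_simps scaleR_eq_scaleC scaleC_scaleC distrib_left scaleC_add_left mult_ac)
  then show ?thesis by (simp add: matrix_unit_def bounded_linear_Blinfun_apply)
qed

lemma matrix_unit_bounded_operators: "matrix_unit c j l \<in> bounded_operators"
  by (simp add: bounded_operators_iff matrix_unit_apply cinner_simps scaleC_scaleC mult_ac)

definition hilbert_op :: "nat \<Rightarrow> ('a \<Rightarrow>\<^sub>L 'a)"
  where "hilbert_op N = (\<Sum>j<N. \<Sum>l<N. matrix_unit (hilbert_entry j l) j l)"

lemma hilbert_op_bounded_operators: "hilbert_op N \<in> bounded_operators"
  unfolding hilbert_op_def by (intro subspace_sum[OF subspace_bounded_operators] matrix_unit_bounded_operators)

lemma cinner_hilbert_op: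
  "cinner (hilbert_op N x) y = (\<Sum>j<N. \<Sum>l<N. hilbert_entry j l * cinner x (\<xi> l) * cnj (cinner y (\<xi> j)))"
  by (simp add: hilbert_op_def blinfun.sum_left matrix_unit_apply cinner_simps cinner_commute[of "\<xi> _" y])

lemma norm_hilbert_op:
  assumes \<omega>: "\<omega> = \<infinity>"
  shows "norm (hilbert_op N) \<le> pi"
proof (rule norm_blinfun_bound)
  fix x
  show "norm (hilbert_op N x) \<le> pi * norm x"
  proof (cases "hilbert_op N x = 0")
    case False
    define y where "y = hilbert_op N x"
    have x0: "x \<noteq> 0" using False by (auto simp: blinfun.bilinear_simps)
    have y0: "y \<noteq> 0" using False by (simp add: y_def)
    \<comment> \<open>For unit vectors the two sums of squares are at most 1 each, so the bound
      becomes \<open>pi\<close>; homogeneity then gives the operator norm.\<close>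
    define x' y' where "x' = (1 / norm x) *\<^sub>R x" and "y' = (1 / norm y) *\<^sub>R y"
    have n: "norm x' = 1" "norm y' = 1" using x0 y0 by (simp_all add: x'_def y'_def)
    have b: "(\<Sum>j<N. (cmod (cinner z (\<xi> j)))\<^sup>2) \<le> (norm z)\<^sup>2" for z
      by (rule bessel) (simp_all add: \<omega>)
    have "cinner (hilbert_op N x') y' = of_real (norm y / norm x)"
      using y0 by (simp add: x'_def y'_def blinfun.bilinear_simps cinner_simps y_def[symmetric] cinner_self power2_eq_square)
    then have "norm y / norm x = cmod (cinner (hilbert_op N x') y')" by (simp add: norm_divide)
    also have "\<dots> \<le> pi / 2 * ((\<Sum>j<N. (cmod (cinner x' (\<xi> j)))\<^sup>2) + (\<Sum>j<N. (cmod (cinner y' (\<xi> j)))\<^sup>2))"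
      unfolding cinner_hilbert_op by (rule hilbert_inequality)
    also have "\<dots> \<le> pi / 2 * ((norm x')\<^sup>2 + (norm y')\<^sup>2)"
      by (intro mult_left_mono add_mono b) auto
    also have "\<dots> = pi" by (simp add: n)
    finally show ?thesis using x0 by (simp add: y_def pos_divide_le_eq)
  qed simp
qed simp

lemma hilbert_op_entry:
  assumes \<omega>: "\<omega> = \<infinity>"
  shows "cinner (hilbert_op N (\<xi> l)) (\<xi> j) = (if j < N \<and> l < N then hilbert_entry j l else 0)"
proof -
  have "cinner (hilbert_op N (\<xi> l)) (\<xi> j) = (\<Sum>i<N. \<Sum>k<N. if k = l then (if i = j then hilbert_entry i k else 0) else 0)"
    unfolding cinner_hilbert_op by (intro sum.cong refl) (auto simp: ortho \<omega>)
  also have "\<dots> = (if l < N then \<Sum>i<N. if i = j then hilbert_entry i l else 0 else 0)"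
    by simp
  also have "\<dots> = (if j < N \<and> l < N then hilbert_entry j l else 0)"
    by simp
  finally show ?thesis .
qed

text \<open>In a decomposition \<open>X = u + v + w\<close> of a self-adjoint \<open>X\<close> with zero diagonal, \<open>w\<close> is twice the upper
  triangular part of \<open>X\<close>. The truncated Hilbert matrices are uniformly bounded, their triangular
  parts grow like \<open>ln N\<close>, and their entries have the same phase, so the terms of a convergent series
  of such matrices cannot cancel.\<close>

lemma not_direct_sum_if_infinite:
  assumes \<omega>: "\<omega> = \<infinity>"
  shows "\<not> direct_sum3 k_algebra (a_algebra \<omega> \<xi>) (n_algebra \<omega> \<xi>) bounded_operators"
proof
  assume ds: "direct_sum3 k_algebra (a_algebra \<omega> \<xi>) (n_algebra \<omega> \<xi>) bounded_operators"
  \<comment> \<open>The weights \<open>(1 / 2) ^ n\<close> make the series for \<open>X\<close>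
    converge; harmonic numbers of size \<open>4 ^ n\<close> overcome them and leave
    \<open>2 ^ n\<close>.\<close>
  have "\<exists>M. M > 0 \<and> harm M \<ge> (4::real) ^ n" for n
  proof -
    have "\<forall>\<^sub>F M in sequentially. (4::real) ^ n \<le> harm M" using harm_at_top filterlim_at_top by blast
    then have "\<forall>\<^sub>F M in sequentially. M > 0 \<and> (4::real) ^ n \<le> harm M"
      using eventually_gt_at_top[of "0::nat"] by eventually_elim simp
    then show ?thesis by (rule eventually_happens'[OF sequentially_bot])
  qed
  then obtain M :: "nat \<Rightarrow> nat" where M: "\<And>n. M n > 0" "\<And>n. harm (M n) \<ge> (4::real) ^ n" by metis
  let ?t = "\<lambda>n. (1 / 2) ^ n *\<^sub>R hilbert_op (2 * M n)"
  have st: "summable ?t"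
  proof (rule summable_comparison_test)
    show "summable (\<lambda>n. pi * (1 / 2 :: real) ^ n)" by (intro summable_mult summable_geometric) simp
    have "norm (?t n) \<le> pi * (1 / 2) ^ n" for n
      using mult_right_mono[OF norm_hilbert_op[OF \<omega>, of "2 * M n"], of "(1 / 2) ^ n"] by (simp add: mult.commute)
    then show "\<exists>N. \<forall>n\<ge>N. norm (?t n) \<le> pi * (1 / 2) ^ n" by blast
  qed
  define X where "X = suminf ?t"
  have "X \<in> bounded_operators"
    unfolding X_def
    by (rule suminf_in_closed_subspace[OF closed_bounded_operators subspace_bounded_operators st])
      (intro subspace_scale[OF subspace_bounded_operators] hilbert_op_bounded_operators)
  then obtain u v w where uvw: "u \<in> k_algebra" "v \<in> a_algebra \<omega> \<xi>" "w \<in> n_algebra \<omega> \<xi>" "X = u + v + w"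
    using ds unfolding direct_sum3_def by blast
  \<comment> \<open>\<open>s j l\<close> collects the weights of all truncations that contain the
    entry. The weights are nonnegative, so each single one bounds the sum from below.\<close>
  define s where "s = (\<lambda>j l. \<Sum>n. (1 / 2 :: real) ^ n * (if j < 2 * M n \<and> l < 2 * M n then 1 else 0))"
  have ss: "summable (\<lambda>n. (1 / 2 :: real) ^ n * (if j < 2 * M n \<and> l < 2 * M n then 1 else 0))" for j l
    by (rule summable_comparison_test[OF _ summable_geometric[of "1 / 2 :: real"]]) auto
  have s_lower: "(1 / 2) ^ n \<le> s j l" if "j < 2 * M n" "l < 2 * M n" for n j l
  proof -
    have "(\<Sum>i\<in>{n}. (1 / 2 :: real) ^ i * (if j < 2 * M i \<and> l < 2 * M i then 1 else 0)) \<le> s j l"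
      unfolding s_def by (rule sum_le_suminf[OF ss]) auto
    then show ?thesis using that by simp
  qed
  have X_entry: "cinner (X (\<xi> l)) (\<xi> j) = of_real (s j l) * hilbert_entry j l" for j l
  proof -
    have bl: "bounded_linear (\<lambda>T::'a \<Rightarrow>\<^sub>L 'a. cinner (T (\<xi> l)) (\<xi> j))"
      by (rule bounded_linear_compose[OF bounded_linear_cinner_left blinfun.bounded_linear_left])
    have "cinner (X (\<xi> l)) (\<xi> j) = (\<Sum>n. cinner (?t n (\<xi> l)) (\<xi> j))"
      unfolding X_def by (rule bounded_linear.suminf[OF bl st])
    also have "\<dots> = (\<Sum>n. complex_of_real ((1 / 2) ^ n * (if j < 2 * M n \<and> l < 2 * M n then 1 else 0)) * hilbert_entry j l)"
      by (rule arg_cong[where f = suminf]) (auto simp: blinfun.bilinear_simps cinner_simps hilbert_op_entry[OF \<omega>])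
    also have "\<dots> = of_real (s j l) * hilbert_entry j l"
    proof -
      have "(\<lambda>n. complex_of_real ((1 / 2) ^ n * (if j < 2 * M n \<and> l < 2 * M n then 1 else 0))) sums of_real (s j l)"
        unfolding s_def by (rule bounded_linear.sums[OF bounded_linear_of_real summable_sums[OF ss]])
      from sums_mult2[OF this, of "hilbert_entry j l"] show ?thesis by (rule sums_unique[symmetric])
    qed
    finally show ?thesis .
  qed
  have s_sym: "s l j = s j l" for j l unfolding s_def by (simp add: conj_commute)
  have skew: "cinner (u x) y = - cnj (cinner (u y) x)" for x y
    using cinner_adj[of u x y] cinner_commute[of x "u y"] uvw(1)
    by (simp add: k_algebra_iff blinfun.bilinear_simps cinner_simps)
  have v0: "cinner (v (\<xi> j)) (\<xi> l) = 0" if "j \<noteq> l" for j l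
  proof -
    have "enat j < \<omega>" by (simp add: \<omega>)
    then obtain r :: real where "v (\<xi> j) = r *\<^sub>R \<xi> j" using uvw(2) by (auto simp: a_algebra_iff)
    then show ?thesis using that \<omega> by (simp add: cinner_simps ortho)
  qed
  have w0: "cinner (w (\<xi> j)) (\<xi> l) = 0" if "j \<le> l" for j l
  proof (rule flag_coefficient_zero[OF _ that])
    have "enat j < \<omega>" by (simp add: \<omega>)
    then show "w (\<xi> j) \<in> flag j" using uvw(3) by (simp add: n_algebra_iff)
  qed (simp add: \<omega>)
  have X_sum: "cinner (X x) y = cinner (u x) y + cinner (v x) y + cinner (w x) y" for x y
    by (simp add: uvw(4) blinfun.bilinear_simps cinner_simps)
  \<comment> \<open>Below the diagonal \<open>X\<close> and \<open>u\<close> have the same entries.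
    Since \<open>X\<close> is Hermitian and \<open>u\<close> is skew, \<open>u\<close> is the
    negative of \<open>X\<close> above the diagonal, so that \<open>X - u\<close> is twice
    \<open>X\<close> there.\<close>
  have w_entry: "Im (cinner (w (\<xi> j)) (\<xi> l)) = - (2 * s j l / (real j - real l))" if lj: "l < j" for j l
  proof -
    have "cinner (u (\<xi> l)) (\<xi> j) = of_real (s j l) * hilbert_entry j l"
      using X_sum[of "\<xi> l" "\<xi> j"] v0[of l j] w0[of l j] lj X_entry[of l j] by simp
    then have "cinner (u (\<xi> j)) (\<xi> l) = - cnj (of_real (s j l) * hilbert_entry j l)" using skew[of "\<xi> j" "\<xi> l"] by simp
    moreover have "cinner (u (\<xi> j)) (\<xi> l) + cinner (w (\<xi> j)) (\<xi> l) = of_real (s j l) * - hilbert_entry j l"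
      using X_sum[of "\<xi> j" "\<xi> l"] v0[of j l] lj X_entry[of j l] s_sym[of j l] hilbert_entry_swap[of l j] by simp
    ultimately have "cinner (w (\<xi> j)) (\<xi> l) = of_real (s j l) * (cnj (hilbert_entry j l) - hilbert_entry j l)"
      by (simp add: algebra_simps eq_diff_eq)
    moreover have "hilbert_entry j l = of_real (1 / (real j - real l)) * \<i>"
      using lj by (simp add: hilbert_entry_def)
    ultimately show ?thesis by (simp add: algebra_simps)
  qed
  have "2 ^ n \<le> norm w" for n
  proof -
    define N where "N = 2 * M n"
    \<comment> \<open>Testing \<open>w\<close> on the constant vector of length \<open>N\<close>
      sums the entries of the block, whose imaginary parts all have one sign. The squared norm of
      \<open>z\<close> is \<open>N\<close>, so this sum is at most \<open>N\<close> times
      \<open>norm w\<close>.\<close>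
    define z where "z = (\<Sum>j<N. \<xi> j)"
    have nz: "(norm z)\<^sup>2 = real N"
      using norm_sum_orthogonal[of "{..<N}" \<xi> "\<lambda>_. 1"] \<omega> by (simp add: z_def ortho)
    have "cinner (w z) z = (\<Sum>j<N. \<Sum>l<N. cinner (w (\<xi> j)) (\<xi> l))"
      by (simp add: z_def blinfun.sum_right cinner_simps) (rule sum.swap)
    then have "Im (cinner (w z) z) = (\<Sum>j<N. \<Sum>l<N. Im (cinner (w (\<xi> j)) (\<xi> l)))" by simp
    also have "\<dots> = (\<Sum>j<N. \<Sum>l<j. - (2 * s j l / (real j - real l)))"
    proof (rule sum.cong[OF refl])
      fix j assume "j \<in> {..<N}"
      have "(\<Sum>l<N. Im (cinner (w (\<xi> j)) (\<xi> l))) = (\<Sum>l<j. Im (cinner (w (\<xi> j)) (\<xi> l)))"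
        by (rule sum.mono_neutral_right) (use \<open>j \<in> {..<N}\<close> w0 in auto)
      also have "\<dots> = (\<Sum>l<j. - (2 * s j l / (real j - real l)))"
        by (rule sum.cong) (use w_entry in auto)
      finally show "(\<Sum>l<N. Im (cinner (w (\<xi> j)) (\<xi> l))) = (\<Sum>l<j. - (2 * s j l / (real j - real l)))" .
    qed
    also have "\<dots> = - (\<Sum>j<N. \<Sum>l<j. 2 * s j l / (real j - real l))" by (simp add: sum_negf)
    finally have Im: "- Im (cinner (w z) z) = (\<Sum>j<N. \<Sum>l<j. 2 * s j l / (real j - real l))" by simp
    have "2 * (1 / 2) ^ n * (real (M n) * 4 ^ n) \<le> 2 * (1 / 2) ^ n * (\<Sum>j<N. \<Sum>l<j. 1 / (real j - real l))"
      using order_trans[OF mult_left_mono[OF M(2)[of n], of "real (M n)"] sum_triangle_lower_bound[of "M n"]]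
      by (intro mult_left_mono) (auto simp: N_def)
    also have "\<dots> = (\<Sum>j<N. \<Sum>l<j. 2 * (1 / 2) ^ n / (real j - real l))" by (simp add: sum_distrib_left)
    also have "\<dots> \<le> (\<Sum>j<N. \<Sum>l<j. 2 * s j l / (real j - real l))"
      by (intro sum_mono divide_right_mono mult_left_mono s_lower) (auto simp: N_def)
    also have "\<dots> \<le> cmod (cinner (w z) z)" unfolding Im[symmetric] using abs_Im_le_cmod[of "cinner (w z) z"] by linarith
    also have "\<dots> \<le> norm (w z) * norm z" by (rule cmod_cinner_le)
    also have "\<dots> \<le> (norm w * norm z) * norm z" by (intro mult_right_mono norm_blinfun) auto
    also have "\<dots> = norm w * real N" using nz by (simp add: power2_eq_square)
    finally have "2 * real (M n) * ((1 / 2) ^ n * 4 ^ n) \<le> 2 * real (M n) * norm w" by (simp add: N_def mult_ac)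
    then have "(1 / 2) ^ n * 4 ^ n \<le> norm w" using M(1)[of n] by simp
    then show ?thesis by (simp add: power_mult_distrib[symmetric])
  qed
  moreover obtain n where "norm w < 2 ^ n" using real_arch_pow[of 2 "norm w"] by auto
  ultimately show False by (meson not_le)
qed

end

theorem proposition1p1:
  fixes \<omega> :: enat and \<xi> :: "nat \<Rightarrow> 'a::complex_hilbert"
  assumes "separable_space (euclidean :: 'a topology)"
    and "orthonormal_basis \<omega> \<xi>"
  shows "\<exists>MK MA MN.
    (lie_group_structure K_group k_algebra MK \<and>
     lie_group_structure (A_group \<omega> \<xi>) (a_algebra \<omega> \<xi>) MA \<and>
     lie_group_structure (N_group \<omega> \<xi>) (n_algebra \<omega> \<xi>) MN \<and>
     smooth_map (prod_manifold MK (prod_manifold MA MN))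
       (open_submanifold bounded_operators (carrier GL)) iwasawa_mult \<and>
     bij_betw iwasawa_mult (K_group \<times> A_group \<omega> \<xi> \<times> N_group \<omega> \<xi>) (carrier GL)) \<and>
    ((diffeo (prod_manifold MK (prod_manifold MA MN))
        (open_submanifold bounded_operators (carrier GL)) iwasawa_mult \<longleftrightarrow>
      direct_sum3 k_algebra (a_algebra \<omega> \<xi>) (n_algebra \<omega> \<xi>) bounded_operators) \<and>
     (direct_sum3 k_algebra (a_algebra \<omega> \<xi>) (n_algebra \<omega> \<xi>) bounded_operators \<longleftrightarrow>
      finite_dimensional TYPE('a)))"
proof -
  interpret orthonormal \<omega> \<xi> by (rule orthonormal.intro) (rule assms(2))
  let ?D = "direct_sum3 k_algebra (a_algebra \<omega> \<xi>) (n_algebra \<omega> \<xi>) bounded_operators"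
  have fin: "diffeo KAN_manifold GL_manifold iwasawa_mult" if "finite_dimensional TYPE('a)"
  proof -
    have "\<omega> \<noteq> \<infinity>" using that finite_dimensional_iff by simp
    then obtain m where "\<omega> = enat m" by (cases \<omega>) auto
    then show ?thesis by (rule diffeo_if_finite)
  qed
  have "finite_dimensional TYPE('a)" if ?D
    using that not_direct_sum_if_infinite finite_dimensional_iff by blast
  then have "(diffeo KAN_manifold GL_manifold iwasawa_mult \<longleftrightarrow> ?D) \<and> (?D \<longleftrightarrow> finite_dimensional TYPE('a))"
    using fin direct_sum_if_diffeo by blast
  then show ?thesis
    using lie_group_structure_K lie_group_structure_A lie_group_structure_N smooth_iwasawa_mult bij_betw_iwasawa
    by (intro exI[of _ K_manifold] exI[of _ A_manifold] exI[of _ N_manifold] conjI) blast+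
qed

end
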